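(* On any countable amenable group $G$ there exists a uniformly Følner multiorder $(\tilde{\mathcal O},\nu,G)$ of (Kolmogorov–Sinai) entropy zero.
   Context: A countable amenable group means an infinite countable discrete group $G$ in which there is a Følner sequence, i.e. a sequence of finite subsets $F_n\subset G$ with $\lim_n |F_n\cap gF_n|/|F_n|=1$ for every $g\in G$. A linear order $\prec$ on $G$ is of type $\mathbb Z$ if every order interval $[a,b]^{\prec}=\{a,b\}\cup\{g\in G: a\prec g\prec b\}$ ($a\prec b$) is finite and $G$ has no minimal or maximal element. The set $\tilde{\mathcal O}$ of all orders of type $\mathbb Z$ on $G$ is a Borel subset of $\{0,1\}^{G\times G}$ (relations identified with their indicator functions, product topology), with the inherited Borel sigma-algebra. $G$ acts on $\tilde{\mathcal O}$ by: $\prec'=g(\prec)$ where $a\prec' b\iff ag\prec bg$. A multiorder on $G$ is the measure-preserving action $(\tilde{\mathcal O},\nu,G)$, where $\nu$ is a $G$-invariant Borel probability measure on $\tilde{\mathcal O}$. For finite $K\subset G$ and $\varepsilon>0$, a finite set $A\subset G$ is $(K,\varepsilon)$-invariant if $|A\triangle KA|/|A|<\varepsilon$. A multiorder is uniformly Følner if for any finite $K\subset G$ and $\varepsilon>0$ there exists $n\in\mathbb N$ such that for $\nu$-almost every $\prec\,\in\tilde{\mathcal O}$, any order interval $[a,b]^{\prec}$ of length (cardinality) at least $n$ is $(K,\varepsilon)$-invariant. The entropy of the multiorder is $h(\nu,G)=\sup_{\mathcal P}\lim_n\frac1{|F_n|}H\bigl(\nu,\bigvee_{g\in F_n}g^{-1}(\mathcal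 P)\bigr)$, where the supremum is over finite measurable partitions, $H$ is Shannon entropy and $(F_n)$ is any Følner sequence. *)

theory Defs
  imports "HOL-Algebra.Coset" "HOL-Probability.Probability"
begin

definition folner_sequence :: "('a, 'b) monoid_scheme \<Rightarrow> (nat \<Rightarrow> 'a set) \<Rightarrow> bool" where
  "folner_sequence G F \<longleftrightarrow>
     (\<forall>n. finite (F n) \<and> F n \<noteq> {} \<and> F n \<subseteq> carrier G) \<and>
     (\<forall>g\<in>carrier G.
        (\<lambda>n. real (card (F n \<inter> (g <#\<^bsub>G\<^esub> F n))) / real (card (F n))) \<longlonglongrightarrow> 1)"

definition countable_amenable_group :: "('a, 'b) monoid_scheme \<Rightarrow> bool" where
  "countable_amenable_group G \<longleftrightarrow>
     group G \<and> infinite (carrier G) \<and> countable (carrier G) \<and> (\<exists>F. folner_sequence G F)"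

definition order_interval :: "('a, 'b) monoid_scheme \<Rightarrow> 'a rel \<Rightarrow> 'a \<Rightarrow> 'a \<Rightarrow> 'a set" where
  "order_interval G r a b = {a, b} \<union> {g \<in> carrier G. (a, g) \<in> r \<and> (g, b) \<in> r}"

definition Z_orders :: "('a, 'b) monoid_scheme \<Rightarrow> 'a rel set" where
  "Z_orders G = {r. r \<subseteq> carrier G \<times> carrier G \<and> strict_linear_order_on (carrier G) r \<and>
     (\<forall>a b. (a, b) \<in> r \<longrightarrow> finite (order_interval G r a b)) \<and>
     (\<forall>a\<in>carrier G. (\<exists>b\<in>carrier G. (b, a) \<in> r) \<and> (\<exists>b\<in>carrier G. (a, b) \<in> r))}"

text \<open>A relation is identified with its indicator function, a point of the product space
  \<open>'a \<times> 'a \<Rightarrow> bool\<close>, where \<open>bool\<close> plays the role of the discrete space \<open>{0,1}\<close>. Elements of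
  \<open>Z_orders G\<close> vanish off \<open>carrier G \<times> carrier G\<close>, and the functions with this property form a
  closed subspace homeomorphic to the product of copies of \<open>{0,1}\<close> over
  \<open>carrier G \<times> carrier G\<close>. So this is the Borel sigma-algebra inherited from the latter.\<close>

definition Z_order_space :: "('a, 'b) monoid_scheme \<Rightarrow> 'a rel measure" where
  "Z_order_space G =
     vimage_algebra (Z_orders G) (\<lambda>r p. p \<in> r) (borel :: ('a \<times> 'a \<Rightarrow> bool) measure)"

definition order_action :: "('a, 'b) monoid_scheme \<Rightarrow> 'a \<Rightarrow> 'a rel \<Rightarrow> 'a rel" where
  "order_action G g r =
     {(a, b) \<in> carrier G \<times> carrier G. (a \<otimes>\<^bsub>G\<^esub> g, b \<otimes>\<^bsub>G\<^esub> g) \<in> r}"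

definition multiorder :: "('a, 'b) monoid_scheme \<Rightarrow> 'a rel measure \<Rightarrow> bool" where
  "multiorder G \<nu> \<longleftrightarrow>
     prob_space \<nu> \<and> space \<nu> = Z_orders G \<and> sets \<nu> = sets (Z_order_space G) \<and>
     (\<forall>g\<in>carrier G. order_action G g \<in> measurable \<nu> \<nu> \<and> distr \<nu> \<nu> (order_action G g) = \<nu>)"

definition set_invariant :: "('a, 'b) monoid_scheme \<Rightarrow> 'a set \<Rightarrow> real \<Rightarrow> 'a set \<Rightarrow> bool" where
  "set_invariant G K \<epsilon> A \<longleftrightarrow>
     real (card (sym_diff A (K <#>\<^bsub>G\<^esub> A))) / real (card A) < \<epsilon>"

text \<open>The set \<open>K\<close> has to be nonempty: for \<open>K = {}\<close> the ratio in \<open>set_invariant\<close> is always 1.\<close>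

definition uniformly_folner :: "('a, 'b) monoid_scheme \<Rightarrow> 'a rel measure \<Rightarrow> bool" where
  "uniformly_folner G \<nu> \<longleftrightarrow>
     (\<forall>K \<epsilon>. finite K \<and> K \<noteq> {} \<and> K \<subseteq> carrier G \<and> 0 < \<epsilon> \<longrightarrow>
        (\<exists>n::nat. AE r in \<nu>. \<forall>a b. (a, b) \<in> r \<and> n \<le> card (order_interval G r a b) \<longrightarrow>
           set_invariant G K \<epsilon> (order_interval G r a b)))"

definition finite_measurable_partition :: "'x measure \<Rightarrow> 'x set set \<Rightarrow> bool" where
  "finite_measurable_partition M P \<longleftrightarrow> finite P \<and> P \<subseteq> sets M \<and> partition_on (space M) P"

definition shannon_entropy :: "'x measure \<Rightarrow> 'x set set \<Rightarrow> real" where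
  "shannon_entropy M P = - (\<Sum>A\<in>P. measure M A * ln (measure M A))"

definition partition_preimage :: "'x measure \<Rightarrow> ('x \<Rightarrow> 'x) \<Rightarrow> 'x set set \<Rightarrow> 'x set set" where
  "partition_preimage M f P = (\<lambda>A. f -` A \<inter> space M) ` P"

definition partition_join ::
  "'x measure \<Rightarrow> ('a \<Rightarrow> 'x \<Rightarrow> 'x) \<Rightarrow> 'a set \<Rightarrow> 'x set set \<Rightarrow> 'x set set" where
  "partition_join M act F P = common_refinement ((\<lambda>g. partition_preimage M (act g) P) ` F)"

text \<open>The value \<open>h\<close> must be obtained along every Folner sequence, and existence of the limits
  is part of the definition.\<close>

definition has_ks_entropy ::
  "('a, 'b) monoid_scheme \<Rightarrow> 'x measure \<Rightarrow> ('a \<Rightarrow> 'x \<Rightarrow> 'x) \<Rightarrow> ereal \<Rightarrow> bool" where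
  "has_ks_entropy G M act h \<longleftrightarrow>
     (\<forall>F. folner_sequence G F \<longrightarrow>
        (\<exists>L :: 'x set set \<Rightarrow> real.
           (\<forall>P. finite_measurable_partition M P \<longrightarrow>
              (\<lambda>n. shannon_entropy M (partition_join M act (F n) P) / real (card (F n)))
                \<longlonglongrightarrow> L P) \<and>
           h = (SUP P\<in>{P. finite_measurable_partition M P}. ereal (L P))))"

end

theory Submission
  imports Defs "HOL-Library.Sublist" "HOL-Real_Asymp.Real_Asymp"
begin

text \<open>
  Orders of type \<open>\<int>\<close> are obtained as limits of finite lists. Construct distinct lists \<open>X n\<close> in \<open>G\<close> that
  enumerate ever more invariant sets and are, for every \<open>k \<le> n\<close>, concatenations of tiles of level
  \<open>k\<close>; up to a small error \<open>\<epsilon> k\<close>, each such tile is a right translate, with its order, of one of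
  finitely many lists with an \<open>(E k, \<epsilon> k)\<close>-invariant range. To pass from one level to the next,
  quasi-tile a large invariant set by translates of lists of the current level (Ornstein and Weiss).
  Only tiles that are not damaged by overlaps are kept, and the few uncovered points are inserted
  anywhere into the kept tiles. As the place of insertion is irrelevant, exact concatenations are
  obtained without any matching argument.

  Seen from a random element of \<open>X n\<close>, these lists are random orders whose laws are nearly invariant
  under translation, and \<open>\<nu>\<close> is a weak limit of the laws. An interval that is long compared with the
  tiles of level \<open>k\<close> is almost a union of such tiles, which makes it almost invariant with bounds
  depending on \<open>k\<close> only. The entropy vanishes because the order in a large window is, up to a small
  fraction of errors, determined by the positions of the tiles of level \<open>k\<close>; these are so large,
  compared with the number of their shapes, that there are few configurations of positions.
\<close>

section \<open>Almost invariant sets and quasi-tilings\<close>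

context group begin

text \<open>The action sends \<open>a\<close> to \<open>a \<otimes> g\<close>, so seen from
  \<open>g\<close> a list orders \<open>a\<close> before \<open>b\<close> when
  \<open>a \<otimes> g\<close> precedes \<open>b \<otimes> g\<close>, and passing from
  \<open>g\<close> to \<open>h \<otimes> g\<close> is the action of \<open>h\<close>. Hence
  invariance is measured under left multiplication, while tiles are right translates. Exact
  concatenations are essential because every long interval has to be almost invariant: a mere bound
  on the density of stray points would not exclude an interval consisting of strays. To remove the
  strays at all levels at once, the induction carries a reserve: half of the length lies in tiles
  that can still take up points, and a tile inherits this ability from the tiles inside it. The
  number of shapes of a level depends only on errors fixed at the level before; their minimal length
  is chosen afterwards. So the logarithm of the number is negligible against the length, which is
  where entropy zero comes from. The limit has type \<int> because two given points lie, outside a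
  set of probability of order \<open>\<epsilon> k\<close>, in one tile of level \<open>k\<close>,
  whose length is bounded, and because invariance forbids extreme elements.\<close>

abbreviation rtrans :: "'a set \<Rightarrow> 'a \<Rightarrow> 'a set" where
  "rtrans A c \<equiv> (\<lambda>x. x \<otimes> c) ` A"

abbreviation lrtrans :: "'a list \<Rightarrow> 'a \<Rightarrow> 'a list" where
  "lrtrans L c \<equiv> map (\<lambda>x. x \<otimes> c) L"

definition escape :: "'a \<Rightarrow> 'a set \<Rightarrow> 'a set" where
  "escape g A = {x \<in> A. g \<otimes> x \<notin> A}"

definition almost_inv :: "'a set \<Rightarrow> real \<Rightarrow> 'a set \<Rightarrow> bool" where
  "almost_inv K e A \<longleftrightarrow> finite A \<and> A \<noteq> {} \<and> A \<subseteq> carrier G \<and>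
     (\<forall>g\<in>K. real (card (escape g A)) \<le> e * real (card A))"

lemma escape_subset: "escape g A \<subseteq> A"
  by (auto simp: escape_def)

lemma inj_on_rtrans: "A \<subseteq> carrier G \<Longrightarrow> c \<in> carrier G \<Longrightarrow> inj_on (\<lambda>x. x \<otimes> c) A"
  by (auto simp: inj_on_def subset_iff)

lemma inj_on_ltrans: "A \<subseteq> carrier G \<Longrightarrow> c \<in> carrier G \<Longrightarrow> inj_on (\<lambda>x. c \<otimes> x) A"
  by (auto simp: inj_on_def subset_iff)

lemma card_rtrans: "A \<subseteq> carrier G \<Longrightarrow> c \<in> carrier G \<Longrightarrow> card (rtrans A c) = card A"
  by (simp add: card_image inj_on_rtrans)

lemma rtrans_mem_iff:
  "A \<subseteq> carrier G \<Longrightarrow> c \<in> carrier G \<Longrightarrow> x \<in> carrier G \<Longrightarrow> x \<otimes> c \<in> rtrans A c \<longleftrightarrow> x \<in> A"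
  by (auto simp: subset_iff)

text \<open>Left and right multiplication commute, so a set and its right translates have the same
  escape counts: almost invariance is checked once for a shape and holds for all its
  translates.\<close>

lemma escape_rtrans:
  assumes "A \<subseteq> carrier G" "c \<in> carrier G" "g \<in> carrier G"
  shows "escape g (rtrans A c) = rtrans (escape g A) c"
proof -
  have "g \<otimes> (x \<otimes> c) \<in> rtrans A c \<longleftrightarrow> g \<otimes> x \<in> A" if "x \<in> A" for x
    using rtrans_mem_iff[of A c "g \<otimes> x"] assms that by (auto simp: m_assoc[symmetric] subset_iff)
  then show ?thesis
    unfolding escape_def by blast
qed

lemma almost_inv_mono:
  assumes "almost_inv K e A" "K' \<subseteq> K" "e \<le> e'"
  shows "almost_inv K' e' A"
proof -
  have "e * real (card A) \<le> e' * real (card A)"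
    using assms(3) by (simp add: mult_right_mono)
  then show ?thesis
    using assms(1,2) unfolding almost_inv_def by (meson order_trans subsetD)
qed

definition coverage :: "(nat \<times> 'a \<times> 'a set) set \<Rightarrow> 'a set" where
  "coverage Q = (\<Union>p\<in>Q. snd (snd p))"

text \<open>A triple holds the index of a shape, the centre of a translate and the part retained
  from it. The retained parts are disjoint, which serves counting; by the last clause the coverage
  is also the union of the full translates, so its boundary is controlled by the invariance of whole
  shapes and not of the irregular retained parts.\<close>

definition packing :: "(nat \<Rightarrow> 'a set) \<Rightarrow> nat set \<Rightarrow> 'a set \<Rightarrow> real \<Rightarrow> (nat \<times> 'a \<times> 'a set) set \<Rightarrow> bool" where
  "packing F I B e Q \<longleftrightarrow> finite Q \<and>
     (\<forall>(i, c, P)\<in>Q. i \<in> I \<and> c \<in> carrier G \<and> P \<subseteq> rtrans (F i) c \<and> rtrans (F i) c \<subseteq> B \<and>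
        real (card (rtrans (F i) c - P)) \<le> e * real (card (F i))) \<and>
     (\<forall>p\<in>Q. \<forall>q\<in>Q. p \<noteq> q \<longrightarrow> snd (snd p) \<inter> snd (snd q) = {}) \<and>
     (\<forall>(i, c, P)\<in>Q. rtrans (F i) c \<subseteq> coverage Q)"

lemma packingD:
  assumes "packing F I B e Q" "(i, c, P) \<in> Q"
  shows "i \<in> I" "c \<in> carrier G" "P \<subseteq> rtrans (F i) c" "rtrans (F i) c \<subseteq> B"
    "real (card (rtrans (F i) c - P)) \<le> e * real (card (F i))" "rtrans (F i) c \<subseteq> coverage Q"
  using assms unfolding packing_def by fast+

lemma packing_coverage_subset: "packing F I B e Q \<Longrightarrow> coverage Q \<subseteq> B"
  unfolding packing_def coverage_def by fastforce

lemma packing_mono: "packing F I B e Q \<Longrightarrow> I \<subseteq> J \<Longrightarrow> packing F J B e Q"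
  unfolding packing_def case_prod_unfold by (meson subsetD)

lemma packing_insert:
  assumes pk: "packing F I B e Q" and B: "finite B" and i: "i \<in> I" and c: "c \<in> carrier G"
    and sub: "rtrans (F i) c \<subseteq> B"
    and few: "real (card (rtrans (F i) c \<inter> coverage Q)) \<le> e * real (card (F i))"
  shows "packing F I B e (insert (i, c, rtrans (F i) c - coverage Q) Q)"
proof -
  let ?P = "rtrans (F i) c - coverage Q"
  have eq: "rtrans (F i) c - ?P = rtrans (F i) c \<inter> coverage Q"
    by blast
  have cov: "coverage (insert (i, c, ?P) Q) = coverage Q \<union> rtrans (F i) c"
    by (auto simp: coverage_def)
  have disj: "snd (snd p) \<inter> ?P = {}" if "p \<in> Q" for p
    using that by (auto simp: coverage_def)
  show ?thesis
    unfolding packing_def cov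
  proof (intro conjI)
    show "finite (insert (i, c, ?P) Q)"
      using pk by (auto simp: packing_def)
    show "\<forall>(i, c, P)\<in>insert (i, c, ?P) Q. i \<in> I \<and> c \<in> carrier G \<and> P \<subseteq> rtrans (F i) c \<and>
        rtrans (F i) c \<subseteq> B \<and> real (card (rtrans (F i) c - P)) \<le> e * real (card (F i))"
      using pk i c sub few eq by (auto simp: packing_def)
    show "\<forall>p\<in>insert (i, c, ?P) Q. \<forall>q\<in>insert (i, c, ?P) Q. p \<noteq> q \<longrightarrow> snd (snd p) \<inter> snd (snd q) = {}"
      using pk disj unfolding packing_def by (simp add: Int_commute)
    show "\<forall>(i', c', P)\<in>insert (i, c, ?P) Q. rtrans (F i') c' \<subseteq> coverage Q \<union> rtrans (F i) c"
      using pk unfolding packing_def by fast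
  qed
qed

text \<open>While some translate in \<open>B\<close> meets the coverage in a fraction below
  \<open>e\<close>, it is added. As \<open>e < 1\<close> it brings a new point, so the uncovered set
  shrinks and the process stops; the density property of all translates is what stopping
  means.\<close>

lemma greedy_packing:
  assumes "packing F I B e Q" "finite B" "i \<in> I" "finite (F i)" "F i \<noteq> {}"
    "F i \<subseteq> carrier G" "e < 1"
  obtains Q' where "packing F I B e Q'" "coverage Q \<subseteq> coverage Q'"
    "\<And>c. c \<in> carrier G \<Longrightarrow> rtrans (F i) c \<subseteq> B \<Longrightarrow>
       e * real (card (F i)) \<le> real (card (rtrans (F i) c \<inter> coverage Q'))"
proof -
  have "\<exists>Q'. packing F I B e Q' \<and> coverage Q \<subseteq> coverage Q' \<and>
    (\<forall>c\<in>carrier G. rtrans (F i) c \<subseteq> B \<longrightarrow>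
       e * real (card (F i)) \<le> real (card (rtrans (F i) c \<inter> coverage Q')))"
    using assms(1)
  proof (induction "card (B - coverage Q)" arbitrary: Q rule: less_induct)
    case less
    show ?case
    proof (cases "\<forall>c\<in>carrier G. rtrans (F i) c \<subseteq> B \<longrightarrow>
       e * real (card (F i)) \<le> real (card (rtrans (F i) c \<inter> coverage Q))")
      case True
      then show ?thesis
        using less.prems by blast
    next
      case False
      then obtain c where c: "c \<in> carrier G" "rtrans (F i) c \<subseteq> B"
        and few: "real (card (rtrans (F i) c \<inter> coverage Q)) < e * real (card (F i))"
        by (meson not_le)
      let ?P = "rtrans (F i) c - coverage Q"
      let ?Q = "insert (i, c, ?P) Q"
      have pk: "packing F I B e ?Q"
        using packing_insert[OF less.prems assms(2,3) c] few by linarith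
      have cF: "0 < card (F i)"
        using assms(4,5) by (simp add: card_gt_0_iff)
      then have "e * real (card (F i)) < real (card (F i))"
        using assms(7) by simp
      then have "card (rtrans (F i) c \<inter> coverage Q) < card (rtrans (F i) c)"
        using few card_rtrans[OF assms(6) c(1)] by linarith
      then have "?P \<noteq> {}"
        by (auto simp: Int_absorb2)
      moreover have cov: "coverage ?Q = coverage Q \<union> ?P"
        by (auto simp: coverage_def)
      ultimately have "B - coverage ?Q \<subset> B - coverage Q"
        using c(2) by blast
      then have "card (B - coverage ?Q) < card (B - coverage Q)"
        using assms(2) by (simp add: psubset_card_mono)
      from less.hyps[OF this pk] show ?thesis
        using cov by blast
    qed
  qed
  then show ?thesis
    using that by blast
qed

text \<open>With \<open>e \<le> 1/2\<close> each retained part has at least half of the size of its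
  shape, and the retained parts are disjoint.\<close>

lemma packing_shape_mass:
  assumes pk: "packing F I B e Q" and B: "finite B" "B \<subseteq> carrier G" and e: "e \<le> 1/2"
    and F: "\<And>i. i \<in> I \<Longrightarrow> F i \<subseteq> carrier G"
  shows "(\<Sum>p\<in>Q. real (card (F (fst p)))) \<le> 2 * real (card (coverage Q))"
proof -
  have fin: "finite Q" and finP: "\<And>p. p \<in> Q \<Longrightarrow> finite (snd (snd p))"
    using pk B packing_coverage_subset[OF pk]
    by (auto simp: packing_def coverage_def UN_subset_iff finite_subset)
  have one: "real (card (F (fst p))) \<le> 2 * real (card (snd (snd p)))" if p: "p \<in> Q" for p
  proof -
    obtain i c P where p': "p = (i, c, P)"
      by (cases p)
    have i: "i \<in> I" "c \<in> carrier G" "P \<subseteq> rtrans (F i) c" "rtrans (F i) c \<subseteq> B"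
      and few: "real (card (rtrans (F i) c - P)) \<le> e * real (card (F i))"
      using packingD[OF pk p[unfolded p']] by auto
    have finF: "finite (rtrans (F i) c)"
      using i(4) B(1) finite_subset by blast
    have "card (rtrans (F i) c - P) = card (F i) - card P"
      using card_Diff_subset[OF finite_subset[OF i(3) finF] i(3)] card_rtrans[OF F[OF i(1)] i(2)] by simp
    moreover have "card P \<le> card (F i)"
      using card_mono[OF finF i(3)] card_rtrans[OF F[OF i(1)] i(2)] by simp
    moreover have "e * real (card (F i)) \<le> 1/2 * real (card (F i))"
      using e by (intro mult_right_mono) auto
    ultimately show ?thesis
      using few by (simp add: p' of_nat_diff)
  qed
  have "(\<Sum>p\<in>Q. real (card (F (fst p)))) \<le> (\<Sum>p\<in>Q. 2 * real (card (snd (snd p))))"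
    by (intro sum_mono one)
  also have "\<dots> = 2 * real (\<Sum>p\<in>Q. card (snd (snd p)))"
    by (simp add: sum_distrib_left)
  also have "(\<Sum>p\<in>Q. card (snd (snd p))) = card (coverage Q)"
    unfolding coverage_def
    using pk finP by (intro card_UN_disjoint[symmetric]) (auto simp: packing_def)
  finally show ?thesis .
qed

text \<open>The gain of one stage comes from double counting. At least half of the uncovered points
  \<open>c\<close> have their whole translate of \<open>F i\<close> uncovered, as the boundaries of
  \<open>B\<close> and of the old tiles are thin. The density property puts at least
  \<open>e * card (F i)\<close> newly covered points into each such translate, and a new point lies
  in at most \<open>card (F i)\<close> of them.\<close>

lemma packing_reduction:
  assumes pk: "packing F I B e Q" and B: "finite B" "B \<subseteq> carrier G" and e: "0 < e" "e \<le> 1/2"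
    and FI: "\<And>j. j \<in> I \<Longrightarrow> F j \<subseteq> carrier G"
    and F: "finite (F i)" "F i \<noteq> {}" "F i \<subseteq> carrier G"
    and invF: "\<And>j f. j \<in> I \<Longrightarrow> f \<in> F i \<Longrightarrow> real (card (escape (inv f) (F j))) \<le> \<eta> * real (card (F j))"
    and invB: "\<And>f. f \<in> F i \<Longrightarrow> real (card (escape f B)) \<le> \<eta> * real (card B)"
    and \<eta>: "0 \<le> \<eta>" "6 * (real (card (F i)) * \<eta>) \<le> \<rho>"
    and big: "\<rho> * real (card B) \<le> real (card (B - coverage Q))"
    and H': "coverage Q \<subseteq> H'" "H' \<subseteq> B"
    and dense: "\<And>c. c \<in> carrier G \<Longrightarrow> rtrans (F i) c \<subseteq> B \<Longrightarrow>
       e * real (card (F i)) \<le> real (card (rtrans (F i) c \<inter> H'))"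
  shows "real (card (B - H')) \<le> (1 - e/2) * real (card (B - coverage Q))"
proof -
  let ?H = "coverage Q" and ?F = "F i"
  let ?R = "B - ?H"
  have HB: "?H \<subseteq> B"
    using packing_coverage_subset[OF pk] .
  have finQ: "finite Q"
    using pk by (simp add: packing_def)
  define C where "C = {x \<in> ?R. \<forall>f\<in>?F. f \<otimes> x \<in> ?R}"
  have finC: "finite C"
    using B by (simp add: C_def)
  have cF: "0 < card ?F"
    using F by (simp add: card_gt_0_iff)
  \<comment> \<open>Some \<open>f\<close> drives a point outside \<open>C\<close> either out of
    \<open>B\<close> or into an old tile. In the second case the image is a point of that tile which
    \<open>inv f\<close> takes out of it again; hence the inverses in \<open>invF\<close>.\<close>
  define Bd where "Bd = (\<Union>f\<in>?F. escape f B) \<union> (\<Union>f\<in>?F. \<Union>p\<in>Q. (\<lambda>y. inv f \<otimes> y) ` escape (inv f) (rtrans (F (fst p)) (fst (snd p))))"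
  have sub: "?R - C \<subseteq> Bd"
  proof
    fix x assume "x \<in> ?R - C"
    then obtain f where x: "x \<in> B" "x \<notin> ?H" and f: "f \<in> ?F" "f \<otimes> x \<notin> ?R"
      by (auto simp: C_def)
    have xf: "x \<in> carrier G" "f \<in> carrier G"
      using x f B F by auto
    show "x \<in> Bd"
    proof (cases "f \<otimes> x \<in> B")
      case False
      then show ?thesis
        using x f by (auto simp: Bd_def escape_def)
    next
      case True
      then have "f \<otimes> x \<in> ?H"
        using f by blast
      then obtain p where p: "p \<in> Q" "f \<otimes> x \<in> snd (snd p)"
        by (auto simp: coverage_def)
      obtain j c P where p': "p = (j, c, P)"
        by (cases p)
      have "f \<otimes> x \<in> rtrans (F j) c" "rtrans (F j) c \<subseteq> ?H"
        using packingD[OF pk p(1)[unfolded p']] p(2) by (auto simp: p')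
      moreover have "inv f \<otimes> (f \<otimes> x) = x"
        using xf by (simp add: m_assoc[symmetric])
      ultimately have "f \<otimes> x \<in> escape (inv f) (rtrans (F j) c)"
        using x by (auto simp: escape_def)
      then have "inv f \<otimes> (f \<otimes> x) \<in> (\<lambda>y. inv f \<otimes> y) ` escape (inv f) (rtrans (F (fst p)) (fst (snd p)))"
        by (auto simp: p')
      then show ?thesis
        using \<open>inv f \<otimes> (f \<otimes> x) = x\<close> f p unfolding Bd_def by auto
    qed
  qed
  have esc: "real (card ((\<lambda>y. inv f \<otimes> y) ` escape (inv f) (rtrans (F (fst p)) (fst (snd p))))) \<le> \<eta> * real (card (F (fst p)))"
    if f: "f \<in> ?F" and p: "p \<in> Q" for f p
  proof -
    obtain j c P where p': "p = (j, c, P)"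
      by (cases p)
    have j: "j \<in> I" "c \<in> carrier G" "rtrans (F j) c \<subseteq> B"
      using packingD[OF pk p[unfolded p']] by auto
    have fc: "f \<in> carrier G"
      using f F by auto
    have fin: "finite (escape (inv f) (rtrans (F j) c))"
      using j(3) B(1) by (meson escape_subset finite_subset)
    have "card ((\<lambda>y. inv f \<otimes> y) ` escape (inv f) (rtrans (F j) c)) \<le> card (escape (inv f) (rtrans (F j) c))"
      using fin by (rule card_image_le)
    also have "\<dots> = card (escape (inv f) (F j))"
      using escape_rtrans[OF FI[OF j(1)] j(2) inv_closed[OF fc]]
        card_rtrans[OF order_trans[OF escape_subset FI[OF j(1)]] j(2)] by simp
    finally show ?thesis
      using invF[OF j(1) f] by (simp add: p')
  qed
  have "real (card Bd) \<le> real (card (\<Union>f\<in>?F. escape f B)) +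
     real (card (\<Union>f\<in>?F. \<Union>p\<in>Q. (\<lambda>y. inv f \<otimes> y) ` escape (inv f) (rtrans (F (fst p)) (fst (snd p)))))"
    unfolding Bd_def of_nat_add[symmetric] of_nat_le_iff by (rule card_Un_le)
  also have "\<dots> \<le> (\<Sum>f\<in>?F. real (card (escape f B))) + (\<Sum>f\<in>?F. \<Sum>p\<in>Q. real (card ((\<lambda>y. inv f \<otimes> y) ` escape (inv f) (rtrans (F (fst p)) (fst (snd p))))))"
    unfolding of_nat_sum[symmetric] of_nat_add[symmetric] of_nat_le_iff
    by (intro add_mono card_UN_le F order_trans[OF card_UN_le[OF F(1)] sum_mono] finQ)
  also have "\<dots> \<le> (\<Sum>f\<in>?F. \<eta> * real (card B)) + (\<Sum>f\<in>?F. \<Sum>p\<in>Q. \<eta> * real (card (F (fst p))))"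
    by (intro add_mono sum_mono invB esc)
  also have "\<dots> = real (card ?F) * (\<eta> * real (card B)) + real (card ?F) * (\<eta> * (\<Sum>p\<in>Q. real (card (F (fst p)))))"
    by (simp add: sum_distrib_left)
  also have "\<dots> \<le> real (card ?F) * (\<eta> * real (card B)) + real (card ?F) * (\<eta> * (2 * real (card B)))"
  proof -
    have "(\<Sum>p\<in>Q. real (card (F (fst p)))) \<le> 2 * real (card ?H)"
      by (rule packing_shape_mass[OF pk B e(2) FI])
    also have "\<dots> \<le> 2 * real (card B)"
      using card_mono[OF B(1) HB] by simp
    finally show ?thesis
      using \<eta>(1) by (intro add_left_mono mult_left_mono) auto
  qed
  \<comment> \<open>One share stems from the boundary of \<open>B\<close> and two from the tiles,
    whose total size is at most twice that of \<open>B\<close>. The constant 6 makes the sum of the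
    three shares at most half of \<open>\<rho> * card B\<close>.\<close>
  also have "\<dots> = (6 * (real (card ?F) * \<eta>)) * real (card B) / 2"
    by (simp add: algebra_simps)
  also have "\<dots> \<le> \<rho> * real (card B) / 2"
    using \<eta>(2) by (intro divide_right_mono mult_right_mono) auto
  finally have bd: "real (card Bd) \<le> real (card ?R) / 2"
    using big by simp
  have finBd: "finite Bd"
  proof -
    have "finite (escape (inv f) (rtrans (F (fst p)) (fst (snd p))))" if "p \<in> Q" for p f
    proof -
      obtain j c P where "p = (j, c, P)"
        by (cases p)
      then have "rtrans (F (fst p)) (fst (snd p)) \<subseteq> B"
        using packingD(4)[OF pk] that by auto
      then show ?thesis
        using B(1) by (meson escape_subset finite_subset)
    qed
    moreover have "finite (escape f B)" for f
      using B(1) by (meson escape_subset finite_subset)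
    ultimately show ?thesis
      using F finQ by (simp add: Bd_def)
  qed
  have "card ?R - card C \<le> card (?R - C)"
    by (rule diff_card_le_card_Diff[OF finC])
  also have "\<dots> \<le> card Bd"
    by (rule card_mono[OF finBd sub])
  finally have Cbig: "real (card ?R) / 2 \<le> real (card C)"
    using bd by linarith
  have Ccar: "C \<subseteq> carrier G"
    using B by (auto simp: C_def)
  have finD: "finite (H' - ?H)"
    using H' B(1) finite_subset by blast
  have "(\<Sum>c\<in>C. e * real (card ?F)) \<le> (\<Sum>c\<in>C. real (card (rtrans ?F c \<inter> (H' - ?H))))"
  proof (rule sum_mono)
    fix c assume c: "c \<in> C"
    have "rtrans ?F c \<subseteq> ?R"
      using c by (auto simp: C_def)
    then have "rtrans ?F c \<inter> (H' - ?H) = rtrans ?F c \<inter> H'" "rtrans ?F c \<subseteq> B"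
      by auto
    then show "e * real (card ?F) \<le> real (card (rtrans ?F c \<inter> (H' - ?H)))"
      using dense c Ccar by auto
  qed
  also have "\<dots> = (\<Sum>c\<in>C. \<Sum>f\<in>?F. of_bool (f \<otimes> c \<in> H' - ?H))"
  proof (rule sum.cong)
    fix c assume c: "c \<in> C"
    have "rtrans ?F c \<inter> (H' - ?H) = rtrans {f \<in> ?F. f \<otimes> c \<in> H' - ?H} c"
      by auto
    moreover have "card (rtrans {f \<in> ?F. f \<otimes> c \<in> H' - ?H} c) = card {f \<in> ?F. f \<otimes> c \<in> H' - ?H}"
      using c Ccar F by (intro card_rtrans) auto
    ultimately have "card (rtrans ?F c \<inter> (H' - ?H)) = card (?F \<inter> {f. f \<otimes> c \<in> H' - ?H})"
      by (simp add: Collect_conj_eq)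
    then show "real (card (rtrans ?F c \<inter> (H' - ?H))) = (\<Sum>f\<in>?F. of_bool (f \<otimes> c \<in> H' - ?H))"
      using F(1) by (simp add: sum.If_cases of_bool_def)
  qed simp
  \<comment> \<open>After the exchange, for fixed \<open>f\<close> the map from \<open>c\<close> to
    \<open>f \<otimes> c\<close> is injective, so the inner sum is at most the number of newly
    covered points.\<close>
  also have "\<dots> = (\<Sum>f\<in>?F. \<Sum>c\<in>C. of_bool (f \<otimes> c \<in> H' - ?H))"
    by (rule sum.swap)
  also have "\<dots> \<le> (\<Sum>f\<in>?F. real (card (H' - ?H)))"
  proof (rule sum_mono)
    fix f assume f: "f \<in> ?F"
    have "(\<Sum>c\<in>C. of_bool (f \<otimes> c \<in> H' - ?H)) = real (card {c \<in> C. f \<otimes> c \<in> H' - ?H})"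
      using finC by (simp add: sum.If_cases of_bool_def Collect_conj_eq)
    also have "\<dots> = real (card ((\<lambda>c. f \<otimes> c) ` {c \<in> C. f \<otimes> c \<in> H' - ?H}))"
      using f F Ccar by (subst card_image[OF inj_on_ltrans]) auto
    also have "\<dots> \<le> real (card (H' - ?H))"
      using finD by (intro of_nat_mono card_mono) auto
    finally show "(\<Sum>c\<in>C. of_bool (f \<otimes> c \<in> H' - ?H)) \<le> real (card (H' - ?H))" .
  qed
  finally have "real (card ?F) * (e * real (card C)) \<le> real (card ?F) * real (card (H' - ?H))"
    by (simp add: algebra_simps)
  then have "e * real (card C) \<le> real (card (H' - ?H))"
    using cF by simp
  moreover have "e * (real (card ?R) / 2) \<le> e * real (card C)"
    using Cbig e by simp
  moreover have "card (B - H') = card ?R - card (H' - ?H)"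
  proof -
    have eq: "B - H' = ?R - (H' - ?H)"
      using H' by auto
    have "H' - ?H \<subseteq> ?R"
      using H' by auto
    then show ?thesis
      unfolding eq by (rule card_Diff_subset[OF finD])
  qed
  moreover have "card (H' - ?H) \<le> card ?R"
    using H' B(1) by (intro card_mono) auto
  ultimately have "real (card (B - H')) = real (card ?R) - real (card (H' - ?H))"
    "e * (real (card ?R) / 2) \<le> real (card (H' - ?H))"
    by (simp_all add: of_nat_diff)
  then show ?thesis
    by (simp add: left_diff_distrib)
qed

end

section \<open>Quasi-tilings, approximate tiles and absorption\<close>

context group begin

text \<open>The shapes are used from the last and most invariant one down to the first. Each stage
  multiplies the uncovered fraction by at most \<open>1 - e/2\<close> unless that fraction is
  already below \<open>\<rho>\<close>, which explains the maximum in the induction.\<close>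

lemma quasi_tiling:
  assumes B: "finite B" "B \<subseteq> carrier G" and e: "0 < e" "e \<le> 1/2" and \<rho>: "0 \<le> \<rho>"
    and F: "\<And>i. i < m \<Longrightarrow> finite (F i) \<and> F i \<noteq> {} \<and> F i \<subseteq> carrier G"
    and invF: "\<And>i j f. i < j \<Longrightarrow> j < m \<Longrightarrow> f \<in> F i \<Longrightarrow>
      6 * real (card (F i)) * real (card (escape (inv f) (F j))) \<le> \<rho> * real (card (F j))"
    and invB: "\<And>i f. i < m \<Longrightarrow> f \<in> F i \<Longrightarrow>
      6 * real (card (F i)) * real (card (escape f B)) \<le> \<rho> * real (card B)"
    and m: "(1 - e/2) ^ m \<le> \<rho>"
  obtains Q where "packing F {..<m} B e Q" "real (card (B - coverage Q)) \<le> \<rho> * real (card B)"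
proof -
  have "\<exists>Q. packing F {m-k..<m} B e Q \<and>
      real (card (B - coverage Q)) \<le> max \<rho> ((1 - e/2) ^ k) * real (card B)" if "k \<le> m" for k
    using that
  proof (induction k)
    case 0
    have "packing F {m-0..<m} B e {}" "coverage {} = {}"
      by (auto simp: packing_def coverage_def)
    moreover have "real (card B) \<le> max \<rho> 1 * real (card B)"
      using mult_right_mono[of 1 "max \<rho> 1" "real (card B)"] by simp
    ultimately show ?case
      by (intro exI[of _ "{}"]) auto
  next
    case (Suc k)
    then obtain Q where Q: "packing F {m-k..<m} B e Q"
      "real (card (B - coverage Q)) \<le> max \<rho> ((1 - e/2) ^ k) * real (card B)"
      by auto
    define i where "i = m - Suc k"
    have i: "i < m" "i \<in> {m - Suc k..<m}" "\<And>j. j \<in> {m-k..<m} \<Longrightarrow> i < j \<and> j < m"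
      using Suc.prems by (auto simp: i_def)
    \<comment> \<open>The enlarged index set admits the shape \<open>i\<close> in the greedy step.
      The reduction below still uses the packing over the old index set, where all shapes have an
      index greater than \<open>i\<close>, as \<open>invF\<close> requires.\<close>
    have Q1: "packing F {m - Suc k..<m} B e Q"
      by (rule packing_mono[OF Q(1)]) auto
    have Fi: "finite (F i)" "F i \<noteq> {}" "F i \<subseteq> carrier G"
      using F[OF i(1)] by auto
    have cF: "0 < real (card (F i))"
      using Fi by (simp add: card_gt_0_iff)
    obtain Q' where Q': "packing F {m - Suc k..<m} B e Q'" "coverage Q \<subseteq> coverage Q'"
      "\<And>c. c \<in> carrier G \<Longrightarrow> rtrans (F i) c \<subseteq> B \<Longrightarrow>
       e * real (card (F i)) \<le> real (card (rtrans (F i) c \<inter> coverage Q'))"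
      using greedy_packing[OF Q1 B(1) i(2) Fi] e by auto
    have fin: "finite (B - coverage Q)"
      using B by simp
    have le: "card (B - coverage Q') \<le> card (B - coverage Q)"
      using Q'(2) by (intro card_mono[OF fin]) auto
    have "real (card (B - coverage Q')) \<le> max \<rho> ((1 - e/2) ^ Suc k) * real (card B)"
    proof (cases "\<rho> * real (card B) \<le> real (card (B - coverage Q))")
      case True
      have "real (card (B - coverage Q')) \<le> (1 - e/2) * real (card (B - coverage Q))"
      proof (rule packing_reduction[OF Q(1) B e _ Fi, where \<eta> = "\<rho> / (6 * real (card (F i)))" and \<rho> = \<rho>])
        show "F j \<subseteq> carrier G" if "j \<in> {m-k..<m}" for j
          using F that by auto
        show "real (card (escape (inv f) (F j))) \<le> \<rho> / (6 * real (card (F i))) * real (card (F j))"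
          if "j \<in> {m-k..<m}" "f \<in> F i" for j f
          using invF[of i j f] i(3)[OF that(1)] that(2) cF by (simp add: field_simps)
        show "real (card (escape f B)) \<le> \<rho> / (6 * real (card (F i))) * real (card B)" if "f \<in> F i" for f
          using invB[OF i(1) that] cF by (simp add: field_simps)
        show "6 * (real (card (F i)) * (\<rho> / (6 * real (card (F i))))) \<le> \<rho>"
          using cF by simp
      qed (use cF \<rho> True Q' packing_coverage_subset[OF Q'(1)] in auto)
      also have "\<dots> \<le> (1 - e/2) * (max \<rho> ((1 - e/2) ^ k) * real (card B))"
        using Q(2) e by (intro mult_left_mono) auto
      also have "\<dots> = ((1 - e/2) * max \<rho> ((1 - e/2) ^ k)) * real (card B)"
        by simp
      also have "\<dots> \<le> max \<rho> ((1 - e/2) ^ Suc k) * real (card B)"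
      proof (intro mult_right_mono)
        have "(1 - e/2) * \<rho> \<le> 1 * \<rho>"
          using e \<rho> by (intro mult_right_mono) auto
        then show "(1 - e/2) * max \<rho> ((1 - e/2) ^ k) \<le> max \<rho> ((1 - e/2) ^ Suc k)"
          by (auto simp: max_def)
      qed auto
      finally show ?thesis .
    next
      case False
      then have "real (card (B - coverage Q')) \<le> \<rho> * real (card B)"
        using le by linarith
      also have "\<dots> \<le> max \<rho> ((1 - e/2) ^ Suc k) * real (card B)"
        by (intro mult_right_mono) auto
      finally show ?thesis .
    qed
    then show ?case
      using Q'(1) by blast
  qed
  from this[of m] that m show thesis
    by (auto simp: max_absorb1 lessThan_atLeast0)
qed

text \<open>Each shape is chosen after all earlier ones and made as invariant under the inverses of
  their elements as their sizes demand.\<close>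

lemma choose_shapes:
  assumes avail: "\<And>K e. finite K \<Longrightarrow> K \<subseteq> carrier G \<Longrightarrow> 0 < e \<Longrightarrow> \<exists>L. good L \<and> almost_inv K e (set L)"
    and E: "finite E" "E \<subseteq> carrier G" "0 < \<epsilon>" and \<rho>: "0 < \<rho>"
  obtains f :: "nat \<Rightarrow> 'a list" where
    "\<And>i. i < m \<Longrightarrow> good (f i) \<and> almost_inv E \<epsilon> (set (f i))"
    "\<And>i j x. i < j \<Longrightarrow> j < m \<Longrightarrow> x \<in> set (f i) \<Longrightarrow>
      6 * real (card (set (f i))) * real (card (escape (inv x) (set (f j)))) \<le> \<rho> * real (card (set (f j)))"
proof -
  have "\<exists>f. (\<forall>i<m. good (f i) \<and> almost_inv E \<epsilon> (set (f i))) \<and>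
     (\<forall>j<m. \<forall>i<j. \<forall>x\<in>set (f i).
      6 * real (card (set (f i))) * real (card (escape (inv x) (set (f j)))) \<le> \<rho> * real (card (set (f j))))"
  proof (induction m)
    case (Suc m)
    then obtain f where f1: "\<And>i. i < m \<Longrightarrow> good (f i) \<and> almost_inv E \<epsilon> (set (f i))"
      and f2: "\<And>i j x. j < m \<Longrightarrow> i < j \<Longrightarrow> x \<in> set (f i) \<Longrightarrow>
        6 * real (card (set (f i))) * real (card (escape (inv x) (set (f j)))) \<le> \<rho> * real (card (set (f j)))"
      by blast
    define K where "K = E \<union> (\<Union>i<m. (\<lambda>x. inv x) ` set (f i))"
    \<comment> \<open>Dividing by the total size of the earlier shapes gives
      \<open>6 * card (set (f i)) * e \<le> \<rho>\<close> for all of them at once.\<close>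
    define e where "e = min \<epsilon> (\<rho> / (6 * (1 + real (\<Sum>i<m. card (set (f i))))))"
    have pos: "0 < 1 + real (\<Sum>i<m. card (set (f i)))"
      by (simp only: of_nat_sum) (intro add_pos_nonneg sum_nonneg, auto)
    have "finite K" "K \<subseteq> carrier G" "0 < e"
      using E f1 \<rho> pos by (auto simp: K_def e_def almost_inv_def)
    then obtain L where L: "good L" "almost_inv K e (set L)"
      using avail by blast
    have L1: "almost_inv E \<epsilon> (set L)"
      by (rule almost_inv_mono[OF L(2)]) (auto simp: K_def e_def)
    have L2: "6 * real (card (set (f i))) * real (card (escape (inv x) (set L))) \<le> \<rho> * real (card (set L))"
      if i: "i < m" and x: "x \<in> set (f i)" for i x
    proof -
      have "inv x \<in> K"
        using i x by (auto simp: K_def)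
      then have "real (card (escape (inv x) (set L))) \<le> e * real (card (set L))"
        using L(2) by (simp add: almost_inv_def)
      then have "6 * real (card (set (f i))) * real (card (escape (inv x) (set L))) \<le>
          6 * real (card (set (f i))) * (e * real (card (set L)))"
        by (intro mult_left_mono) auto
      also have "\<dots> = (6 * real (card (set (f i))) * e) * real (card (set L))"
        by simp
      also have "\<dots> \<le> \<rho> * real (card (set L))"
      proof (intro mult_right_mono)
        have "card (set (f i)) \<le> (\<Sum>i<m. card (set (f i)))"
          using i by (intro member_le_sum) auto
        then have "real (card (set (f i))) \<le> 1 + real (\<Sum>i<m. card (set (f i)))"
          by linarith
        then have "6 * real (card (set (f i))) * e \<le> 6 * (1 + real (\<Sum>i<m. card (set (f i)))) * e"
          using \<open>0 < e\<close> by (intro mult_right_mono mult_left_mono) auto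
        also have "\<dots> \<le> 6 * (1 + real (\<Sum>i<m. card (set (f i)))) * (\<rho> / (6 * (1 + real (\<Sum>i<m. card (set (f i))))))"
          using pos by (intro mult_left_mono) (auto simp: e_def)
        also have "\<dots> = \<rho>"
          using pos by simp
        finally show "6 * real (card (set (f i))) * e \<le> \<rho>" .
      qed auto
      finally show ?thesis .
    qed
    show ?case
      using f1 f2 L(1) L1 L2 by (intro exI[of _ "f(m := L)"]) (auto simp: less_Suc_eq)
  qed auto
  then show thesis
    using that by blast
qed

text \<open>Closeness is expressed by a common subsequence \<open>M\<close> of the tile and the
  translated shape, so that a single object records both which points agree and that their order
  agrees. Extra points may sit anywhere in \<open>T\<close> as long as they are few.\<close>

definition approx_tile :: "'a list set \<Rightarrow> real \<Rightarrow> 'a list \<Rightarrow> bool" where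
  "approx_tile \<L> \<epsilon> T \<longleftrightarrow> (\<exists>L\<in>\<L>. \<exists>c\<in>carrier G. \<exists>M. subseq M T \<and> subseq M (lrtrans L c) \<and>
     (1 - \<epsilon>) * real (length L) \<le> real (length M) \<and> real (length T) \<le> (1 + \<epsilon>) * real (length L))"

definition next_tile :: "('a list \<Rightarrow> bool) \<Rightarrow> 'a list set \<Rightarrow> real \<Rightarrow> 'a list \<Rightarrow> bool" where
  "next_tile \<tau> \<L> \<epsilon> T \<longleftrightarrow> (\<exists>Ts. T = concat Ts \<and> (\<forall>t\<in>set Ts. \<tau> t)) \<and> approx_tile \<L> \<epsilon> T"

text \<open>The points left over by a quasi-tiling are appended to absorbing tiles, arbitrarily far away: the
  few extra points disturb neither the almost invariance of a tile nor its inner order.\<close>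

definition absorbing :: "('a list \<Rightarrow> bool) \<Rightarrow> real \<Rightarrow> 'a list \<Rightarrow> bool" where
  "absorbing \<tau> \<kappa> t \<longleftrightarrow> \<tau> t \<and> 1 \<le> \<kappa> * real (length t) \<and>
     (\<forall>ys. distinct ys \<and> set ys \<subseteq> carrier G \<and> set ys \<inter> set t = {} \<and> real (length ys) \<le> \<kappa> * real (length t) \<longrightarrow>
        (\<exists>t'. \<tau> t' \<and> subseq t t' \<and> mset t' = mset t + mset ys))"

definition absorbing_mass :: "('a list \<Rightarrow> bool) \<Rightarrow> real \<Rightarrow> 'a list list \<Rightarrow> nat" where
  "absorbing_mass \<tau> \<kappa> Ts = (\<Sum>t\<leftarrow>Ts. if absorbing \<tau> \<kappa> t then length t else 0)"

text \<open>The new points fill the absorbing tiles from left to right, each up to the integer part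
  of \<open>\<kappa> * length t\<close>, which is at least half of this product; hence the factors
  \<open>\<kappa> / 2\<close> and \<open>2 / \<kappa>\<close>. A tile that took points may no longer
  absorb. If it was filled, the points it took pay for its length; \<open>S\<close> pays for the
  last tile, which may be filled only in part.\<close>

lemma absorb_list:
  assumes "\<forall>t\<in>set Ts. \<tau> t \<and> length t \<le> S" "distinct (concat Ts @ ys)" "set ys \<subseteq> carrier G"
    "real (length ys) \<le> \<kappa> / 2 * real (absorbing_mass \<tau> \<kappa> Ts)" "0 < \<kappa>"
  shows "\<exists>Ts'. (\<forall>t\<in>set Ts'. \<tau> t) \<and> subseq (concat Ts) (concat Ts') \<and>
     mset (concat Ts') = mset (concat Ts) + mset ys \<and>
     real (absorbing_mass \<tau> \<kappa> Ts) - 2 / \<kappa> * real (length ys) - real S \<le> real (absorbing_mass \<tau> \<kappa> Ts')"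
  using assms(1-4)
proof (induction Ts arbitrary: ys)
  case Nil
  then show ?case
    by (intro exI[of _ "[]"]) (auto simp: absorbing_mass_def)
next
  case (Cons t Ts)
  show ?case
  proof (cases "absorbing \<tau> \<kappa> t")
    case False
    then obtain Ts' where Ts': "\<forall>t\<in>set Ts'. \<tau> t" "subseq (concat Ts) (concat Ts')"
      "mset (concat Ts') = mset (concat Ts) + mset ys"
      "real (absorbing_mass \<tau> \<kappa> Ts) - 2 / \<kappa> * real (length ys) - real S \<le> real (absorbing_mass \<tau> \<kappa> Ts')"
      using Cons.IH[of ys] Cons.prems by (auto simp: absorbing_mass_def)
    then show ?thesis
      using Cons.prems False
      by (intro exI[of _ "t # Ts'"]) (auto simp: absorbing_mass_def list_emb_append_mono)
  next
    case True
    define r where "r = nat \<lfloor>\<kappa> * real (length t)\<rfloor>"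
    have k1: "1 \<le> \<kappa> * real (length t)"
      using True by (simp add: absorbing_def)
    then have r: "real r \<le> \<kappa> * real (length t)" "\<kappa> * real (length t) / 2 \<le> real r"
      unfolding r_def using of_nat_floor[of "\<kappa> * real (length t)"]
        le_nat_floor[of 1 "\<kappa> * real (length t)"] by linarith+
    have mass: "absorbing_mass \<tau> \<kappa> (t # Ts) = length t + absorbing_mass \<tau> \<kappa> Ts"
      using True by (simp add: absorbing_mass_def)
    show ?thesis
    proof (cases "length ys \<le> r")
      case le: True
      have "\<exists>t'. \<tau> t' \<and> subseq t t' \<and> mset t' = mset t + mset ys"
      proof -
        have "distinct ys" "set ys \<inter> set t = {}" "real (length ys) \<le> \<kappa> * real (length t)"
          using Cons.prems(2) r le by auto
        then show ?thesis
          using True Cons.prems(3) unfolding absorbing_def by blast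
      qed
      then obtain t' where t': "\<tau> t'" "subseq t t'" "mset t' = mset t + mset ys"
        by blast
      have "length t \<le> S"
        using Cons.prems(1) by simp
      moreover have "0 \<le> 2 / \<kappa> * real (length ys)"
        using assms(5) by simp
      moreover have "absorbing_mass \<tau> \<kappa> Ts \<le> absorbing_mass \<tau> \<kappa> (t' # Ts)"
        by (simp add: absorbing_mass_def)
      ultimately have "real (absorbing_mass \<tau> \<kappa> (t # Ts)) - 2 / \<kappa> * real (length ys) - real S \<le> real (absorbing_mass \<tau> \<kappa> (t' # Ts))"
        unfolding mass by linarith
      then show ?thesis
        using t' Cons.prems(1) by (intro exI[of _ "t' # Ts"]) (auto simp: list_emb_append_mono)
    next
      case gt: False
      let ?y1 = "take r ys" and ?y2 = "drop r ys"
      have ys: "ys = ?y1 @ ?y2"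
        by simp
      have s1: "set ?y1 \<subseteq> set ys" "set ?y2 \<subseteq> set ys"
        by (auto dest: in_set_takeD in_set_dropD)
      have "distinct ?y1" "set ?y1 \<subseteq> carrier G" "set ?y1 \<inter> set t = {}" "real (length ?y1) \<le> \<kappa> * real (length t)"
        using Cons.prems(2,3) s1 r by auto
      then have "\<exists>t'. \<tau> t' \<and> subseq t t' \<and> mset t' = mset t + mset ?y1"
        using True unfolding absorbing_def by blast
      then obtain t' where t': "\<tau> t'" "subseq t t'" "mset t' = mset t + mset ?y1"
        by blast
      have d2: "distinct (concat Ts @ ?y2)"
        using Cons.prems(2) s1 by auto
      have len2: "real (length ?y2) = real (length ys) - real r"
        using gt by simp
      have half: "\<kappa> / 2 * real (length t) \<le> real r"
        using r(2) by simp
      have "real (length ys) \<le> \<kappa> / 2 * real (length t) + \<kappa> / 2 * real (absorbing_mass \<tau> \<kappa> Ts)"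
        using Cons.prems(4) unfolding mass by (simp add: algebra_simps)
      then have "real (length ?y2) \<le> \<kappa> / 2 * real (absorbing_mass \<tau> \<kappa> Ts)"
        unfolding len2 using half by linarith
      then obtain Ts' where Ts': "\<forall>t\<in>set Ts'. \<tau> t" "subseq (concat Ts) (concat Ts')"
        "mset (concat Ts') = mset (concat Ts) + mset ?y2"
        "real (absorbing_mass \<tau> \<kappa> Ts) - 2 / \<kappa> * real (length ?y2) - real S \<le> real (absorbing_mass \<tau> \<kappa> Ts')"
        using Cons.IH[OF _ d2] Cons.prems(1,3) s1 by auto
      have "real (length t) \<le> 2 / \<kappa> * real r"
        using half assms(5) by (simp add: field_simps)
      moreover have "2 / \<kappa> * real (length ?y2) = 2 / \<kappa> * real (length ys) - 2 / \<kappa> * real r"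
        unfolding len2 by (simp add: right_diff_distrib)
      moreover have "absorbing_mass \<tau> \<kappa> Ts' \<le> absorbing_mass \<tau> \<kappa> (t' # Ts')"
        by (simp add: absorbing_mass_def)
      ultimately have "real (absorbing_mass \<tau> \<kappa> (t # Ts)) - 2 / \<kappa> * real (length ys) - real S \<le> real (absorbing_mass \<tau> \<kappa> (t' # Ts'))"
        unfolding mass using Ts'(4) by linarith
      moreover have "mset (concat (t' # Ts')) = mset (concat (t # Ts)) + mset ys"
        using t'(3) Ts'(3) by (metis (no_types, lifting) ys add.assoc add.commute concat.simps(2) mset_append)
      ultimately show ?thesis
        using t' Ts' by (intro exI[of _ "t' # Ts'"]) (auto simp: list_emb_append_mono)
    qed
  qed
qed

text \<open>Points offered to the long tile are passed on to the absorbing tiles inside it. Their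
  capacity suffices because \<open>\<kappa>' \<le> \<kappa> / 8\<close> and their mass is at least a
  quarter of \<open>length L\<close>; \<open>\<kappa>' \<le> \<epsilon>\<close> keeps the result
  within the length allowed to a tile. The old list remains a subsequence, so it serves as the
  common part \<open>M\<close> of the enlarged tile.\<close>

lemma absorbing_next_tile:
  assumes Ts: "\<forall>t\<in>set Ts. \<tau> t \<and> length t \<le> S" and dist: "distinct (concat Ts)"
    and L: "L \<in> \<L>" "c \<in> carrier G" "subseq (concat Ts) (lrtrans L c)"
      "(1 - \<epsilon>) * real (length L) \<le> real (length (concat Ts))"
    and mass: "real (length L) / 4 \<le> real (absorbing_mass \<tau> \<kappa> Ts)"
    and \<kappa>: "0 < \<kappa>" "0 < \<kappa>'" "\<kappa>' \<le> \<epsilon>" "\<kappa>' \<le> \<kappa> / 8" "1 \<le> \<kappa>' * real (length (concat Ts))"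
  shows "absorbing (next_tile \<tau> \<L> \<epsilon>) \<kappa>' (concat Ts)"
proof -
  let ?T = "concat Ts"
  have le: "length ?T \<le> length L"
    using list_emb_length[OF L(3)] by simp
  have tile: "next_tile \<tau> \<L> \<epsilon> T'"
    if T': "T' = concat Ts'" "\<forall>t\<in>set Ts'. \<tau> t" "subseq ?T T'"
      "real (length T') \<le> (1 + \<epsilon>) * real (length L)" for T' Ts'
    using that L unfolding next_tile_def approx_tile_def by blast
  have t0: "next_tile \<tau> \<L> \<epsilon> ?T"
  proof (rule tile[OF refl])
    have "real (length ?T) \<le> 1 * real (length L)"
      using le by simp
    also have "\<dots> \<le> (1 + \<epsilon>) * real (length L)"
      using \<kappa> by (intro mult_right_mono) auto
    finally show "real (length ?T) \<le> (1 + \<epsilon>) * real (length L)" .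
  qed (use Ts in auto)
  have "\<exists>t'. next_tile \<tau> \<L> \<epsilon> t' \<and> subseq ?T t' \<and> mset t' = mset ?T + mset ys"
    if ys: "distinct ys" "set ys \<subseteq> carrier G" "set ys \<inter> set ?T = {}" "real (length ys) \<le> \<kappa>' * real (length ?T)" for ys
  proof -
    have "\<kappa>' * real (length ?T) \<le> \<kappa>' * real (length L)"
      using le \<kappa> by simp
    then have ysL: "real (length ys) \<le> \<kappa>' * real (length L)"
      using ys(4) by linarith
    also have "\<dots> \<le> \<kappa> / 8 * real (length L)"
      using \<kappa> by (intro mult_right_mono) auto
    also have "\<dots> = \<kappa> / 2 * (real (length L) / 4)"
      by simp
    also have "\<dots> \<le> \<kappa> / 2 * real (absorbing_mass \<tau> \<kappa> Ts)"
      using mass \<kappa> by (intro mult_left_mono) auto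
    finally obtain Ts' where Ts': "\<forall>t\<in>set Ts'. \<tau> t" "subseq ?T (concat Ts')" "mset (concat Ts') = mset ?T + mset ys"
      using absorb_list[of Ts \<tau> S ys \<kappa>] Ts dist ys \<kappa> by (auto simp: Int_commute)
    have "length (concat Ts') = length ?T + length ys"
      using arg_cong[OF Ts'(3), of size] by (simp only: size_mset size_union)
    moreover have "\<kappa>' * real (length L) \<le> \<epsilon> * real (length L)"
      using \<kappa> by (intro mult_right_mono) auto
    ultimately have "real (length (concat Ts')) \<le> (1 + \<epsilon>) * real (length L)"
      using le ysL unfolding distrib_right by linarith
    then show ?thesis
      using tile[OF refl Ts'(1,2)] Ts' by blast
  qed
  then show ?thesis
    using t0 \<kappa>(5) unfolding absorbing_def by blast
qed

lemma lrtrans_lrtrans: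
  assumes "set t \<subseteq> carrier G" "c \<in> carrier G" "d \<in> carrier G"
  shows "lrtrans (lrtrans t c) d = lrtrans t (c \<otimes> d)"
  using assms by (auto simp: m_assoc)

lemma lrtrans_inv:
  assumes "set t \<subseteq> carrier G" "c \<in> carrier G"
  shows "lrtrans (lrtrans t c) (inv c) = t" "lrtrans (lrtrans t (inv c)) c = t"
  using assms by (auto simp: m_assoc intro!: map_idI)

lemma absorbing_rtrans:
  assumes \<tau>: "\<And>t c. set t \<subseteq> carrier G \<Longrightarrow> c \<in> carrier G \<Longrightarrow> \<tau> t \<Longrightarrow> \<tau> (lrtrans t c)"
    and t: "set t \<subseteq> carrier G" "c \<in> carrier G" "absorbing \<tau> \<kappa> t"
  shows "absorbing \<tau> \<kappa> (lrtrans t c)"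
  unfolding absorbing_def
proof (intro conjI allI impI)
  show "\<tau> (lrtrans t c)"
    using \<tau> t by (simp add: absorbing_def)
  show "1 \<le> \<kappa> * real (length (lrtrans t c))"
    using t by (simp add: absorbing_def)
  fix ys assume ys: "distinct ys \<and> set ys \<subseteq> carrier G \<and> set ys \<inter> set (lrtrans t c) = {} \<and>
     real (length ys) \<le> \<kappa> * real (length (lrtrans t c))"
  let ?zs = "lrtrans ys (inv c)"
  have zy: "lrtrans ?zs c = ys"
    using lrtrans_inv ys t(2) by blast
  have "distinct ?zs"
    using ys t(2) by (simp add: distinct_map inj_on_rtrans)
  moreover have "set ?zs \<subseteq> carrier G"
    using ys t(2) by auto
  moreover have "set ?zs \<inter> set t = {}"
  proof -
    have "y \<notin> set t" if "y \<in> set ?zs" for y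
    proof
      assume "y \<in> set t"
      then have "y \<otimes> c \<in> set (lrtrans t c)"
        by auto
      moreover have "y \<otimes> c \<in> set ys"
        using that zy by (metis (no_types, lifting) imageI set_map)
      ultimately show False
        using ys by blast
    qed
    then show ?thesis
      by blast
  qed
  moreover have "real (length ?zs) \<le> \<kappa> * real (length t)"
    using ys by simp
  ultimately have "\<exists>t'. \<tau> t' \<and> subseq t t' \<and> mset t' = mset t + mset ?zs"
    using t(3) unfolding absorbing_def by blast
  then obtain t' where t': "\<tau> t'" "subseq t t'" "mset t' = mset t + mset ?zs"
    by blast
  have "set t' \<subseteq> carrier G"
    using arg_cong[OF t'(3), of set_mset] t(1) \<open>set ?zs \<subseteq> carrier G\<close> by simp
  then have "\<tau> (lrtrans t' c)"
    using \<tau> t(2) t'(1) by blast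
  moreover have "subseq (lrtrans t c) (lrtrans t' c)"
    using t'(2) by (rule subseq_map)
  moreover have "mset (lrtrans t' c) = mset (lrtrans t c) + mset ys"
  proof -
    have "mset (lrtrans t' c) = image_mset (\<lambda>x. x \<otimes> c) (mset t + mset ?zs)"
      by (simp only: mset_map t'(3))
    also have "\<dots> = mset (lrtrans t c) + mset (lrtrans ?zs c)"
      by (simp only: image_mset_union mset_map)
    finally show ?thesis
      by (simp only: zy)
  qed
  ultimately show "\<exists>t'. \<tau> t' \<and> subseq (lrtrans t c) t' \<and> mset t' = mset (lrtrans t c) + mset ys"
    by blast
qed

end

lemma subseq_concat_filter: "subseq (concat (filter Q Ts)) (concat Ts)"
  by (induction Ts) (auto intro: list_emb_append_mono list_emb_append2)

text \<open>A tile not contained in \<open>P\<close> has a point outside \<open>P\<close>. The tiles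
  are disjoint, so at most \<open>card (set (concat Ts) - P)\<close> of them are lost, each of
  weight at most \<open>S\<close>.\<close>

lemma filter_tiles_mass:
  fixes w :: "'b list \<Rightarrow> nat"
  assumes "\<And>t. w t \<le> length t" "\<forall>t\<in>set Ts. length t \<le> S" "distinct (concat Ts)"
  shows "sum_list (map w Ts) \<le> sum_list (map w (filter (\<lambda>t. set t \<subseteq> P) Ts)) + S * card (set (concat Ts) - P)"
  using assms(2,3)
proof (induction Ts)
  case (Cons t Ts)
  have "set (concat (t # Ts)) - P = (set t - P) \<union> (set (concat Ts) - P)"
    by auto
  then have card: "card (set (concat (t # Ts)) - P) = card (set t - P) + card (set (concat Ts) - P)"
    using Cons.prems(2) by (simp del: Un_Diff) (subst card_Un_disjoint, auto)
  have IH: "sum_list (map w Ts) \<le> sum_list (map w (filter (\<lambda>t. set t \<subseteq> P) Ts)) + S * card (set (concat Ts) - P)"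
    using Cons by auto
  show ?case
  proof (cases "set t \<subseteq> P")
    case True
    then show ?thesis
      unfolding card using IH by (simp add: distrib_left)
  next
    case False
    then have "0 < card (set t - P)"
      by (auto simp: card_gt_0_iff)
    then have "S \<le> S * card (set t - P)"
      by simp
    moreover have "w t \<le> S"
      using assms(1)[of t] Cons.prems(1) order_trans by auto
    ultimately have "w t \<le> S * card (set t - P)"
      by (rule order_trans[rotated])
    moreover have flt: "filter (\<lambda>t. set t \<subseteq> P) (t # Ts) = filter (\<lambda>t. set t \<subseteq> P) Ts"
      using False by simp
    ultimately show ?thesis
      unfolding card distrib_left flt list.map sum_list.Cons using IH by linarith
  qed
qed simp

lemma set_mono_subseq: "subseq xs ys \<Longrightarrow> set xs \<subseteq> set ys"
  by (auto simp: subseq_conv_nths dest: in_set_nthsD)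

lemma distinct_subseq: "subseq xs ys \<Longrightarrow> distinct ys \<Longrightarrow> distinct xs"
  by (auto simp: subseq_conv_nths)

section \<open>Rich classes of tiles and the passage to the next level\<close>

context group begin

text \<open>The invariant of the induction over the levels: exact concatenations exist with any
  prescribed invariance, and half of their length is a reserve of tiles that still absorb, from
  which the next level draws its own capacity.\<close>

definition rich :: "('a list \<Rightarrow> bool) \<Rightarrow> real \<Rightarrow> bool" where
  "rich \<tau> \<kappa> \<longleftrightarrow> (\<forall>K e. finite K \<and> K \<subseteq> carrier G \<and> 0 < e \<longrightarrow>
     (\<exists>Ts. (\<forall>t\<in>set Ts. \<tau> t) \<and> distinct (concat Ts) \<and> almost_inv K e (set (concat Ts)) \<and>
        length (concat Ts) \<le> 2 * absorbing_mass \<tau> \<kappa> Ts))"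

text \<open>For a nonempty set with fewer than \<open>N\<close> points the prescribed bound on the
  escape counts is below 1. Nothing escapes then, so the set contains a translate of
  \<open>K\<close>, which has \<open>N\<close> points.\<close>

lemma large_almost_inv:
  assumes "infinite (carrier G)"
  obtains K e where "finite K" "K \<subseteq> carrier G" "0 < (e::real)" "\<And>A. almost_inv K e A \<Longrightarrow> N \<le> card A"
proof -
  obtain K where K: "K \<subseteq> carrier G" "finite K" "card K = N"
    using infinite_arbitrarily_large[OF assms] by blast
  have "N \<le> card A" if A: "almost_inv K (1 / (2 * (1 + real N))) A" for A
  proof (rule ccontr)
    assume "\<not> N \<le> card A"
    then have lt: "card A < N"
      by simp
    have A': "finite A" "A \<noteq> {}" "A \<subseteq> carrier G"
      using A by (auto simp: almost_inv_def)
    then obtain a where a: "a \<in> A"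
      by blast
    have "g \<otimes> a \<in> A" if g: "g \<in> K" for g
    proof (rule ccontr)
      assume "g \<otimes> a \<notin> A"
      then have "a \<in> escape g A"
        using a by (simp add: escape_def)
      then have "1 \<le> card (escape g A)"
        using A' by (metis One_nat_def Suc_leI card_gt_0_iff empty_iff escape_subset finite_subset)
      then have "1 \<le> 1 / (2 * (1 + real N)) * real (card A)"
        using A g unfolding almost_inv_def by fastforce
      also have "\<dots> < 1"
        using lt by (simp add: field_simps)
      finally show False
        by simp
    qed
    then have "rtrans K a \<subseteq> A"
      by auto
    then have "card (rtrans K a) \<le> card A"
      using A' by (intro card_mono)
    then show False
      using lt K a A' by (auto simp: card_rtrans subset_iff)
  qed
  then show thesis
    using that[of K "1 / (2 * (1 + real N))"] K by simp
qed

lemma next_tile_rtrans: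
  assumes \<tau>: "\<And>t c. set t \<subseteq> carrier G \<Longrightarrow> c \<in> carrier G \<Longrightarrow> \<tau> t \<Longrightarrow> \<tau> (lrtrans t c)"
    and \<L>: "\<And>L. L \<in> \<L> \<Longrightarrow> set L \<subseteq> carrier G"
    and t: "set t \<subseteq> carrier G" "c \<in> carrier G" "next_tile \<tau> \<L> \<epsilon> t"
  shows "next_tile \<tau> \<L> \<epsilon> (lrtrans t c)"
proof -
  obtain Ts where Ts: "t = concat Ts" "\<forall>s\<in>set Ts. \<tau> s"
    using t(3) by (auto simp: next_tile_def)
  obtain L d M where L: "L \<in> \<L>" "d \<in> carrier G" "subseq M t" "subseq M (lrtrans L d)"
    "(1 - \<epsilon>) * real (length L) \<le> real (length M)" "real (length t) \<le> (1 + \<epsilon>) * real (length L)"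
    using t(3) unfolding next_tile_def approx_tile_def by blast
  have "lrtrans t c = concat (map (\<lambda>s. lrtrans s c) Ts)"
    by (simp add: Ts(1) map_concat)
  moreover have "\<forall>s\<in>set (map (\<lambda>s. lrtrans s c) Ts). \<tau> s"
    using Ts t(1,2) by (auto intro!: \<tau>)
  moreover have "length (lrtrans M c) = length M" "length (lrtrans t c) = length t"
    by simp_all
  moreover have "subseq (lrtrans M c) (lrtrans t c)"
    using L(3) by (rule subseq_map)
  moreover have "subseq (lrtrans M c) (lrtrans L (d \<otimes> c))"
    using subseq_map[OF L(4), of "\<lambda>x. x \<otimes> c"]
    by (simp only: lrtrans_lrtrans[OF \<L>[OF L(1)] L(2) t(2)])
  ultimately show ?thesis
    using L(1,5,6) m_closed[OF L(2) t(2)] unfolding next_tile_def approx_tile_def by metis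
qed

text \<open>The overlap allowed in the quasi-tiling is small compared with \<open>1 / S\<close>. As a damaged \<open>\<tau>\<close>-tile has at
  most \<open>S\<close> elements, almost all \<open>\<tau>\<close>-tiles of a new shape survive intact and no boundary estimate for
  them is needed.\<close>

lemma rich_next_tile:
  assumes fol: "\<And>K e. finite K \<Longrightarrow> K \<subseteq> carrier G \<Longrightarrow> (0::real) < e \<Longrightarrow> \<exists>B. almost_inv K e B"
    and inf: "infinite (carrier G)"
    and \<tau>: "\<And>t c. set t \<subseteq> carrier G \<Longrightarrow> c \<in> carrier G \<Longrightarrow> \<tau> t \<Longrightarrow> \<tau> (lrtrans t c)"
      "\<And>t. \<tau> t \<Longrightarrow> length t \<le> S" and S: "1 \<le> S"
    and \<kappa>: "0 < \<kappa>" "\<kappa> \<le> 1" and \<tau>_rich: "rich \<tau> \<kappa>"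
    and E: "finite E" "E \<subseteq> carrier G" and \<epsilon>: "0 < \<epsilon>" "\<epsilon> \<le> 1/4"
  obtains \<L> \<kappa>' N where "finite \<L>" "\<L> \<noteq> {}" "\<And>L. L \<in> \<L> \<Longrightarrow> distinct L \<and> almost_inv E \<epsilon> (set L) \<and> N \<le> length L"
    "0 < N" "(2 + 4 * ln (real (card \<L>) * real N)) / real N \<le> \<epsilon>"
    "0 < \<kappa>'" "\<kappa>' \<le> 1" "rich (next_tile \<tau> \<L> \<epsilon>) \<kappa>'"
proof -
  \<comment> \<open>The constants are found backwards. \<open>\<theta>\<close> is the fraction of
    points that may be left over, small against the capacity \<open>\<kappa>'\<close>. It is spent
    on uncovered points (\<open>\<rho>\<close>) and on damaged tiles (\<open>\<beta>\<close>); as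
    one lost point can cost a tile of \<open>S\<close> points, the overlap allowed is
    \<open>\<beta> / S\<close>.\<close>
  define \<kappa>' where "\<kappa>' = min \<epsilon> (\<kappa> / 8)"
  define \<theta> where "\<theta> = \<kappa>' / 16"
  define \<beta> where "\<beta> = \<theta> / 4"
  define e where "e = \<beta> / real S"
  define \<rho> where "\<rho> = \<theta> / 2"
  have k': "0 < \<kappa>'" "\<kappa>' \<le> \<epsilon>" "\<kappa>' \<le> \<kappa> / 8" "\<kappa>' \<le> 1/4"
    using \<kappa> \<epsilon> by (auto simp: \<kappa>'_def)
  then have params: "0 < \<theta>" "\<theta> \<le> 1/64" "0 < \<beta>" "\<beta> \<le> \<epsilon>" "\<beta> \<le> 1/256" "0 < \<rho>" "\<rho> \<le> 1" "\<beta> + \<rho> \<le> \<theta>"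
    using \<epsilon> by (auto simp: \<theta>_def \<beta>_def \<rho>_def)
  have e: "0 < e" "e \<le> \<beta>" "real S * e = \<beta>"
    using params S by (auto simp: e_def field_simps)
  then have e2: "e \<le> 1/2"
    using params by simp
  obtain m0 where m0: "(1 - e/2) ^ m0 < \<rho>"
    using real_arch_pow_inv[of \<rho> "1 - e/2"] params e e2 by auto
  \<comment> \<open>The successor guarantees at least one shape, hence
    \<open>\<L> \<noteq> {}\<close>.\<close>
  define m where "m = Suc m0"
  have "(1 - e/2) ^ m \<le> 1 * (1 - e/2) ^ m0"
    unfolding m_def power_Suc using e e2 by (intro mult_right_mono) auto
  then have m: "(1 - e/2) ^ m \<le> \<rho>"
    using m0 by simp
  have mpos: "0 < real m"
    by (simp add: m_def)
  \<comment> \<open>\<open>m\<close> was determined by \<open>e\<close> and \<open>\<rho>\<close>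
    alone, before any shape of the new level is chosen; so the lengths can be made large against its
    logarithm.\<close>
  have "((\<lambda>n. (2 + 4 * ln (real m * real n)) / real n) \<longlongrightarrow> 0) sequentially"
    using mpos by real_asymp
  then have "eventually (\<lambda>n. (2 + 4 * ln (real m * real n)) / real n < \<epsilon>) sequentially"
    using \<epsilon> by (simp add: order_tendsto_iff)
  \<comment> \<open>This length keeps \<open>\<kappa>'\<close> times the length at least 1, as
    absorption demands, even after half of a shape is lost.\<close>
  moreover have "eventually (\<lambda>n. 2 / \<kappa>' \<le> real n) sequentially"
    by real_asymp
  ultimately have "eventually (\<lambda>n. (2 + 4 * ln (real m * real n)) / real n < \<epsilon> \<and> 2 / \<kappa>' \<le> real n) sequentially"
    by eventually_elim simp
  then obtain N where N: "(2 + 4 * ln (real m * real N)) / real N < \<epsilon>" "2 / \<kappa>' \<le> real N"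
    by (auto simp: eventually_sequentially)
  have N0: "0 < N"
  proof -
    have "0 < 2 / \<kappa>'"
      using k' by simp
    then show ?thesis
      using N(2) by linarith
  qed
  define good where "good = (\<lambda>L. distinct L \<and> N \<le> length L \<and>
    (\<exists>Ts. L = concat Ts \<and> (\<forall>t\<in>set Ts. \<tau> t) \<and> length L \<le> 2 * absorbing_mass \<tau> \<kappa> Ts))"
  obtain KN eN where KN: "finite KN" "KN \<subseteq> carrier G" "0 < eN" "\<And>A. almost_inv KN eN A \<Longrightarrow> N \<le> card A"
    using large_almost_inv[OF inf] by metis
  have avail: "\<exists>L. good L \<and> almost_inv K d (set L)" if K: "finite K" "K \<subseteq> carrier G" "0 < d" for K d
  proof -
    have "finite (K \<union> KN) \<and> K \<union> KN \<subseteq> carrier G \<and> 0 < min d eN"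
      using K KN by simp
    then have "\<exists>Ts. (\<forall>t\<in>set Ts. \<tau> t) \<and> distinct (concat Ts) \<and>
      almost_inv (K \<union> KN) (min d eN) (set (concat Ts)) \<and> length (concat Ts) \<le> 2 * absorbing_mass \<tau> \<kappa> Ts"
      using \<tau>_rich unfolding rich_def by blast
    then obtain Ts where Ts: "\<forall>t\<in>set Ts. \<tau> t" "distinct (concat Ts)"
      "almost_inv (K \<union> KN) (min d eN) (set (concat Ts))" "length (concat Ts) \<le> 2 * absorbing_mass \<tau> \<kappa> Ts"
      by blast
    have "N \<le> card (set (concat Ts))"
      by (rule KN(4), rule almost_inv_mono[OF Ts(3)]) auto
    then have "N \<le> length (concat Ts)"
      by (simp only: distinct_card[OF Ts(2)])
    then have "good (concat Ts)"
      unfolding good_def using Ts by blast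
    then show ?thesis
      using almost_inv_mono[OF Ts(3), of K d] by auto
  qed
  obtain f where f1: "\<And>i. i < m \<Longrightarrow> good (f i) \<and> almost_inv E \<epsilon> (set (f i))"
    and f2: "\<And>i j x. i < j \<Longrightarrow> j < m \<Longrightarrow> x \<in> set (f i) \<Longrightarrow>
      6 * real (card (set (f i))) * real (card (escape (inv x) (set (f j)))) \<le> \<rho> * real (card (set (f j)))"
    using choose_shapes[of good E \<epsilon> \<rho> m, OF avail E \<epsilon>(1) params(6)] by blast
  have "\<forall>i\<in>{..<m}. \<exists>Ts. f i = concat Ts \<and> (\<forall>t\<in>set Ts. \<tau> t) \<and> length (f i) \<le> 2 * absorbing_mass \<tau> \<kappa> Ts"
    using f1 unfolding good_def by blast
  then obtain Tf where Tf: "\<And>i. i < m \<Longrightarrow> f i = concat (Tf i)"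
    "\<And>i t. i < m \<Longrightarrow> t \<in> set (Tf i) \<Longrightarrow> \<tau> t"
    "\<And>i. i < m \<Longrightarrow> length (f i) \<le> 2 * absorbing_mass \<tau> \<kappa> (Tf i)"
    by (metis lessThan_iff)
  define F where "F = (\<lambda>i. set (f i))"
  have fd: "distinct (f i)" "N \<le> length (f i)" if "i < m" for i
    using f1[OF that] by (auto simp: good_def)
  have F: "finite (F i) \<and> F i \<noteq> {} \<and> F i \<subseteq> carrier G" if "i < m" for i
    using f1[OF that] by (simp add: almost_inv_def F_def)
  have cF: "card (F i) = length (f i)" if "i < m" for i
    using fd[OF that] by (simp add: F_def distinct_card)
  define \<L> where "\<L> = f ` {..<m}"
  define S' where "S' = 2 * (\<Sum>i<m. length (f i))"
  have lenS': "length T \<le> S'" if T: "next_tile \<tau> \<L> \<epsilon> T" for T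
  proof -
    obtain i where i: "i < m" "real (length T) \<le> (1 + \<epsilon>) * real (length (f i))"
      using T unfolding next_tile_def approx_tile_def \<L>_def by auto
    have "(1 + \<epsilon>) * real (length (f i)) \<le> 2 * real (length (f i))"
      using \<epsilon> by (intro mult_right_mono) auto
    moreover have "length (f i) \<le> (\<Sum>i<m. length (f i))"
      using i(1) by (intro member_le_sum) auto
    ultimately show ?thesis
      using i(2) unfolding S'_def by linarith
  qed
  have "rich (next_tile \<tau> \<L> \<epsilon>) \<kappa>'"
    unfolding rich_def
  proof (intro allI impI)
    fix K and e0 :: real
    assume K: "finite K \<and> K \<subseteq> carrier G \<and> 0 < e0"
    \<comment> \<open>\<open>B\<close> is taken so large that the term \<open>S'\<close> lost in
      \<open>absorb_list\<close> is at most an eighth of its size.\<close>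
    obtain KB eB where KB: "finite KB" "KB \<subseteq> carrier G" "0 < eB" "\<And>A. almost_inv KB eB A \<Longrightarrow> 8 * S' \<le> card A"
      using large_almost_inv[OF inf] by metis
    define sm where "sm = 1 + (\<Sum>i<m. real (card (F i)))"
    have sm: "1 \<le> sm"
      by (simp add: sm_def sum_nonneg)
    define d where "d = min e0 (min eB (\<rho> / (6 * sm)))"
    have "0 < d"
      using K KB params sm by (simp add: d_def)
    moreover have "finite (K \<union> KB \<union> (\<Union>i<m. F i))" "K \<union> KB \<union> (\<Union>i<m. F i) \<subseteq> carrier G"
      using K KB F by auto
    ultimately obtain B where B: "almost_inv (K \<union> KB \<union> (\<Union>i<m. F i)) d B"
      using fol by meson
    have B1: "almost_inv K e0 B" "8 * S' \<le> card B"
      by (rule almost_inv_mono[OF B] KB(4)[OF almost_inv_mono[OF B]]; auto simp: d_def)+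
    have Bf: "finite B" "B \<subseteq> carrier G"
      using B by (auto simp: almost_inv_def)
    have invB: "6 * real (card (F i)) * real (card (escape x B)) \<le> \<rho> * real (card B)" if i: "i < m" and x: "x \<in> F i" for i x
    proof -
      have "real (card (escape x B)) \<le> d * real (card B)"
        using B i x by (auto simp: almost_inv_def)
      also have "\<dots> \<le> \<rho> / (6 * sm) * real (card B)"
        by (intro mult_right_mono) (auto simp: d_def)
      finally have esc: "real (card (escape x B)) \<le> \<rho> / (6 * sm) * real (card B)" .
      have "real (card (F i)) \<le> (\<Sum>i<m. real (card (F i)))"
        using i by (intro member_le_sum) auto
      then have "6 * real (card (F i)) \<le> 6 * sm"
        by (simp add: sm_def)
      then have "6 * real (card (F i)) * real (card (escape x B)) \<le> 6 * sm * (\<rho> / (6 * sm) * real (card B))"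
        using esc sm by (intro mult_mono) auto
      then show ?thesis
        using sm by simp
    qed
    obtain Q where Q: "packing F {..<m} B e Q" "real (card (B - coverage Q)) \<le> \<rho> * real (card B)"
      by (rule quasi_tiling[OF Bf e(1) e2 _ F _ invB m]) (use params f2 in \<open>auto simp: F_def\<close>)
    have finQ: "finite Q"
      using Q(1) by (simp add: packing_def)
    \<comment> \<open>Of a translated shape only the tiles lying entirely in the retained part are
      kept. What remains is still an exact concatenation, and the lists \<open>T p\<close> inherit
      the disjointness of the retained parts.\<close>
    define kept where "kept = (\<lambda>p. filter (\<lambda>t. set t \<subseteq> {x. x \<otimes> fst (snd p) \<in> snd (snd p)}) (Tf (fst p)))"
    define W where "W = (\<lambda>p. map (\<lambda>t. lrtrans t (fst (snd p))) (kept p))"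
    define T where "T = (\<lambda>p. concat (W p))"
    have T_props: "distinct (T p)" "set (T p) \<subseteq> snd (snd p)"
        "(1 - \<beta>) * real (card (snd (snd p))) \<le> real (length (T p))"
        "absorbing (next_tile \<tau> \<L> \<epsilon>) \<kappa>' (T p)"
      if p: "p \<in> Q" for p
    proof -
      obtain i c P where p': "p = (i, c, P)"
        by (cases p)
      note pk = packingD[OF Q(1) p[unfolded p']]
      have i: "i < m"
        using pk(1) by simp
      have c: "c \<in> carrier G"
        using pk(2) .
      let ?K = "filter (\<lambda>t. set t \<subseteq> {x. x \<otimes> c \<in> P}) (Tf i)"
      have K': "kept p = ?K"
        by (simp add: kept_def p')
      have T': "T p = lrtrans (concat ?K) c"
        unfolding T_def W_def K' map_concat by (simp add: p')
      have sub: "subseq (concat ?K) (f i)"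
        unfolding Tf(1)[OF i] by (rule subseq_concat_filter)
      have carK: "set (concat ?K) \<subseteq> carrier G"
        using set_mono_subseq[OF sub] F[OF i] by (auto simp: F_def)
      have subT: "subseq (T p) (lrtrans (f i) c)"
        unfolding T' by (rule subseq_map[OF sub])
      show dT: "distinct (T p)"
        unfolding T' distinct_map using distinct_subseq[OF sub fd(1)[OF i]] inj_on_rtrans[OF carK c] by blast
      show "set (T p) \<subseteq> snd (snd p)"
        unfolding T' by (auto simp: p')
      have cP: "card (F i - {x. x \<otimes> c \<in> P}) = card (rtrans (F i) c - P)"
      proof -
        have "rtrans (F i) c - P = rtrans (F i - {x. x \<otimes> c \<in> P}) c"
          by auto
        moreover have "F i - {x. x \<otimes> c \<in> P} \<subseteq> carrier G"
          using F[OF i] by blast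
        ultimately show ?thesis
          using card_rtrans c by presburger
      qed
      have "real (S * card (F i - {x. x \<otimes> c \<in> P})) \<le> real S * (e * real (card (F i)))"
        unfolding cP of_nat_mult by (intro mult_left_mono pk(5)) auto
      also have "\<dots> = \<beta> * real (length (f i))"
        unfolding cF[OF i] by (simp flip: e(3))
      finally have loss: "real (S * card (set (concat (Tf i)) - {x. x \<otimes> c \<in> P})) \<le> \<beta> * real (length (f i))"
        by (simp only: F_def Tf(1)[OF i])
      have tl: "\<forall>t\<in>set (Tf i). length t \<le> S" "distinct (concat (Tf i))"
        using \<tau>(2) Tf[OF i] fd[OF i] by auto
      have "length (concat (Tf i)) \<le> length (concat ?K) + S * card (set (concat (Tf i)) - {x. x \<otimes> c \<in> P})"
        using filter_tiles_mass[where w = length, OF _ tl] by (simp add: length_concat)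
      then have lenK: "real (length (f i)) \<le> real (length (concat ?K)) + \<beta> * real (length (f i))"
        using loss unfolding Tf(1)[OF i] by linarith
      then have lenT: "(1 - \<beta>) * real (length (f i)) \<le> real (length (T p))"
        unfolding T' by (simp add: left_diff_distrib)
      have "absorbing_mass \<tau> \<kappa> (Tf i) \<le> absorbing_mass \<tau> \<kappa> ?K + S * card (set (concat (Tf i)) - {x. x \<otimes> c \<in> P})"
        unfolding absorbing_mass_def by (rule filter_tiles_mass[OF _ tl]) auto
      moreover have "real (length (f i)) \<le> 2 * real (absorbing_mass \<tau> \<kappa> (Tf i))"
        using Tf(3)[OF i] by linarith
      moreover have "\<beta> * real (length (f i)) \<le> 1/4 * real (length (f i))"
        using params by (intro mult_right_mono) auto
      ultimately have massK: "real (length (f i)) / 4 \<le> real (absorbing_mass \<tau> \<kappa> ?K)"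
        using loss by linarith
      have "absorbing_mass \<tau> \<kappa> ?K \<le> absorbing_mass \<tau> \<kappa> (W p)"
        unfolding absorbing_mass_def W_def K' map_map unfolding p' fst_conv snd_conv
      proof (rule sum_list_mono)
        fix t assume t: "t \<in> set ?K"
        then have "set t \<subseteq> carrier G"
          using carK by auto
        then have "absorbing \<tau> \<kappa> t \<Longrightarrow> absorbing \<tau> \<kappa> (lrtrans t c)"
          using absorbing_rtrans[where \<tau> = \<tau>] \<tau>(1) c by blast
        then show "(if absorbing \<tau> \<kappa> t then length t else 0) \<le>
          ((\<lambda>t. if absorbing \<tau> \<kappa> t then length t else 0) \<circ> (\<lambda>t. lrtrans t c)) t"
          by auto
      qed
      then have massW: "real (length (f i)) / 4 \<le> real (absorbing_mass \<tau> \<kappa> (W p))"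
        using massK by linarith
      have "card P \<le> card (rtrans (F i) c)"
        using pk(3) F[OF i] by (intro card_mono) auto
      also have "\<dots> = length (f i)"
        using F[OF i] c cF[OF i] by (simp add: card_rtrans)
      finally have "(1 - \<beta>) * real (card P) \<le> (1 - \<beta>) * real (length (f i))"
        using params by (intro mult_left_mono) auto
      then show "(1 - \<beta>) * real (card (snd (snd p))) \<le> real (length (T p))"
        using lenT by (simp add: p')
      show "absorbing (next_tile \<tau> \<L> \<epsilon>) \<kappa>' (T p)"
        unfolding T_def
      proof (rule absorbing_next_tile[where L = "f i" and c = c and \<kappa> = \<kappa> and S = S])
        show "\<forall>t\<in>set (W p). \<tau> t \<and> length t \<le> S"
        proof
          fix t assume "t \<in> set (W p)"
          then obtain s where s: "s \<in> set ?K" "t = lrtrans s c"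
            unfolding W_def K' by (auto simp: p')
          then have "\<tau> s" "set s \<subseteq> carrier G"
            using Tf(2)[OF i] carK by auto
          then have "\<tau> t"
            using \<tau>(1) c s(2) by blast
          then show "\<tau> t \<and> length t \<le> S"
            using \<tau>(2) by blast
        qed
        show "distinct (concat (W p))" "subseq (concat (W p)) (lrtrans (f i) c)"
          using dT subT by (simp_all add: T_def)
        show "f i \<in> \<L>"
          using i by (simp add: \<L>_def)
        show "(1 - \<epsilon>) * real (length (f i)) \<le> real (length (concat (W p)))"
        proof -
          have "(1 - \<epsilon>) * real (length (f i)) \<le> (1 - \<beta>) * real (length (f i))"
            using params by (intro mult_right_mono) auto
          then show ?thesis
            using lenT by (simp add: T_def)
        qed
        show "1 \<le> \<kappa>' * real (length (concat (W p)))"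
        proof -
          have "2 / \<kappa>' \<le> real (length (f i))"
            using N(2) fd(2)[OF i] by linarith
          moreover have "1/2 * real (length (f i)) \<le> (1 - \<beta>) * real (length (f i))"
            using params by (intro mult_right_mono) auto
          ultimately have "1 / \<kappa>' \<le> real (length (T p))"
            using lenT by simp
          then show ?thesis
            using k' by (simp add: T_def field_simps)
        qed
      qed (use c massW \<kappa> k' in auto)
    qed
    obtain ps where ps: "set ps = Q" "distinct ps"
      using finite_distinct_list[OF finQ] by blast
    define Us where "Us = map T ps"
    have dQ: "snd (snd p) \<inter> snd (snd q) = {}" if "p \<in> Q" "q \<in> Q" "p \<noteq> q" for p q
      using Q(1) that unfolding packing_def by blast
    have dUs: "distinct (concat (map T qs))" if "set qs \<subseteq> Q" "distinct qs" for qs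
      using that
    proof (induction qs)
      case (Cons q qs)
      have "set (T q) \<inter> set (T q') = {}" if "q' \<in> set qs" for q'
        using dQ[of q q'] T_props(2)[of q] T_props(2)[of q'] Cons.prems that by auto
      then show ?case
        using Cons T_props(1)[of q] by auto
    qed simp
    have dU: "distinct (concat Us)"
      unfolding Us_def by (rule dUs) (use ps in auto)
    have UB: "set (concat Us) \<subseteq> B"
      using T_props(2) packing_coverage_subset[OF Q(1)] ps by (fastforce simp: Us_def coverage_def)
    have covB: "card (coverage Q) = (\<Sum>p\<in>Q. card (snd (snd p)))"
      unfolding coverage_def
      by (intro card_UN_disjoint finQ) (use dQ Bf packing_coverage_subset[OF Q(1)] in \<open>auto simp: coverage_def UN_subset_iff finite_subset\<close>)
    have lenU: "(1 - \<theta>) * real (card B) \<le> real (length (concat Us))"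
    proof -
      have "coverage Q \<subseteq> B"
        by (rule packing_coverage_subset[OF Q(1)])
      then have "card (B - coverage Q) = card B - card (coverage Q)" "card (coverage Q) \<le> card B"
        using Bf by (auto simp: card_Diff_subset finite_subset card_mono)
      then have c1: "real (card B) - \<rho> * real (card B) \<le> real (card (coverage Q))"
        using Q(2) by linarith
      have "length (concat Us) = (\<Sum>p\<in>Q. length (T p))"
        using ps by (simp add: Us_def length_concat sum_list_distinct_conv_sum_set comp_def)
      moreover have "(\<Sum>p\<in>Q. (1 - \<beta>) * real (card (snd (snd p)))) \<le> (\<Sum>p\<in>Q. real (length (T p)))"
        by (intro sum_mono T_props(3))
      ultimately have "(1 - \<beta>) * real (card (coverage Q)) \<le> real (length (concat Us))"
        by (simp add: covB sum_distrib_left)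
      moreover have "(1 - \<beta>) * (real (card B) - \<rho> * real (card B)) \<le> (1 - \<beta>) * real (card (coverage Q))"
        using c1 params by (intro mult_left_mono) auto
      moreover have "(1 - \<theta>) * real (card B) \<le> (1 - \<beta>) * (real (card B) - \<rho> * real (card B))"
      proof -
        have "0 \<le> \<beta> * \<rho>"
          using params by simp
        then have "1 - \<theta> \<le> (1 - \<beta>) * (1 - \<rho>)"
          using params(8) by (simp add: algebra_simps)
        then have "(1 - \<theta>) * real (card B) \<le> (1 - \<beta>) * (1 - \<rho>) * real (card B)"
          by (intro mult_right_mono) auto
        then show ?thesis
          by (simp add: algebra_simps)
      qed
      ultimately show ?thesis
        by linarith
    qed
    obtain ys where ys: "set ys = B - set (concat Us)" "distinct ys"
      using finite_distinct_list[of "B - set (concat Us)"] Bf by blast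
    have "length ys = card B - length (concat Us)"
      using distinct_card[OF ys(2)] distinct_card[OF dU] ys(1) UB Bf by (simp add: card_Diff_subset finite_subset)
    moreover have "length (concat Us) \<le> card B"
      using distinct_card[OF dU] card_mono[OF Bf(1) UB] by simp
    ultimately have lys: "real (length ys) \<le> \<theta> * real (card B)"
      using lenU by (simp add: left_diff_distrib of_nat_diff)
    have massU: "absorbing_mass (next_tile \<tau> \<L> \<epsilon>) \<kappa>' Us = length (concat Us)"
    proof -
      have "map (\<lambda>t. if absorbing (next_tile \<tau> \<L> \<epsilon>) \<kappa>' t then length t else 0) Us = map length Us"
        using T_props(4) ps by (auto simp: Us_def)
      then show ?thesis
        unfolding absorbing_mass_def length_concat by (rule arg_cong)
    qed
    have l2: "(1 - \<theta>) * real (card B) \<ge> 63/64 * real (card B)"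
      using params by (intro mult_right_mono) auto
    have "\<exists>Ts'. (\<forall>t\<in>set Ts'. next_tile \<tau> \<L> \<epsilon> t) \<and> subseq (concat Us) (concat Ts') \<and>
       mset (concat Ts') = mset (concat Us) + mset ys \<and>
       real (absorbing_mass (next_tile \<tau> \<L> \<epsilon>) \<kappa>' Us) - 2 / \<kappa>' * real (length ys) - real S' \<le>
         real (absorbing_mass (next_tile \<tau> \<L> \<epsilon>) \<kappa>' Ts')"
    proof (rule absorb_list)
      show "\<forall>t\<in>set Us. next_tile \<tau> \<L> \<epsilon> t \<and> length t \<le> S'"
        using T_props(4) lenS' ps by (auto simp: Us_def absorbing_def)
      show "distinct (concat Us @ ys)"
        using dU ys by auto
      show "set ys \<subseteq> carrier G"
        using ys Bf by auto
      have "\<theta> * real (card B) \<le> \<kappa>' / 2 * (63/64 * real (card B))"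
        unfolding \<theta>_def using k' by simp
      also have "\<dots> \<le> \<kappa>' / 2 * real (length (concat Us))"
        using l2 lenU k' by (intro mult_left_mono) auto
      finally show "real (length ys) \<le> \<kappa>' / 2 * real (absorbing_mass (next_tile \<tau> \<L> \<epsilon>) \<kappa>' Us)"
        unfolding massU using lys by linarith
    qed (use k' in auto)
    then obtain Ts' where Ts': "\<forall>t\<in>set Ts'. next_tile \<tau> \<L> \<epsilon> t"
       "mset (concat Ts') = mset (concat Us @ ys)"
       "real (absorbing_mass (next_tile \<tau> \<L> \<epsilon>) \<kappa>' Us) - 2 / \<kappa>' * real (length ys) - real S' \<le>
         real (absorbing_mass (next_tile \<tau> \<L> \<epsilon>) \<kappa>' Ts')"
      by auto
    have d': "distinct (concat Ts')"
      using mset_eq_imp_distinct_iff[OF Ts'(2)] dU ys by auto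
    have s': "set (concat Ts') = B"
      using mset_eq_setD[OF Ts'(2)] ys UB by auto
    have l': "length (concat Ts') = card B"
      using distinct_card[OF d'] s' by simp
    \<comment> \<open>All of \<open>Us\<close> is absorbing, which is at least 63/64 of
      \<open>B\<close>. One eighth is lost to the tiles that were filled and another to
      \<open>S'\<close>; more than the half demanded by \<open>rich\<close> is left.\<close>
    have "2 / \<kappa>' * real (length ys) \<le> 2 / \<kappa>' * (\<theta> * real (card B))"
      using lys k' by (intro mult_left_mono) auto
    also have "\<dots> = real (card B) / 8"
      unfolding \<theta>_def using k' by simp
    finally have "real (card B) \<le> 2 * real (absorbing_mass (next_tile \<tau> \<L> \<epsilon>) \<kappa>' Ts')"
      using Ts'(3) B1(2) l2 lenU unfolding massU by linarith
    then have "length (concat Ts') \<le> 2 * absorbing_mass (next_tile \<tau> \<L> \<epsilon>) \<kappa>' Ts'"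
      unfolding l' by linarith
    then show "\<exists>Ts. (\<forall>t\<in>set Ts. next_tile \<tau> \<L> \<epsilon> t) \<and> distinct (concat Ts) \<and> almost_inv K e0 (set (concat Ts)) \<and>
        length (concat Ts) \<le> 2 * absorbing_mass (next_tile \<tau> \<L> \<epsilon>) \<kappa>' Ts"
      using Ts'(1) d' B1(1) s' by blast
  qed
  moreover have "finite \<L>" "\<L> \<noteq> {}"
    by (auto simp: \<L>_def m_def)
  moreover have "distinct L \<and> almost_inv E \<epsilon> (set L) \<and> N \<le> length L" if "L \<in> \<L>" for L
    using that f1 fd by (auto simp: \<L>_def)
  moreover have "(2 + 4 * ln (real (card \<L>) * real N)) / real N \<le> \<epsilon>"
  proof -
    have "card \<L> \<le> m" "0 < card \<L>"
      using card_image_le[of "{..<m}" f] \<open>finite \<L>\<close> \<open>\<L> \<noteq> {}\<close> by (auto simp: \<L>_def card_gt_0_iff)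
    then have "ln (real (card \<L>) * real N) \<le> ln (real m * real N)"
      using N0 by (intro ln_mono mult_right_mono) auto
    then have "(2 + 4 * ln (real (card \<L>) * real N)) / real N \<le> (2 + 4 * ln (real m * real N)) / real N"
      by (intro divide_right_mono) auto
    then show ?thesis
      using N(1) by linarith
  qed
  ultimately show thesis
    using that[of \<L> N \<kappa>'] N0 k' by auto
qed

end

section \<open>The hierarchy of tiles\<close>

context group begin

lemma next_tileD:
  assumes "next_tile \<tau> \<L> \<epsilon> T"
  shows "\<exists>Ts. T = concat Ts \<and> (\<forall>t\<in>set Ts. \<tau> t)" "approx_tile \<L> \<epsilon> T"
  using assms by (simp_all add: next_tile_def)

lemma rich_base:
  assumes fol: "\<And>K e. finite K \<Longrightarrow> K \<subseteq> carrier G \<Longrightarrow> (0::real) < e \<Longrightarrow> \<exists>B. almost_inv K e B"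
  shows "rich (\<lambda>t. length t = 1 \<or> length t = 2) 1"
  unfolding rich_def
proof (intro allI impI)
  let ?\<tau> = "\<lambda>t :: 'a list. length t = 1 \<or> length t = 2"
  fix K and e :: real
  assume "finite K \<and> K \<subseteq> carrier G \<and> 0 < e"
  then obtain B where B: "almost_inv K e B"
    using fol by blast
  then obtain xs where xs: "set xs = B" "distinct xs"
    using finite_distinct_list unfolding almost_inv_def by blast
  have abs: "absorbing ?\<tau> 1 [x]" for x
    unfolding absorbing_def
  proof (intro conjI allI impI)
    fix ys :: "'a list"
    assume ys: "distinct ys \<and> set ys \<subseteq> carrier G \<and> set ys \<inter> set [x] = {} \<and> real (length ys) \<le> 1 * real (length [x])"
    then have "real (length ys) \<le> 1"
      by simp
    then have "length ys = 0 \<or> length ys = 1"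
      by linarith
    then show "\<exists>t'. (length t' = 1 \<or> length t' = 2) \<and> subseq [x] t' \<and> mset t' = mset [x] + mset ys"
      by (intro exI[of _ "x # ys"]) (auto simp: subseq_singleton_left)
  qed auto
  have c: "concat (map (\<lambda>x. [x]) xs) = xs"
    by (induction xs) auto
  have "absorbing_mass ?\<tau> 1 (map (\<lambda>x. [x]) xs) = length xs"
    unfolding absorbing_mass_def by (induction xs) (simp_all add: abs del: One_nat_def)
  then show "\<exists>Ts. (\<forall>t\<in>set Ts. ?\<tau> t) \<and> distinct (concat Ts) \<and> almost_inv K e (set (concat Ts)) \<and>
      length (concat Ts) \<le> 2 * absorbing_mass ?\<tau> 1 Ts"
    using xs B by (intro exI[of _ "map (\<lambda>x. [x]) xs"]) (simp add: c)
qed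

text \<open>The passage to the next level is iterated by dependent choice. A tile is by definition a
  concatenation of tiles of the level before, so a list made of tiles of level \<open>n\<close>
  splits exactly at all lower levels.\<close>

lemma tile_hierarchy:
  assumes fol: "\<And>K e. finite K \<Longrightarrow> K \<subseteq> carrier G \<Longrightarrow> (0::real) < e \<Longrightarrow> \<exists>B. almost_inv K e B"
    and inf: "infinite (carrier G)"
    and E: "\<And>k. finite (E k)" "\<And>k. E k \<subseteq> carrier G" and \<epsilon>: "\<And>k::nat. 0 < \<epsilon> k" "\<And>k. \<epsilon> k \<le> 1/4"
  obtains \<L> N X where
    "\<And>k. finite (\<L> k)" "\<And>k. \<L> k \<noteq> {}"
    "\<And>k L. L \<in> \<L> k \<Longrightarrow> distinct L \<and> almost_inv (E k) (\<epsilon> k) (set L) \<and> N k \<le> length L"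
    "\<And>k. 0 < N k" "\<And>k. (2 + 4 * ln (real (card (\<L> k)) * real (N k))) / real (N k) \<le> \<epsilon> k"
    "\<And>n. distinct (X n)" "\<And>n. almost_inv (E n) (\<epsilon> n) (set (X n))"
    "\<And>k n. k \<le> n \<Longrightarrow> \<exists>Ts. X n = concat Ts \<and> (\<forall>T\<in>set Ts. approx_tile (\<L> k) (\<epsilon> k) T)"
proof -
  define step where "step = (\<lambda>k (s :: ('a list \<Rightarrow> bool) \<times> real) (s' :: ('a list \<Rightarrow> bool) \<times> real) \<L> N. fst s' = next_tile (fst s) \<L> (\<epsilon> k) \<and>
    finite \<L> \<and> \<L> \<noteq> {} \<and> (\<forall>L\<in>\<L>. distinct L \<and> almost_inv (E k) (\<epsilon> k) (set L) \<and> N \<le> length L) \<and>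
    0 < N \<and> (2 + 4 * ln (real (card \<L>) * real N)) / real N \<le> \<epsilon> k)"
  define ok where "ok = (\<lambda>s :: ('a list \<Rightarrow> bool) \<times> real.
    (\<forall>t c. set t \<subseteq> carrier G \<longrightarrow> c \<in> carrier G \<longrightarrow> fst s t \<longrightarrow> fst s (lrtrans t c)) \<and>
    (\<exists>S\<ge>1. \<forall>t. fst s t \<longrightarrow> length t \<le> S) \<and> 0 < snd s \<and> snd s \<le> 1 \<and> rich (fst s) (snd s))"
  have "\<exists>f. \<forall>k. ok (f k) \<and> (\<exists>\<L> N. step k (f k) (f (Suc k)) \<L> N)"
  proof (rule dependent_nat_choice)
    show "\<exists>s. ok s"
      by (rule exI[of _ "(\<lambda>t. length t = 1 \<or> length t = 2, 1)"])
        (auto simp: ok_def rich_base[OF fol] simp del: One_nat_def intro!: exI[of _ 2])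
  next
    fix s k
    assume "ok s"
    then obtain S where s: "\<And>t c. set t \<subseteq> carrier G \<Longrightarrow> c \<in> carrier G \<Longrightarrow> fst s t \<Longrightarrow> fst s (lrtrans t c)"
      "1 \<le> S" "\<And>t. fst s t \<Longrightarrow> length t \<le> S" "0 < snd s" "snd s \<le> 1" "rich (fst s) (snd s)"
      unfolding ok_def by blast
    have "\<exists>\<L> \<kappa>' N. finite \<L> \<and> \<L> \<noteq> {} \<and> (\<forall>L\<in>\<L>. distinct L \<and> almost_inv (E k) (\<epsilon> k) (set L) \<and> N \<le> length L) \<and>
      0 < N \<and> (2 + 4 * ln (real (card \<L>) * real N)) / real N \<le> \<epsilon> k \<and>
      0 < \<kappa>' \<and> \<kappa>' \<le> 1 \<and> rich (next_tile (fst s) \<L> (\<epsilon> k)) \<kappa>'"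
      by (rule rich_next_tile[of "fst s" S "snd s" "E k" "\<epsilon> k"]; (fact fol inf s E \<epsilon>)?) blast
    then obtain \<L> \<kappa>' N where \<L>: "finite \<L>" "\<L> \<noteq> {}"
      "\<And>L. L \<in> \<L> \<Longrightarrow> distinct L \<and> almost_inv (E k) (\<epsilon> k) (set L) \<and> N \<le> length L"
      "0 < N" "(2 + 4 * ln (real (card \<L>) * real N)) / real N \<le> \<epsilon> k"
      "0 < \<kappa>'" "\<kappa>' \<le> 1" "rich (next_tile (fst s) \<L> (\<epsilon> k)) \<kappa>'"
      by blast
    have "next_tile (fst s) \<L> (\<epsilon> k) (lrtrans t c)"
      if "set t \<subseteq> carrier G" "c \<in> carrier G" "next_tile (fst s) \<L> (\<epsilon> k) t" for t c
      using next_tile_rtrans[of "fst s" \<L> t c "\<epsilon> k"] s(1) \<L>(3) that by (auto simp: almost_inv_def)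
    moreover have "length t \<le> 1 + 2 * (\<Sum>L\<in>\<L>. length L)" if t: "next_tile (fst s) \<L> (\<epsilon> k) t" for t
    proof -
      obtain L where L: "L \<in> \<L>" "real (length t) \<le> (1 + \<epsilon> k) * real (length L)"
        using next_tileD(2)[OF t] by (auto simp: approx_tile_def)
      have "(1 + \<epsilon> k) * real (length L) \<le> 2 * real (length L)"
        using \<epsilon>(2)[of k] by (intro mult_right_mono) auto
      moreover have "length L \<le> (\<Sum>L\<in>\<L>. length L)"
        using L(1) \<L>(1) by (intro member_le_sum) auto
      ultimately show ?thesis
        using L(2) by linarith
    qed
    ultimately have "ok (next_tile (fst s) \<L> (\<epsilon> k), \<kappa>')"
      unfolding ok_def fst_conv snd_conv using \<L>(6-8) by (intro conjI exI[of _ "1 + 2 * (\<Sum>L\<in>\<L>. length L)"]) auto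
    moreover have "step k s (next_tile (fst s) \<L> (\<epsilon> k), \<kappa>') \<L> N"
      unfolding step_def using \<L> by auto
    ultimately show "\<exists>s'. ok s' \<and> (\<exists>\<L> N. step k s s' \<L> N)"
      by blast
  qed
  then obtain f where f: "\<And>k. ok (f k)" "\<And>k. \<exists>\<L> N. step k (f k) (f (Suc k)) \<L> N"
    by blast
  then obtain \<L> N where st: "\<And>k. step k (f k) (f (Suc k)) (\<L> k) (N k)"
    by metis
  have "\<exists>Ts. (\<forall>t\<in>set Ts. fst (f (Suc n)) t) \<and> distinct (concat Ts) \<and> almost_inv (E n) (\<epsilon> n) (set (concat Ts))" for n
  proof -
    have "rich (fst (f (Suc n))) (snd (f (Suc n)))"
      using f(1)[of "Suc n"] by (simp add: ok_def)
    moreover have "finite (E n) \<and> E n \<subseteq> carrier G \<and> 0 < \<epsilon> n"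
      using E \<epsilon> by simp
    ultimately obtain Ts where "\<forall>t\<in>set Ts. fst (f (Suc n)) t" "distinct (concat Ts)"
      "almost_inv (E n) (\<epsilon> n) (set (concat Ts))"
      unfolding rich_def by meson
    then show ?thesis
      by blast
  qed
  then obtain Z where Z: "\<And>n. \<forall>t\<in>set (Z n). fst (f (Suc n)) t" "\<And>n. distinct (concat (Z n))"
    "\<And>n. almost_inv (E n) (\<epsilon> n) (set (concat (Z n)))"
    by metis
  \<comment> \<open>Index shift: \<open>f 0\<close> is the class of single points and pairs, and the
    tiles of level \<open>k\<close> are those of the class \<open>f (Suc k)\<close>.\<close>
  have fS: "fst (f (Suc k)) = next_tile (fst (f k)) (\<L> k) (\<epsilon> k)" for k
    using st[of k] by (simp add: step_def)
  have dec: "\<exists>Ts. concat (Z n) = concat Ts \<and> (\<forall>t\<in>set Ts. fst (f (Suc k)) t)" if "k \<le> n" for k n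
    using that
  proof (induction k rule: inc_induct)
    case base
    then show ?case
      using Z(1) by blast
  next
    case (step k)
    then obtain Ts where Ts: "concat (Z n) = concat Ts" "\<forall>t\<in>set Ts. fst (f (Suc (Suc k))) t"
      by blast
    have "\<forall>t\<in>set Ts. \<exists>Us. t = concat Us \<and> (\<forall>u\<in>set Us. fst (f (Suc k)) u)"
      using Ts(2) next_tileD(1) unfolding fS[of "Suc k"] by blast
    then obtain U where U: "\<forall>t\<in>set Ts. t = concat (U t) \<and> (\<forall>u\<in>set (U t). fst (f (Suc k)) u)"
      by metis
    have "concat (concat (map U Ts)) = concat Ts"
      using U by (induction Ts) auto
    then show ?case
      using Ts(1) U by (intro exI[of _ "concat (map U Ts)"]) auto
  qed
  show thesis
  proof (rule that[of \<L> N "\<lambda>n. concat (Z n)"])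
    show "\<exists>Ts. concat (Z n) = concat Ts \<and> (\<forall>T\<in>set Ts. approx_tile (\<L> k) (\<epsilon> k) T)" if "k \<le> n" for k n
      using dec[OF that] next_tileD(2) unfolding fS by blast
  qed (use st Z in \<open>auto simp: step_def\<close>)
qed

end

section \<open>Order and counting in concatenations of tiles\<close>

lemma subseq_pair_set: "subseq [x, y] X \<Longrightarrow> x \<in> set X \<and> y \<in> set X"
  using set_mono_subseq by fastforce

lemma subseq_pair_append:
  "subseq [x, y] (A @ B) \<longleftrightarrow> subseq [x, y] A \<or> subseq [x, y] B \<or> (x \<in> set A \<and> y \<in> set B)"
proof (induction A)
  case (Cons a A)
  then show ?case
    by (cases "x = a") (auto simp: subseq_singleton_left dest: subseq_pair_set)
qed auto

lemma subseq_pair_total: "x \<in> set X \<Longrightarrow> y \<in> set X \<Longrightarrow> x \<noteq> y \<Longrightarrow> subseq [x, y] X \<or> subseq [y, x] X"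
  by (induction X) (auto simp: subseq_singleton_left)

lemma subseq_pair_Cons: "subseq [x, y] (a # X) \<longleftrightarrow> (x = a \<and> y \<in> set X) \<or> subseq [x, y] X"
  using subseq_pair_append[of x y "[a]" X] by auto

lemma subseq_pair_asym: "distinct X \<Longrightarrow> subseq [x, y] X \<Longrightarrow> \<not> subseq [y, x] X"
proof (induction X)
  case (Cons a X)
  then show ?case
    using subseq_pair_set[of x y X] subseq_pair_set[of y x X] unfolding subseq_pair_Cons distinct.simps by metis
qed simp

lemma subseq_pair_irrefl: "distinct X \<Longrightarrow> \<not> subseq [x, x] X"
  using subseq_pair_asym[of X x x] by blast

lemma subseq_pair_trans: "distinct X \<Longrightarrow> subseq [x, y] X \<Longrightarrow> subseq [y, z] X \<Longrightarrow> subseq [x, z] X"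
proof (induction X)
  case (Cons a X)
  then show ?case
    using subseq_pair_set[of x y X] subseq_pair_set[of y z X] unfolding subseq_pair_Cons distinct.simps by metis
qed simp

lemma subseq_pair_subseq_iff:
  assumes "subseq M X" "distinct X" "x \<in> set M" "y \<in> set M"
  shows "subseq [x, y] X \<longleftrightarrow> subseq [x, y] M"
proof -
  have "subseq [x, y] M \<Longrightarrow> subseq [x, y] X" for x y
    using assms(1) subseq_order.trans by blast
  then show ?thesis
    using assms subseq_pair_total[of x M y] subseq_pair_asym[of X x y] subseq_pair_irrefl[of X] by blast
qed

lemma subseq_pair_map_iff:
  assumes "inj_on f A" "set X \<subseteq> A" "x \<in> A" "y \<in> A"
  shows "subseq [f x, f y] (map f X) \<longleftrightarrow> subseq [x, y] X"
  using assms(2)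
proof (induction X)
  case (Cons a X)
  have "f x = f a \<longleftrightarrow> x = a" "f y \<in> f ` set X \<longleftrightarrow> y \<in> set X"
    using assms Cons.prems by (auto simp: inj_on_def)
  then show ?case
    using Cons by (cases "x = a") (auto simp: subseq_singleton_left)
qed simp

lemma between_subset_block:
  assumes "X = A @ T @ B" "distinct X" "x \<in> set T" "y \<in> set T" "subseq [x, z] X" "subseq [z, y] X"
  shows "z \<in> set T"
proof (rule ccontr)
  assume "z \<notin> set T"
  moreover have "z \<in> set X"
    using assms(5) subseq_pair_set by fast
  ultimately consider "z \<in> set A" | "z \<in> set B"
    using assms(1) by auto
  then show False
  proof cases
    case 1
    then have "subseq [z, x] X"
      using assms(1,3) by (auto simp: subseq_pair_append)
    then show False
      using subseq_pair_asym assms by metis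
  next
    case 2
    then have "subseq [y, z] X"
      using assms(1,4) by (auto simp: subseq_pair_append)
    then show False
      using subseq_pair_asym assms by metis
  qed
qed

lemma distinct_split_unique:
  assumes "distinct (A @ x # B)" "A @ x # B = A' @ x # B'"
  shows "A = A'" "B = B'"
proof -
  have "x \<notin> set A" "x \<notin> set B"
    using assms(1) by auto
  then show "A = A'" "B = B'"
    using append_Cons_eq_iff[of x A B A' B'] assms(2) by simp_all
qed

lemma in_butlastE:
  assumes "x \<in> set (butlast T)"
  obtains P y Q where "T = P @ x # y # Q"
proof -
  obtain P Q where PQ: "butlast T = P @ x # Q"
    using assms split_list by metis
  have "T \<noteq> []"
    using assms by auto
  then have "T = butlast T @ [last T]"
    by simp
  then have "T = P @ x # (Q @ [last T])"
    unfolding PQ by simp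
  moreover obtain y Q' where "Q @ [last T] = y # Q'"
    by (cases "Q @ [last T]") auto
  ultimately show thesis
    using that by metis
qed

lemma split_at_block: "T \<in> set Ts \<Longrightarrow> \<exists>A B. concat Ts = A @ T @ B"
  by (metis concat.simps(2) concat_append split_list)

text \<open>The passage from local to global: a density bound inside each tile becomes one for the
  whole list, with a constant that does not depend on the number of tiles. The uniformity in
  \<open>n\<close> of later bounds rests on this.\<close>

lemma card_concat_le:
  fixes q :: real
  assumes "distinct (concat Ts)" "\<And>T. T \<in> set Ts \<Longrightarrow> real (card (A \<inter> set T)) \<le> q * real (length T)"
    "A \<subseteq> set (concat Ts)"
  shows "real (card A) \<le> q * real (length (concat Ts))"
  using assms
proof (induction Ts arbitrary: A)
  case (Cons T Ts)
  have "real (card (A \<inter> set (concat Ts))) \<le> q * real (length (concat Ts))"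
  proof (rule Cons.IH)
    fix T' assume T': "T' \<in> set Ts"
    then have "A \<inter> set (concat Ts) \<inter> set T' = A \<inter> set T'"
      by auto
    then show "real (card (A \<inter> set (concat Ts) \<inter> set T')) \<le> q * real (length T')"
      using Cons.prems(2)[of T'] T' by simp
  qed (use Cons.prems in auto)
  moreover have "card A = card (A \<inter> set T) + card (A \<inter> set (concat Ts))"
    using Cons.prems by (subst card_Un_disjoint[symmetric]) (auto intro!: arg_cong[where f = card])
  ultimately show ?case
    using Cons.prems(2)[of T] by (simp add: algebra_simps)
qed simp

lemma sum_concat_le:
  fixes q :: real
  assumes "distinct Ts" "\<And>T. T \<in> set Ts \<Longrightarrow> v T \<le> q * real (length T)"
  shows "(\<Sum>T\<in>set Ts. v T) \<le> q * real (length (concat Ts))"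
proof -
  have "(\<Sum>T\<in>set Ts. v T) \<le> (\<Sum>T\<in>set Ts. q * real (length T))"
    using assms by (intro sum_mono) auto
  also have "\<dots> = q * real (length (concat Ts))"
    using assms(1) by (simp add: length_concat sum_list_distinct_conv_sum_set sum_distrib_left)
  finally show ?thesis .
qed

lemma concat_prefix_blocks:
  assumes "concat Ts = I @ D" "\<forall>T\<in>set Ts. length T \<le> S"
  shows "\<exists>Us P. I = concat Us @ P \<and> length P \<le> S \<and> set Us \<subseteq> set Ts"
  using assms
proof (induction Ts arbitrary: I)
  case (Cons T Ts)
  then have "T @ concat Ts = I @ D"
    by simp
  then consider E where "T = I @ E" | E where "I = T @ E" "concat Ts = E @ D"
    by (auto simp: append_eq_append_conv2)
  then show ?case
  proof cases
    case 1
    then have "length I \<le> S"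
      using Cons.prems(2) by auto
    then show ?thesis
      by (intro exI[of _ "[]"] exI[of _ I]) auto
  next
    case 2
    then obtain Us P where "E = concat Us @ P" "length P \<le> S" "set Us \<subseteq> set Ts"
      using Cons.IH[of E] Cons.prems(2) by auto
    then show ?thesis
      using 2 by (intro exI[of _ "T # Us"] exI[of _ P]) auto
  qed
qed simp

text \<open>Each end of a stretch cuts at most one block, so only two pieces of length at most
  \<open>S\<close> fail to be whole blocks.\<close>

lemma concat_infix_blocks:
  assumes "concat Ts = A @ I @ D" "\<forall>T\<in>set Ts. length T \<le> S"
  shows "\<exists>P Us P'. I = P @ concat Us @ P' \<and> length P \<le> S \<and> length P' \<le> S \<and> set Us \<subseteq> set Ts"
  using assms
proof (induction Ts arbitrary: A)
  case Nil
  then show ?case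
    by (intro exI[of _ "[]"]) auto
next
  case (Cons T Ts)
  show ?case
  proof (cases "\<exists>E. A = T @ E")
    case True
    then obtain E where E: "A = T @ E"
      by blast
    then obtain P Us P' where "I = P @ concat Us @ P'" "length P \<le> S" "length P' \<le> S" "set Us \<subseteq> set Ts"
      using Cons.IH[of E] Cons.prems by auto
    then show ?thesis
      by (intro exI[of _ P] exI[of _ Us] exI[of _ P']) auto
  next
    case False
    have "T @ concat Ts = A @ (I @ D)"
      using Cons.prems(1) by simp
    with False obtain E where E: "T = A @ E" "E @ concat Ts = I @ D"
      by (auto simp: append_eq_append_conv2)
    have lE: "length E \<le> S"
      using Cons.prems(2) E(1) by auto
    from E(2) consider F where "E = I @ F" | F where "I = E @ F" "concat Ts = F @ D"
      by (auto simp: append_eq_append_conv2)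
    then show ?thesis
    proof cases
      case 1
      then show ?thesis
        using lE by (intro exI[of _ I] exI[of _ "[]"]) auto
    next
      case 2
      then obtain Us P' where "F = concat Us @ P'" "length P' \<le> S" "set Us \<subseteq> set Ts"
        using concat_prefix_blocks[of Ts F D S] Cons.prems(2) by auto
      then show ?thesis
        using 2 lE by (intro exI[of _ E] exI[of _ Us] exI[of _ P']) auto
    qed
  qed
qed

section \<open>Cores of tiles: escape, jumps and gaps\<close>

context group begin

definition tile_core :: "'a list set \<Rightarrow> real \<Rightarrow> 'a list \<Rightarrow> 'a list \<Rightarrow> 'a \<Rightarrow> 'a list \<Rightarrow> bool" where
  "tile_core \<L> \<epsilon> T L c M \<longleftrightarrow> L \<in> \<L> \<and> c \<in> carrier G \<and> subseq M T \<and> subseq M (lrtrans L c) \<and>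
     (1 - \<epsilon>) * real (length L) \<le> real (length M) \<and> real (length T) \<le> (1 + \<epsilon>) * real (length L)"

lemma approx_tile_iff: "approx_tile \<L> \<epsilon> T \<longleftrightarrow> (\<exists>L c M. tile_core \<L> \<epsilon> T L c M)"
  by (auto simp: approx_tile_def tile_core_def)

text \<open>As \<open>\<epsilon> \<le> 1/4\<close>, the core has at least three quarters of the
  length of the shape, which turns errors measured by \<open>length L\<close> into errors measured
  by \<open>length T\<close>. A point leaves the core under \<open>g\<close> either by leaving the
  translated shape or by hitting one of the few points of the shape outside the core.\<close>

lemma tile_core_bounds:
  assumes core: "tile_core \<L> \<epsilon> T L c M" and T: "distinct T"
    and \<L>: "\<And>L. L \<in> \<L> \<Longrightarrow> distinct L \<and> almost_inv E \<epsilon> (set L) \<and> N \<le> length L"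
    and \<epsilon>: "0 < \<epsilon>" "\<epsilon> \<le> 1/4"
  shows "set M \<subseteq> set T" "set M \<subseteq> rtrans (set L) c"
    "real (card (set T - set M)) \<le> 4 * \<epsilon> * real (length T)"
    "real (card (rtrans (set L) c - set M)) \<le> 2 * \<epsilon> * real (length T)"
    "g \<in> E \<Longrightarrow> g \<in> carrier G \<Longrightarrow> real (card {x \<in> set M. g \<otimes> x \<notin> set M}) \<le> 4 * \<epsilon> * real (length T)"
    "real N \<le> 2 * real (length M)"
    "real (length T) \<le> 2 * real (length L)"
    "real N \<le> 2 * real (length T)"
proof -
  have c: "L \<in> \<L>" "c \<in> carrier G" "subseq M T" "subseq M (lrtrans L c)"
    "(1 - \<epsilon>) * real (length L) \<le> real (length M)" "real (length T) \<le> (1 + \<epsilon>) * real (length L)"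
    using core by (auto simp: tile_core_def)
  have L: "distinct L" "N \<le> length L" "set L \<subseteq> carrier G"
    "\<And>g. g \<in> E \<Longrightarrow> real (card (escape g (set L))) \<le> \<epsilon> * real (length L)"
    using \<L>[OF c(1)] by (auto simp: almost_inv_def distinct_card)
  have M: "distinct M"
    using distinct_subseq c(3) T by blast
  show MT: "set M \<subseteq> set T"
    using set_mono_subseq[OF c(3)] .
  show Msub: "set M \<subseteq> rtrans (set L) c"
    using set_mono_subseq[OF c(4)] by simp
  have MTlen: "length M \<le> length T"
    using c(3) list_emb_length by blast
  have cardL: "card (rtrans (set L) c) = length L"
    using card_rtrans[OF L(3) c(2)] L(1) by (simp add: distinct_card)
  have "3/4 * real (length L) \<le> (1 - \<epsilon>) * real (length L)"
    using \<epsilon> by (intro mult_right_mono) auto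
  then have LM: "3/4 * real (length L) \<le> real (length M)"
    using c(5) by linarith
  then have LT: "3/4 * real (length L) \<le> real (length T)"
    using MTlen by linarith
  have eLT: "\<epsilon> * real (length L) \<le> 4/3 * (\<epsilon> * real (length T))"
    using mult_left_mono[OF LT, of \<epsilon>] \<epsilon> by simp
  have pos: "0 \<le> \<epsilon> * real (length T)"
    using \<epsilon> by simp
  have "real (card (set T - set M)) = real (length T) - real (length M)"
    using MT MTlen T M by (simp add: card_Diff_subset distinct_card)
  also have "\<dots> \<le> 2 * (\<epsilon> * real (length L))"
    using c(5,6) by (simp add: algebra_simps)
  finally show "real (card (set T - set M)) \<le> 4 * \<epsilon> * real (length T)"
    using eLT pos by linarith
  have "card (rtrans (set L) c - set M) = length L - length M" "length M \<le> length L"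
    using card_Diff_subset[OF _ Msub] card_mono[OF _ Msub] M cardL by (auto simp: distinct_card)
  then have LcM: "real (card (rtrans (set L) c - set M)) \<le> \<epsilon> * real (length L)"
    using c(5) by (simp add: algebra_simps of_nat_diff)
  then show "real (card (rtrans (set L) c - set M)) \<le> 2 * \<epsilon> * real (length T)"
    using eLT pos by linarith
  show "real (card {x \<in> set M. g \<otimes> x \<notin> set M}) \<le> 4 * \<epsilon> * real (length T)" if g: "g \<in> E" "g \<in> carrier G"
  proof -
    let ?A = "rtrans (set L) c"
    have A: "?A \<subseteq> carrier G"
      using L(3) c(2) by auto
    have "{x \<in> set M. g \<otimes> x \<notin> set M} \<subseteq> escape g ?A \<union> {x \<in> ?A. g \<otimes> x \<in> ?A - set M}"
      using Msub by (auto simp: escape_def)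
    then have "card {x \<in> set M. g \<otimes> x \<notin> set M} \<le> card (escape g ?A \<union> {x \<in> ?A. g \<otimes> x \<in> ?A - set M})"
      by (intro card_mono) (auto simp: escape_def)
    also have "\<dots> \<le> card (escape g ?A) + card {x \<in> ?A. g \<otimes> x \<in> ?A - set M}"
      by (rule card_Un_le)
    also have "card (escape g ?A) = card (escape g (set L))"
      using escape_rtrans[OF L(3) c(2) g(2)] card_rtrans[OF order_trans[OF escape_subset L(3)] c(2)] by simp
    also have "card {x \<in> ?A. g \<otimes> x \<in> ?A - set M} = card ((\<lambda>x. g \<otimes> x) ` {x \<in> ?A. g \<otimes> x \<in> ?A - set M})"
      using A g by (intro card_image[symmetric] inj_on_ltrans) auto
    also have "\<dots> \<le> card (?A - set M)"
      by (intro card_mono) auto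
    finally have "real (card {x \<in> set M. g \<otimes> x \<notin> set M}) \<le> \<epsilon> * real (length L) + \<epsilon> * real (length L)"
      using L(4)[OF g(1)] LcM by linarith
    then show ?thesis
      using eLT pos by linarith
  qed
  show "real N \<le> 2 * real (length M)" "real N \<le> 2 * real (length T)"
    using LM LT L(2) by linarith+
  have "(1 + \<epsilon>) * real (length L) \<le> 2 * real (length L)"
    using \<epsilon> by (intro mult_right_mono) auto
  then show "real (length T) \<le> 2 * real (length L)"
    using c(6) by linarith
qed

lemma tile_escape:
  assumes core: "tile_core \<L> \<epsilon> T L c M" and T: "distinct T"
    and \<L>: "\<And>L. L \<in> \<L> \<Longrightarrow> distinct L \<and> almost_inv E \<epsilon> (set L) \<and> N \<le> length L"
    and \<epsilon>: "0 < \<epsilon>" "\<epsilon> \<le> 1/4" and g: "g \<in> E" "g \<in> carrier G"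
  shows "real (card (escape g (set T))) \<le> 8 * \<epsilon> * real (length T)"
proof -
  note b = tile_core_bounds[OF core T \<L> \<epsilon>]
  have "escape g (set T) \<subseteq> (set T - set M) \<union> {x \<in> set M. g \<otimes> x \<notin> set M}"
    using b(1) by (auto simp: escape_def)
  then have "card (escape g (set T)) \<le> card (set T - set M) + card {x \<in> set M. g \<otimes> x \<notin> set M}"
    by (intro order_trans[OF card_mono card_Un_le]) auto
  then show ?thesis
    using b(3) b(5)[OF _ g] by linarith
qed

text \<open>Two points of one core differ by a left factor in \<open>D\<close>. So the next element
  can be far only at the last point of a tile, at a point outside the core, or right before such a
  point. The last two kinds give \<open>4 * \<epsilon>\<close> each, and
  \<open>2 \<le> \<epsilon> * N\<close> turns the single last point into one more
  \<open>\<epsilon> * length T\<close>.\<close>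

lemma far_neighbours_card:
  assumes X: "distinct (concat Ts)" "set (concat Ts) \<subseteq> carrier G"
    and tiles: "\<And>T. T \<in> set Ts \<Longrightarrow> approx_tile \<L> \<epsilon> T"
    and \<L>: "\<And>L. L \<in> \<L> \<Longrightarrow> distinct L \<and> almost_inv E \<epsilon> (set L) \<and> N \<le> length L"
    and \<epsilon>: "0 < \<epsilon>" "\<epsilon> \<le> 1/4" "2 \<le> \<epsilon> * real N"
    and D: "D = (\<Union>L\<in>\<L>. \<Union>x\<in>set L. \<Union>y\<in>set L. {x \<otimes> inv y})"
  shows "real (card {x. \<exists>y A B. concat Ts = A @ x # y # B \<and> y \<notin> (\<lambda>d. d \<otimes> x) ` D}) \<le> 9 * \<epsilon> * real (length (concat Ts))"
proof (rule card_concat_le[OF X(1)])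
  let ?X = "concat Ts"
  let ?far = "{x. \<exists>y A B. ?X = A @ x # y # B \<and> y \<notin> (\<lambda>d. d \<otimes> x) ` D}"
  show "?far \<subseteq> set ?X"
  proof
    fix x assume "x \<in> ?far"
    then obtain y A B where "?X = A @ x # y # B"
      by blast
    then show "x \<in> set ?X"
      by (simp del: set_concat)
  qed
  fix T assume T: "T \<in> set Ts"
  obtain L c M where core: "tile_core \<L> \<epsilon> T L c M"
    using tiles[OF T] approx_tile_iff by blast
  obtain A0 B0 where X0: "?X = A0 @ T @ B0"
    using split_at_block[OF T] by blast
  have dT: "distinct T"
    using X(1) X0 by (metis distinct_append)
  note b = tile_core_bounds[OF core dT \<L> \<epsilon>(1,2)]
  have c: "c \<in> carrier G" "L \<in> \<L>"
    using core by (auto simp: tile_core_def)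
  have Lc: "set L \<subseteq> carrier G"
    using \<L>[OF c(2)] by (simp add: almost_inv_def)
  have "T \<noteq> []"
    using b(8) \<epsilon> by (auto dest!: order_trans[OF \<epsilon>(3)])
  define succ where "succ x = (THE y. \<exists>A B. ?X = A @ x # y # B)" for x
  have succ: "succ x = y" if "?X = A @ x # y # B" for x y A B
    unfolding succ_def
  proof (rule the_equality)
    fix z assume "\<exists>A B. ?X = A @ x # z # B"
    then obtain A' B' where "?X = A' @ x # z # B'"
      by blast
    then have "y # B = z # B'"
      using that X(1) distinct_split_unique(2)[of A x "y # B" A' "z # B'"] by simp
    then show "z = y"
      by simp
  qed (use that in blast)
  let ?I = "{x \<in> set (butlast T). succ x \<in> set T - set M}"
  \<comment> \<open>Injectivity of the successor bounds the points followed by a point outside the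
    core by the number of points outside the core.\<close>
  have inj: "inj_on succ ?I"
  proof (rule inj_onI)
    fix x x' assume x: "x \<in> ?I" "x' \<in> ?I" "succ x = succ x'"
    have ex: "\<exists>y A B. ?X = A @ x # y # B" if "x \<in> set (butlast T)" for x
    proof -
      obtain P y Q where "T = P @ x # y # Q"
        using in_butlastE \<open>x \<in> set (butlast T)\<close> by metis
      then have "?X = (A0 @ P) @ x # y # (Q @ B0)"
        using X0 by simp
      then show ?thesis
        by blast
    qed
    obtain y A B where 1: "?X = A @ x # y # B"
      using ex x by blast
    obtain y' A' B' where 2: "?X = A' @ x' # y' # B'"
      using ex x by blast
    have "y' = y"
      using succ[OF 1] succ[OF 2] x(3) by simp
    then have "A @ [x] = A' @ [x']"
      using 1 2 X(1) distinct_split_unique(1)[of "A @ [x]" y B "A' @ [x']" B'] by simp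
    then show "x = x'"
      by simp
  qed
  have sub: "?far \<inter> set T \<subseteq> {last T} \<union> (set T - set M) \<union> ?I"
  proof
    fix x assume x: "x \<in> ?far \<inter> set T"
    then obtain y A B where y: "?X = A @ x # y # B" "y \<notin> (\<lambda>d. d \<otimes> x) ` D"
      by blast
    show "x \<in> {last T} \<union> (set T - set M) \<union> ?I"
    proof (cases "x = last T \<or> x \<notin> set M")
      case False
      then have xb: "x \<in> set (butlast T)"
      proof -
        have "set T = set (butlast T) \<union> {last T}"
          using arg_cong[OF append_butlast_last_id[OF \<open>T \<noteq> []\<close>], of set] by auto
        then show ?thesis
          using x False by blast
      qed
      then obtain P z Z where TPQ: "T = P @ x # z # Z"
        using in_butlastE by metis
      then have "?X = (A0 @ P) @ x # z # (Z @ B0)"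
        using X0 TPQ by simp
      then have "z = y"
        using succ y(1) by metis
      then have yT: "y \<in> set T"
        using TPQ by auto
      have "y \<notin> set M"
      proof
        assume "y \<in> set M"
        then obtain u v where uv: "u \<in> set L" "v \<in> set L" "y = u \<otimes> c" "x = v \<otimes> c"
          using False b(2) by blast
        then have uvc: "u \<in> carrier G" "v \<in> carrier G"
          using Lc by auto
        have "inv v \<otimes> (v \<otimes> c) = c"
          using uvc c(1) by (simp add: m_assoc[symmetric])
        then have "y = (u \<otimes> inv v) \<otimes> x"
          using uvc uv(3,4) c(1) by (simp add: m_assoc)
        moreover have "u \<otimes> inv v \<in> D"
          unfolding D using uv(1,2) c(2) by auto
        ultimately show False
          using y(2) by blast
      qed
      then show ?thesis
        using xb yT succ[OF y(1)] by auto
    qed (use x in auto)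
  qed
  have "card ?I = card (succ ` ?I)"
    using card_image[OF inj] by simp
  also have "\<dots> \<le> card (set T - set M)"
    by (intro card_mono) auto
  finally have cI: "card ?I \<le> card (set T - set M)" .
  have "card (?far \<inter> set T) \<le> card ({last T} \<union> (set T - set M) \<union> ?I)"
    by (intro card_mono sub) auto
  also have "\<dots> \<le> card {last T} + card (set T - set M) + card ?I"
    by (intro order_trans[OF card_Un_le] add_right_mono card_Un_le)
  finally have "real (card (?far \<inter> set T)) \<le> 1 + 2 * real (card (set T - set M))"
    using cI by simp
  moreover have "\<epsilon> * real N \<le> \<epsilon> * (2 * real (length T))"
    using b(8) \<epsilon>(1) by (intro mult_left_mono) auto
  then have "1 \<le> \<epsilon> * real (length T)"
    using \<epsilon>(3) by linarith
  ultimately show "real (card (?far \<inter> set T)) \<le> 9 * \<epsilon> * real (length T)"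
    using b(3) by linarith
qed

text \<open>If \<open>x\<close> and \<open>g \<otimes> x\<close> lie in one tile, all that lies
  between them is in this tile too, hence at most \<open>S\<close> points. The remaining
  \<open>x\<close> escape from their tile.\<close>

lemma separated_card:
  assumes X: "distinct (concat Ts)" "set (concat Ts) \<subseteq> carrier G"
    and tiles: "\<And>T. T \<in> set Ts \<Longrightarrow> approx_tile \<L> \<epsilon> T \<and> length T \<le> S"
    and \<L>: "\<And>L. L \<in> \<L> \<Longrightarrow> distinct L \<and> almost_inv E \<epsilon> (set L) \<and> N \<le> length L"
    and \<epsilon>: "0 < \<epsilon>" "\<epsilon> \<le> 1/4" and g: "g \<in> E" "g \<in> carrier G"
  shows "real (card {x \<in> set (concat Ts). S < card {z. subseq [x, z] (concat Ts) \<and> subseq [z, g \<otimes> x] (concat Ts)}})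
    \<le> 8 * \<epsilon> * real (length (concat Ts))"
proof (rule card_concat_le[OF X(1)])
  let ?bad = "{x \<in> set (concat Ts). S < card {z. subseq [x, z] (concat Ts) \<and> subseq [z, g \<otimes> x] (concat Ts)}}"
  fix T assume T: "T \<in> set Ts"
  obtain L c M where core: "tile_core \<L> \<epsilon> T L c M"
    using tiles[OF T] approx_tile_iff by blast
  obtain A0 B0 where X0: "concat Ts = A0 @ T @ B0"
    using split_at_block[OF T] by blast
  have dT: "distinct T"
    using X(1) X0 by (metis distinct_append)
  have "?bad \<inter> set T \<subseteq> escape g (set T)"
  proof
    fix x assume x: "x \<in> ?bad \<inter> set T"
    have "g \<otimes> x \<notin> set T"
    proof
      assume "g \<otimes> x \<in> set T"
      then have "{z. subseq [x, z] (concat Ts) \<and> subseq [z, g \<otimes> x] (concat Ts)} \<subseteq> set T"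
        using between_subset_block[OF X0 X(1)] x by blast
      then have "card {z. subseq [x, z] (concat Ts) \<and> subseq [z, g \<otimes> x] (concat Ts)} \<le> length T"
        using card_mono[OF finite_set] card_length order_trans by blast
      then show False
        using x tiles[OF T] by auto
    qed
    then show "x \<in> escape g (set T)"
      using x by (simp add: escape_def)
  qed
  then have "card (?bad \<inter> set T) \<le> card (escape g (set T))"
    by (intro card_mono) (auto simp: escape_def)
  then show "real (card (?bad \<inter> set T)) \<le> 8 * \<epsilon> * real (length T)"
    using tile_escape[OF core dT \<L> \<epsilon> g] by linarith
qed auto

text \<open>A stretch consists of whole tiles and two pieces cut off at its ends. A point of a whole
  tile that escapes from the stretch escapes from the tile, and \<open>2 * S\<close> pays for the
  cut pieces. As \<open>S\<close> belongs to the level, the bound is the same for all stretches of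
  all lists; this is the finite form of the uniform Folner property.\<close>

lemma infix_escape:
  assumes X: "concat Ts = A @ I @ B" "distinct (concat Ts)" "set (concat Ts) \<subseteq> carrier G"
    and tiles: "\<And>T. T \<in> set Ts \<Longrightarrow> approx_tile \<L> \<epsilon> T \<and> length T \<le> S"
    and \<L>: "\<And>L. L \<in> \<L> \<Longrightarrow> distinct L \<and> almost_inv E \<epsilon> (set L) \<and> N \<le> length L"
    and \<epsilon>: "0 < \<epsilon>" "\<epsilon> \<le> 1/4" and g: "g \<in> E" "g \<in> carrier G"
  shows "real (card (escape g (set I))) \<le> 8 * \<epsilon> * real (length I) + 2 * real S"
proof -
  obtain P Us P' where I: "I = P @ concat Us @ P'" "length P \<le> S" "length P' \<le> S" "set Us \<subseteq> set Ts"
    using concat_infix_blocks[OF X(1)] tiles by blast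
  have dI: "distinct I"
    using X(1,2) by simp
  have dU: "distinct (concat Us)"
    using dI I(1) by simp
  have "real (card (escape g (set I) \<inter> set (concat Us))) \<le> 8 * \<epsilon> * real (length (concat Us))"
  proof (rule card_concat_le[OF dU])
    fix T assume T: "T \<in> set Us"
    obtain L c M where core: "tile_core \<L> \<epsilon> T L c M"
      using tiles T I(4) approx_tile_iff by blast
    obtain A0 B0 where U0: "concat Us = A0 @ T @ B0"
      using split_at_block[OF T] by blast
    have dT: "distinct T"
      using dU U0 by (metis distinct_append)
    have "set T \<subseteq> set I"
      using U0 I(1) by auto
    then have "escape g (set I) \<inter> set (concat Us) \<inter> set T \<subseteq> escape g (set T)"
      by (auto simp: escape_def)
    then have "card (escape g (set I) \<inter> set (concat Us) \<inter> set T) \<le> card (escape g (set T))"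
      by (intro card_mono) (auto simp: escape_def)
    then show "real (card (escape g (set I) \<inter> set (concat Us) \<inter> set T)) \<le> 8 * \<epsilon> * real (length T)"
      using tile_escape[OF core dT \<L> \<epsilon> g] by linarith
  qed auto
  also have "\<dots> \<le> 8 * \<epsilon> * real (length I)"
    using I(1) \<epsilon> by (intro mult_left_mono) auto
  finally have 1: "real (card (escape g (set I) \<inter> set (concat Us))) \<le> 8 * \<epsilon> * real (length I)" .
  have "escape g (set I) \<subseteq> (escape g (set I) \<inter> set (concat Us)) \<union> (set P \<union> set P')"
    using I(1) by (auto simp: escape_def)
  then have "card (escape g (set I)) \<le> card (escape g (set I) \<inter> set (concat Us)) + card (set P \<union> set P')"
    by (intro order_trans[OF card_mono card_Un_le]) auto
  moreover have "card (set P \<union> set P') \<le> 2 * S"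
    using card_Un_le[of "set P" "set P'"] card_length[of P] card_length[of P'] I(2,3) by linarith
  ultimately show ?thesis
    using 1 by linarith
qed

end

text \<open>A Chernoff bound. With \<open>t = 1 / (m * N)\<close> a set \<open>S\<close> is given
  the weight \<open>t ^ card S\<close>. All subsets of \<open>A\<close> together weigh
  \<open>(1 + t) ^ card A\<close>, at most \<open>exp (2 * w / N)\<close>, while each set counted
  here weighs at least \<open>t\<close> to the power \<open>4 * w / N\<close>.\<close>

lemma card_small_subsets_le:
  assumes A: "finite A" "real (card A) \<le> 2 * real m * w" and m: "0 < m" and N: "0 < N" and w: "0 \<le> w"
  shows "real (card {S. S \<subseteq> A \<and> real N * real (card S) \<le> 4 * w}) \<le>
    exp ((2 + 4 * ln (real m * real N)) / real N * w)"
proof -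
  let ?F = "{S. S \<subseteq> A \<and> real N * real (card S) \<le> 4 * w}"
  define t where "t = 1 / (real m * real N)"
  have mN: "1 \<le> real m * real N"
    using mult_mono[of 1 "real m" 1 "real N"] m N by simp
  then have t: "0 < t" "t \<le> 1"
    by (auto simp: t_def)
  have lnt: "ln t = - ln (real m * real N)"
    using mN m N by (simp add: t_def ln_div)
  have finF: "finite ?F"
    using A(1) by simp
  have "exp (ln t * (4 * w / real N)) \<le> t ^ card S" if S: "S \<in> ?F" for S
  proof -
    have "real (card S) \<le> 4 * w / real N"
      using S N by (simp add: field_simps)
    then have "ln t * (4 * w / real N) \<le> ln t * real (card S)"
      using t by (intro mult_left_mono_neg) (auto simp: ln_le_zero_iff)
    then have "exp (ln t * (4 * w / real N)) \<le> exp (real (card S) * ln t)"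
      by (simp add: mult.commute)
    also have "\<dots> = t ^ card S"
      using t by (simp add: exp_of_nat_mult)
    finally show ?thesis .
  qed
  then have "(\<Sum>S\<in>?F. exp (ln t * (4 * w / real N))) \<le> (\<Sum>S\<in>?F. t ^ card S)"
    by (intro sum_mono)
  also have "\<dots> \<le> (\<Sum>S\<in>Pow A. t ^ card S)"
    using A(1) t by (intro sum_mono2) auto
  also have "\<dots> = (\<Prod>x\<in>A. t + 1)"
    by (subst prod_add[OF A(1)]) simp
  also have "\<dots> \<le> exp t ^ card A"
    using t exp_ge_add_one_self[of t] by (simp add: add.commute power_mono)
  also have "\<dots> = exp (t * real (card A))"
    using exp_of_nat_mult[of "card A" t] by (simp add: mult.commute)
  also have "\<dots> \<le> exp (2 * w / real N)"
  proof -
    have "t * real (card A) \<le> t * (2 * real m * w)"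
      using A(2) t by (intro mult_left_mono) auto
    also have "\<dots> = 2 * w / real N"
      using m N by (simp add: t_def)
    finally show ?thesis
      by simp
  qed
  finally have "real (card ?F) \<le> exp (2 * w / real N) / exp (ln t * (4 * w / real N))"
    by (simp add: field_simps)
  also have "\<dots> = exp ((2 + 4 * ln (real m * real N)) / real N * w)"
  proof -
    have "2 * w / r - (- z) * (4 * w / r) = (2 + 4 * z) / r * w" if "r \<noteq> 0" for r z :: real
      using that by (simp add: field_simps)
    then show ?thesis
      unfolding exp_diff[symmetric] lnt using N by simp
  qed
  finally show ?thesis .
qed

lemma distinct_of_distinct_concat:
  "distinct (concat Ts) \<Longrightarrow> [] \<notin> set Ts \<Longrightarrow> distinct Ts"
  by (simp add: distinct_concat_iff)

lemma distinct_concat_disjoint: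
  "distinct (concat Ts) \<Longrightarrow> T \<in> set Ts \<Longrightarrow> T' \<in> set Ts \<Longrightarrow> T \<noteq> T' \<Longrightarrow> set T \<inter> set T' = {}"
  by (simp add: distinct_concat_iff)

section \<open>Coding a window by the tiles that meet it\<close>

context group begin

definition order_pattern :: "'a rel \<Rightarrow> 'a list \<Rightarrow> 'a \<Rightarrow> 'a rel" where
  "order_pattern D X x = {(a, b) \<in> D. subseq [a \<otimes> x, b \<otimes> x] X}"

text \<open>The choice is meaningful for a point covered by exactly one coded shape. Elsewhere the
  value is arbitrary, and such points are counted among the errors.\<close>

definition decode_pattern :: "'a rel \<Rightarrow> ('a rel \<Rightarrow> 'l) \<Rightarrow> ('a list \<times> 'a) set \<Rightarrow> 'a \<Rightarrow> 'l" where
  "decode_pattern D \<phi> S h =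
     (let p = SOME p. p \<in> S \<and> h \<in> rtrans (set (fst p)) (snd p) in \<phi> (order_pattern D (fst p) (h \<otimes> inv (snd p))))"

text \<open>The code \<open>S\<close> records the shapes that meet the window and their positions relative to \<open>g\<close>. A point is
  in \<open>\<Gamma>\<close> if its neighbourhood lies in the core of a single tile and no other shape covers it, so that
  \<open>S\<close> determines the tile and the order around the point.\<close>

lemma tile_code:
  fixes \<phi> :: "'a rel \<Rightarrow> 'l"
  assumes \<L>: "finite \<L>" "\<And>L. L \<in> \<L> \<Longrightarrow> distinct L \<and> almost_inv E \<epsilon> (set L) \<and> N \<le> length L"
    and N: "0 < N" and \<epsilon>: "0 < \<epsilon>" "\<epsilon> \<le> 1/4"
    and W: "finite W" "W \<subseteq> carrier G"
    and V: "V = (\<Union>L\<in>\<L>. \<Union>x\<in>set L. \<Union>y\<in>set L. \<Union>w\<in>W. {(x \<otimes> inv y) \<otimes> w})" "card V \<le> 2 * card W"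
    and U: "U = (\<Union>L\<in>\<L>. \<Union>x\<in>set L. \<Union>w\<in>W. {inv x \<otimes> w})"
    and D: "D \<subseteq> D' \<times> D'" "D' \<subseteq> E" "D' \<subseteq> carrier G" "finite D'"
    and Ts: "distinct (concat Ts)" "set (concat Ts) \<subseteq> carrier G" "\<And>T. T \<in> set Ts \<Longrightarrow> approx_tile \<L> \<epsilon> T"
  obtains \<Gamma> where
    "real (card (set (concat Ts) - \<Gamma>)) \<le> (6 + 4 * real (card D')) * \<epsilon> * real (length (concat Ts))"
    "\<And>g. g \<in> carrier G \<Longrightarrow> \<exists>S. S \<subseteq> \<L> \<times> U \<and> real N * real (card S) \<le> 4 * real (card W) \<and>
       (\<forall>h\<in>W. h \<otimes> g \<in> \<Gamma> \<longrightarrow> \<phi> (order_pattern D (concat Ts) (h \<otimes> g)) = decode_pattern D \<phi> S h)"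
proof -
  let ?X = "concat Ts"
  have "\<forall>T\<in>set Ts. \<exists>L c M. tile_core \<L> \<epsilon> T L c M"
    using Ts(3) approx_tile_iff by blast
  then obtain Lf cf Mf where core: "\<And>T. T \<in> set Ts \<Longrightarrow> tile_core \<L> \<epsilon> T (Lf T) (cf T) (Mf T)"
    by metis
  have dT: "distinct T" if "T \<in> set Ts" for T
    using Ts(1) that by (simp add: distinct_concat_iff)
  have b: "set (Mf T) \<subseteq> set T" "set (Mf T) \<subseteq> rtrans (set (Lf T)) (cf T)"
    "real (card (set T - set (Mf T))) \<le> 4 * \<epsilon> * real (length T)"
    "real (card (rtrans (set (Lf T)) (cf T) - set (Mf T))) \<le> 2 * \<epsilon> * real (length T)"
    "\<And>g. g \<in> E \<Longrightarrow> g \<in> carrier G \<Longrightarrow> real (card {x \<in> set (Mf T). g \<otimes> x \<notin> set (Mf T)}) \<le> 4 * \<epsilon> * real (length T)"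
    "real N \<le> 2 * real (length (Mf T))" "real N \<le> 2 * real (length T)"
    "Lf T \<in> \<L>" "cf T \<in> carrier G" "set (Lf T) \<subseteq> carrier G" "subseq (Mf T) T" "subseq (Mf T) (lrtrans (Lf T) (cf T))"
    "distinct (Lf T)" "distinct (Mf T)"
    if T: "T \<in> set Ts" for T
    using tile_core_bounds[OF core[OF T] dT[OF T] \<L>(2) \<epsilon>] core[OF T] \<L>(2)[of "Lf T"]
      distinct_subseq[of "Mf T" T] dT[OF T]
    by (auto simp: tile_core_def almost_inv_def)
  have "[] \<notin> set Ts"
    using b(7) N by fastforce
  then have dTs: "distinct Ts"
    using distinct_of_distinct_concat[OF Ts(1)] by blast
  define \<Gamma> where "\<Gamma> = {x \<in> set ?X. \<exists>T\<in>set Ts. x \<in> set (Mf T) \<and> (\<forall>d\<in>D'. d \<otimes> x \<in> set (Mf T)) \<and>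
    (\<forall>T'\<in>set Ts. x \<in> rtrans (set (Lf T')) (cf T') \<longrightarrow> T' = T)}"
  \<comment> \<open>Failure has two sources: the surroundings of the point are not in the core of
    its own tile (\<open>A1\<close>), or the shape of another tile covers the point as well. Tiles
    are disjoint, so in the second case the point is outside the core of that other tile
    (\<open>A2\<close>).\<close>
  define A1 where "A1 = {x \<in> set ?X. \<exists>T\<in>set Ts. x \<in> set T \<and> \<not> (x \<in> set (Mf T) \<and> (\<forall>d\<in>D'. d \<otimes> x \<in> set (Mf T)))}"
  define A2 where "A2 = (\<Union>T\<in>set Ts. rtrans (set (Lf T)) (cf T) - set (Mf T))"
  have sub: "set ?X - \<Gamma> \<subseteq> A1 \<union> A2"
  proof
    fix x assume x: "x \<in> set ?X - \<Gamma>"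
    then obtain T where T: "T \<in> set Ts" "x \<in> set T"
      by auto
    show "x \<in> A1 \<union> A2"
    proof (cases "x \<in> set (Mf T) \<and> (\<forall>d\<in>D'. d \<otimes> x \<in> set (Mf T))")
      case True
      then obtain T' where T': "T' \<in> set Ts" "x \<in> rtrans (set (Lf T')) (cf T')" "T' \<noteq> T"
        using x T unfolding \<Gamma>_def by blast
      then have "x \<notin> set (Mf T')"
        using b(1)[OF T'(1)] distinct_concat_disjoint[OF Ts(1) T(1) T'(1)] T(2) by blast
      then show ?thesis
        using T' by (auto simp: A2_def)
    next
      case False
      then show ?thesis
        using x T unfolding A1_def by blast
    qed
  qed
  have "real (card A1) \<le> ((4 + 4 * real (card D')) * \<epsilon>) * real (length ?X)"
  proof (rule card_concat_le[OF Ts(1)])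
    fix T assume T: "T \<in> set Ts"
    have "A1 \<inter> set T \<subseteq> (set T - set (Mf T)) \<union> (\<Union>d\<in>D'. {x \<in> set (Mf T). d \<otimes> x \<notin> set (Mf T)})"
    proof
      fix x assume x: "x \<in> A1 \<inter> set T"
      then obtain T' where T': "T' \<in> set Ts" "x \<in> set T'" "\<not> (x \<in> set (Mf T') \<and> (\<forall>d\<in>D'. d \<otimes> x \<in> set (Mf T')))"
        by (auto simp: A1_def)
      then have "T' = T"
        using distinct_concat_disjoint[OF Ts(1) T T'(1)] x by blast
      then show "x \<in> (set T - set (Mf T)) \<union> (\<Union>d\<in>D'. {x \<in> set (Mf T). d \<otimes> x \<notin> set (Mf T)})"
        using x T' by blast
    qed
    then have "card (A1 \<inter> set T) \<le> card ((set T - set (Mf T)) \<union> (\<Union>d\<in>D'. {x \<in> set (Mf T). d \<otimes> x \<notin> set (Mf T)}))"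
      using D(4) by (intro card_mono) auto
    also have "\<dots> \<le> card (set T - set (Mf T)) + (\<Sum>d\<in>D'. card {x \<in> set (Mf T). d \<otimes> x \<notin> set (Mf T)})"
      by (intro order_trans[OF card_Un_le] add_left_mono card_UN_le D(4))
    finally have "real (card (A1 \<inter> set T)) \<le> real (card (set T - set (Mf T))) + (\<Sum>d\<in>D'. real (card {x \<in> set (Mf T). d \<otimes> x \<notin> set (Mf T)}))"
      by (simp only: of_nat_add[symmetric] of_nat_sum[symmetric] of_nat_le_iff)
    also have "\<dots> \<le> 4 * \<epsilon> * real (length T) + (\<Sum>d\<in>D'. 4 * \<epsilon> * real (length T))"
      using b(3,5)[OF T] D by (intro add_mono sum_mono) auto
    also have "\<dots> = ((4 + 4 * real (card D')) * \<epsilon>) * real (length T)"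
      by (simp add: algebra_simps)
    finally show "real (card (A1 \<inter> set T)) \<le> ((4 + 4 * real (card D')) * \<epsilon>) * real (length T)" .
  qed (auto simp: A1_def)
  moreover have "real (card A2) \<le> 2 * \<epsilon> * real (length ?X)"
  proof -
    have "real (card A2) \<le> (\<Sum>T\<in>set Ts. real (card (rtrans (set (Lf T)) (cf T) - set (Mf T))))"
      unfolding A2_def of_nat_sum[symmetric] of_nat_le_iff by (intro card_UN_le) auto
    also have "\<dots> \<le> 2 * \<epsilon> * real (length ?X)"
      by (rule sum_concat_le[OF dTs]) (rule b(4))
    finally show ?thesis .
  qed
  moreover have "card (set ?X - \<Gamma>) \<le> card A1 + card A2"
    by (rule order_trans[OF card_mono[OF _ sub] card_Un_le]) (auto simp: A1_def A2_def)
  ultimately have "real (card (set ?X - \<Gamma>)) \<le> (6 + 4 * real (card D')) * \<epsilon> * real (length ?X)"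
    by (simp add: algebra_simps)
  moreover have "\<exists>S. S \<subseteq> \<L> \<times> U \<and> real N * real (card S) \<le> 4 * real (card W) \<and>
       (\<forall>h\<in>W. h \<otimes> g \<in> \<Gamma> \<longrightarrow> \<phi> (order_pattern D ?X (h \<otimes> g)) = decode_pattern D \<phi> S h)"
    if g: "g \<in> carrier G" for g
  proof -
    \<comment> \<open>Tiles are selected by their translated shapes and not by their actual points,
      since the decoder sees only shapes and positions.\<close>
    define \<T> where "\<T> = {T \<in> set Ts. \<exists>h\<in>W. h \<otimes> g \<in> rtrans (set (Lf T)) (cf T)}"
    define S where "S = (\<lambda>T. (Lf T, cf T \<otimes> inv g)) ` \<T>"
    have fin\<T>: "finite \<T>"
      by (simp add: \<T>_def)
    have \<T>D: "\<exists>l\<in>set (Lf T). \<exists>h\<in>W. cf T = inv l \<otimes> (h \<otimes> g) \<and> l \<in> carrier G \<and> h \<in> carrier G"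
      if T: "T \<in> \<T>" for T
    proof -
      obtain h l where hl: "h \<in> W" "l \<in> set (Lf T)" "h \<otimes> g = l \<otimes> cf T" "T \<in> set Ts"
        using T by (auto simp: \<T>_def)
      have car: "h \<in> carrier G" "l \<in> carrier G" "cf T \<in> carrier G"
        using hl b(9,10)[OF hl(4)] W by auto
      have "inv l \<otimes> (l \<otimes> cf T) = cf T"
        using car by (simp add: m_assoc[symmetric])
      then show ?thesis
        using hl car by metis
    qed
    have "S \<subseteq> \<L> \<times> U"
    proof -
      have "(Lf T, cf T \<otimes> inv g) \<in> \<L> \<times> U" if T: "T \<in> \<T>" for T
      proof -
        obtain l h where lh: "l \<in> set (Lf T)" "h \<in> W" "cf T = inv l \<otimes> (h \<otimes> g)" "l \<in> carrier G" "h \<in> carrier G"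
          using \<T>D[OF T] by blast
        then have "cf T \<otimes> inv g = inv l \<otimes> h"
          using g by (simp add: m_assoc)
        moreover have "Lf T \<in> \<L>"
          using b(8) T by (simp add: \<T>_def)
        ultimately show ?thesis
          using lh(1,2) unfolding U by auto
      qed
      then show ?thesis
        by (auto simp: S_def)
    qed
    \<comment> \<open>The cores of the selected tiles are disjoint subsets of a translate of
      \<open>V\<close>, and each has at least \<open>N / 2\<close> points. With
      \<open>card V \<le> 2 * card W\<close> this gives the factor 4.\<close>
    moreover have "real N * real (card S) \<le> 4 * real (card W)"
    proof -
      have VW: "V \<subseteq> carrier G"
        unfolding V(1) using W \<L>(2) by (fastforce simp: almost_inv_def)
      have finV: "finite V"
        unfolding V(1) using W \<L>(1) by auto
      have MV: "set (Mf T) \<subseteq> rtrans V g" if T: "T \<in> \<T>" for T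
      proof
        fix x assume x: "x \<in> set (Mf T)"
        have TT: "T \<in> set Ts"
          using T by (simp add: \<T>_def)
        obtain l h where lh: "l \<in> set (Lf T)" "h \<in> W" "cf T = inv l \<otimes> (h \<otimes> g)" "l \<in> carrier G" "h \<in> carrier G"
          using \<T>D[OF T] by blast
        obtain y where y: "y \<in> set (Lf T)" "x = y \<otimes> cf T"
          using b(2)[OF TT] x by blast
        have "y \<in> carrier G"
          using y b(10)[OF TT] by blast
        then have "x = ((y \<otimes> inv l) \<otimes> h) \<otimes> g"
          using y(2) lh g by (simp add: m_assoc)
        moreover have "(y \<otimes> inv l) \<otimes> h \<in> V"
          unfolding V(1) using b(8)[OF TT] y(1) lh(1,2) by blast
        ultimately show "x \<in> rtrans V g"
          by blast
      qed
      have "real N * real (card \<T>) = (\<Sum>T\<in>\<T>. real N)"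
        by simp
      also have "\<dots> \<le> (\<Sum>T\<in>\<T>. 2 * real (card (set (Mf T))))"
        using b(6,14) by (intro sum_mono) (auto simp: \<T>_def distinct_card)
      also have "\<dots> = 2 * real (\<Sum>T\<in>\<T>. card (set (Mf T)))"
        by (simp add: sum_distrib_left)
      also have "(\<Sum>T\<in>\<T>. card (set (Mf T))) = card (\<Union>T\<in>\<T>. set (Mf T))"
      proof (rule card_UN_disjoint[symmetric, OF fin\<T>])
        show "\<forall>i\<in>\<T>. \<forall>j\<in>\<T>. i \<noteq> j \<longrightarrow> set (Mf i) \<inter> set (Mf j) = {}"
        proof (intro ballI impI)
          fix i j assume ij: "i \<in> \<T>" "j \<in> \<T>" "i \<noteq> j"
          then have "i \<in> set Ts" "j \<in> set Ts"
            by (auto simp: \<T>_def)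
          then show "set (Mf i) \<inter> set (Mf j) = {}"
            using b(1)[of i] b(1)[of j] distinct_concat_disjoint[OF Ts(1) _ _ ij(3)] by blast
        qed
      qed auto
      also have "card (\<Union>T\<in>\<T>. set (Mf T)) \<le> card (rtrans V g)"
        using MV finV by (intro card_mono) auto
      also have "\<dots> = card V"
        using card_rtrans[OF VW g] .
      finally have "real N * real (card \<T>) \<le> 4 * real (card W)"
        using V(2) by linarith
      moreover have "card S \<le> card \<T>"
        unfolding S_def by (rule card_image_le[OF fin\<T>])
      then have "real N * real (card S) \<le> real N * real (card \<T>)"
        by (intro mult_left_mono) auto
      ultimately show ?thesis
        by linarith
    qed
    moreover have "\<phi> (order_pattern D ?X (h \<otimes> g)) = decode_pattern D \<phi> S h" if h: "h \<in> W" "h \<otimes> g \<in> \<Gamma>" for h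
    proof -
      define x where "x = h \<otimes> g"
      have hc: "h \<in> carrier G" and xc: "x \<in> carrier G"
        using h W g by (auto simp: x_def)
      obtain T where T: "T \<in> set Ts" "x \<in> set (Mf T)" "\<And>d. d \<in> D' \<Longrightarrow> d \<otimes> x \<in> set (Mf T)"
        "\<And>T'. T' \<in> set Ts \<Longrightarrow> x \<in> rtrans (set (Lf T')) (cf T') \<Longrightarrow> T' = T"
        using h(2) unfolding \<Gamma>_def x_def by blast
      let ?p = "(Lf T, cf T \<otimes> inv g)"
      have xT: "x \<in> rtrans (set (Lf T)) (cf T)"
        using b(2)[OF T(1)] T(2) by blast
      have mem: "h \<in> rtrans (set (Lf T')) (cf T' \<otimes> inv g) \<longleftrightarrow> x \<in> rtrans (set (Lf T')) (cf T')" if T': "T' \<in> set Ts" for T'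
      proof -
        have "h = l \<otimes> (cf T' \<otimes> inv g) \<longleftrightarrow> x = l \<otimes> cf T'" if l: "l \<in> set (Lf T')" for l
        proof -
          have lc: "l \<in> carrier G" "cf T' \<in> carrier G"
            using l b(9,10)[OF T'] by auto
          have "h = (l \<otimes> cf T') \<otimes> inv g \<longleftrightarrow> h \<otimes> g = l \<otimes> cf T'"
            using inv_solve_right[of h "l \<otimes> cf T'" g] lc hc g by auto
          then show ?thesis
            using lc g by (simp add: x_def m_assoc)
        qed
        then show ?thesis
          by blast
      qed
      have "(SOME p. p \<in> S \<and> h \<in> rtrans (set (fst p)) (snd p)) = ?p"
      proof (rule some_equality)
        show "?p \<in> S \<and> h \<in> rtrans (set (fst ?p)) (snd ?p)"
          using mem[OF T(1)] xT T(1) h(1) by (auto simp: S_def \<T>_def x_def)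
        fix p assume p: "p \<in> S \<and> h \<in> rtrans (set (fst p)) (snd p)"
        then obtain T' where T': "T' \<in> set Ts" "p = (Lf T', cf T' \<otimes> inv g)"
          by (auto simp: S_def \<T>_def)
        then have "T' = T"
          using p mem[OF T'(1)] T(4)[OF T'(1)] by auto
        then show "p = ?p"
          using T' by simp
      qed
      then have dec: "decode_pattern D \<phi> S h = \<phi> (order_pattern D (Lf T) (h \<otimes> inv (cf T \<otimes> inv g)))"
        by (simp add: decode_pattern_def)
      let ?y = "x \<otimes> inv (cf T)"
      note cT = b(9)[OF T(1)]
      have "h \<otimes> inv (cf T \<otimes> inv g) = ?y"
        using hc g cT by (simp add: x_def inv_mult_group m_assoc)
      moreover have "order_pattern D ?X x = order_pattern D (Lf T) ?y"
      proof -
        have "subseq [a' \<otimes> x, b' \<otimes> x] ?X \<longleftrightarrow> subseq [a' \<otimes> ?y, b' \<otimes> ?y] (Lf T)" if ab: "(a', b') \<in> D" for a' b'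
        proof -
          have ab': "a' \<in> D'" "b' \<in> D'" "a' \<in> carrier G" "b' \<in> carrier G"
            using ab D by auto
          obtain A0 B0 where X0: "?X = A0 @ T @ B0"
            using split_at_block[OF T(1)] by blast
          have "subseq T ?X"
            using X0 by (metis subseq_drop_many subseq_rev_drop_many subseq_order.order_refl)
          then have sX: "subseq (Mf T) ?X"
            using b(11)[OF T(1)] subseq_order.trans by blast
          have yc: "?y \<in> carrier G"
            using xc cT by simp
          have eq: "a' \<otimes> x = (a' \<otimes> ?y) \<otimes> cf T" "b' \<otimes> x = (b' \<otimes> ?y) \<otimes> cf T"
            using ab' xc cT by (simp_all add: m_assoc)
          have dL: "distinct (lrtrans (Lf T) (cf T))"
            using b(13)[OF T(1)] inj_on_rtrans[OF b(10)[OF T(1)] cT] by (simp add: distinct_map)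
          \<comment> \<open>The core is a subsequence both of the whole list and of the translated
            shape and contains both points; so it carries their order from one to the other, and a
            translation then reaches the shape itself.\<close>
          have "subseq [a' \<otimes> x, b' \<otimes> x] ?X \<longleftrightarrow> subseq [a' \<otimes> x, b' \<otimes> x] (Mf T)"
            by (rule subseq_pair_subseq_iff[OF sX Ts(1)]) (use T(3) ab' in auto)
          also have "\<dots> \<longleftrightarrow> subseq [a' \<otimes> x, b' \<otimes> x] (lrtrans (Lf T) (cf T))"
            by (rule subseq_pair_subseq_iff[OF b(12)[OF T(1)] dL, symmetric]) (use T(3) ab' in auto)
          also have "\<dots> \<longleftrightarrow> subseq [a' \<otimes> ?y, b' \<otimes> ?y] (Lf T)"
            unfolding eq using ab' yc
            by (intro subseq_pair_map_iff[OF inj_on_rtrans[OF order_refl cT] b(10)[OF T(1)]]) auto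
          finally show ?thesis .
        qed
        then show ?thesis
          unfolding order_pattern_def by blast
      qed
      ultimately show ?thesis
        unfolding dec x_def[symmetric] by simp
    qed
    ultimately show ?thesis
      by blast
  qed
  ultimately show thesis
    using that by blast
qed

end

section \<open>Weak limits of random subsets of a countable set\<close>

text \<open>In base 4 with the digits 1 and 2 the codes of sets stay away from the grid of all numbers with
  denominator a power of 4. So the grid is null for every weak limit, and cylinder sets, which are
  decided by finitely many digits, are continuity sets.\<close>

definition digit :: "'i set \<Rightarrow> 'i \<Rightarrow> int" where
  "digit r i = (if i \<in> r then 2 else 1)"

definition digit_tail :: "(nat \<Rightarrow> 'i) \<Rightarrow> 'i set \<Rightarrow> nat \<Rightarrow> real" where
  "digit_tail f r N = (\<Sum>i. real_of_int (digit r (f (i + N))) * (1/4) ^ Suc i)"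

text \<open>The decoder is defined for every real number, since a weak limit need not be known in
  advance to live on codes.\<close>

definition digit_set :: "(nat \<Rightarrow> 'i) \<Rightarrow> real \<Rightarrow> 'i set" where
  "digit_set f x = {f i |i. \<lfloor>4 ^ Suc i * x\<rfloor> mod 4 = 2}"

lemma digit_tail_summable: "summable (\<lambda>i. real_of_int (digit r (f (i + N))) * (1/4) ^ Suc i)"
proof (rule summable_comparison_test')
  show "summable (\<lambda>i. 2 * (1/4 :: real) ^ Suc i)"
    by (intro summable_mult) (simp add: summable_geometric)
  show "norm (real_of_int (digit r (f (i + N))) * (1/4) ^ Suc i) \<le> 2 * (1/4) ^ Suc i" if "0 \<le> i" for i
    by (auto simp: digit_def)
qed

lemma digit_tail_bounds: "1/3 \<le> digit_tail f r N" "digit_tail f r N \<le> 2/3"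
proof -
  have geo: "(\<lambda>i. c * (1/4 :: real) ^ Suc i) sums (c / 3)" for c
  proof -
    have "(\<lambda>i. (c / 4) * (1/4 :: real) ^ i) sums ((c / 4) * (1 / (1 - 1/4)))"
      by (intro sums_mult geometric_sums) simp
    then show ?thesis
      by (simp add: field_simps)
  qed
  note s = digit_tail_summable[of r f N]
  have "(\<Sum>i. 1 * (1/4 :: real) ^ Suc i) \<le> digit_tail f r N"
    unfolding digit_tail_def using s geo[of 1]
    by (intro suminf_le) (auto simp: digit_def sums_iff)
  then show "1/3 \<le> digit_tail f r N"
    using geo[of 1] by (simp add: sums_iff)
  have "digit_tail f r N \<le> (\<Sum>i. 2 * (1/4 :: real) ^ Suc i)"
    unfolding digit_tail_def using s geo[of 2]
    by (intro suminf_le) (auto simp: digit_def sums_iff)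
  then show "digit_tail f r N \<le> 2/3"
    using geo[of 2] by (simp add: sums_iff)
qed

lemma digit_tail_Suc: "4 * digit_tail f r N = real_of_int (digit r (f N)) + digit_tail f r (Suc N)"
proof -
  have "digit_tail f r N = (\<Sum>i. real_of_int (digit r (f (Suc i + N))) * (1/4) ^ Suc (Suc i)) + real_of_int (digit r (f N)) * (1/4)"
    unfolding digit_tail_def using suminf_split_head[OF digit_tail_summable[of r f N]] by simp
  also have "(\<Sum>i. real_of_int (digit r (f (Suc i + N))) * (1/4) ^ Suc (Suc i)) = (\<Sum>i. real_of_int (digit r (f (i + Suc N))) * (1/4) ^ Suc i * (1/4))"
    by (simp add: algebra_simps)
  also have "\<dots> = digit_tail f r (Suc N) * (1/4)"
    unfolding digit_tail_def by (rule suminf_mult2[symmetric, OF digit_tail_summable])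
  finally show ?thesis
    by simp
qed

lemma digit_tail_floor:
  "\<exists>K::int. 4 ^ N * digit_tail f r 0 = real_of_int K + digit_tail f r N"
proof (induction N)
  case (Suc N)
  then obtain K :: int where "4 ^ N * digit_tail f r 0 = real_of_int K + digit_tail f r N"
    by blast
  then have "4 ^ Suc N * digit_tail f r 0 = real_of_int (4 * K + digit r (f N)) + digit_tail f r (Suc N)"
    using digit_tail_Suc[of f r N] by simp
  then show ?case
    by blast
qed (auto intro: exI[of _ 0])

lemma digit_set_code: "digit_set f (digit_tail f r 0) = r \<inter> range f"
proof -
  have "\<lfloor>4 ^ Suc i * digit_tail f r 0\<rfloor> mod 4 = digit r (f i)" for i
  proof -
    obtain K :: int where "4 ^ i * digit_tail f r 0 = real_of_int K + digit_tail f r i"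
      using digit_tail_floor by blast
    then have eq: "4 ^ Suc i * digit_tail f r 0 = real_of_int (4 * K + digit r (f i)) + digit_tail f r (Suc i)"
      using digit_tail_Suc[of f r i] by simp
    have "\<lfloor>4 ^ Suc i * digit_tail f r 0\<rfloor> = 4 * K + digit r (f i)"
      unfolding eq using digit_tail_bounds[of f r "Suc i"] by linarith
    then show ?thesis
      by (simp add: digit_def)
  qed
  then show ?thesis
    unfolding digit_set_def by (auto simp: digit_def split: if_splits)
qed

text \<open>After multiplication by \<open>4 ^ N\<close> a code is an integer plus a tail, and tails
  lie between 1/3 and 2/3.\<close>

lemma digit_code_far_from_grid:
  "1/3 \<le> \<bar>4 ^ N * digit_tail f r 0 - real_of_int z\<bar>"
proof -
  obtain K :: int where "4 ^ N * digit_tail f r 0 = real_of_int K + digit_tail f r N"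
    using digit_tail_floor by blast
  then have eq: "4 ^ N * digit_tail f r 0 - real_of_int z = real_of_int (K - z) + digit_tail f r N"
    by simp
  consider "0 \<le> K - z" | "K - z \<le> -1"
    by linarith
  then have "0 \<le> real_of_int (K - z) \<or> real_of_int (K - z) \<le> -1"
    by cases auto
  then show ?thesis
    unfolding eq using digit_tail_bounds[of f r N] by linarith
qed

text \<open>The hat function of height \<open>d\<close> at \<open>v\<close> is bounded and
  continuous, and its integral vanishes for every \<open>\<mu> n\<close>; hence it vanishes for the
  limit, where the hat is positive at \<open>v\<close>.\<close>

lemma weak_limit_grid_null:
  assumes \<mu>: "\<And>n. real_distribution (\<mu> n)" and M: "real_distribution M" and conv: "weak_conv_m \<mu> M"
    and far: "\<And>n. AE x in \<mu> n. d \<le> \<bar>x - v\<bar>" and d: "0 < d"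
  shows "emeasure M {v} = 0"
proof -
  interpret M: real_distribution M by fact
  interpret \<mu>: real_distribution "\<mu> n" for n by fact
  define b where "b x = max 0 (d - \<bar>x - v\<bar>)" for x :: real
  have cont: "isCont b x" for x
    unfolding b_def by (intro continuous_intros)
  have bdd: "norm (b x) \<le> d" for x
    using d by (auto simp: b_def)
  have meas: "b \<in> borel_measurable borel"
    using cont by (intro borel_measurable_continuous_onI continuous_at_imp_continuous_on) auto
  have int: "integrable M b"
    by (rule M.integrable_const_bound[of _ d]) (use bdd meas in auto)
  have "(\<lambda>n. integral\<^sup>L (\<mu> n) b) \<longlonglongrightarrow> integral\<^sup>L M b"
    by (rule weak_conv_imp_integral_bdd_continuous_conv[OF \<mu> M conv cont bdd])
  moreover have "integral\<^sup>L (\<mu> n) b = 0" for n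
    by (rule integral_eq_zero_AE, rule AE_mp[OF far[of n]]) (auto simp: b_def)
  ultimately have "integral\<^sup>L M b = 0"
    by (simp add: LIMSEQ_const_iff)
  then have "AE x in M. b x = 0"
    using integral_nonneg_eq_0_iff_AE[OF int] by (auto simp: b_def)
  then have "AE x in M. x \<notin> {v}"
    by eventually_elim (use d in \<open>auto simp: b_def\<close>)
  then show ?thesis
    by (subst (asm) AE_iff_measurable[of "{v}"]) auto
qed

lemma floor_locally_constant:
  fixes x :: real
  assumes "c * x \<notin> \<int>"
  shows "eventually (\<lambda>y. \<lfloor>c * y\<rfloor> = \<lfloor>c * x\<rfloor>) (nhds x)"
proof -
  have lim: "((\<lambda>y. c * y) \<longlongrightarrow> c * x) (nhds x)"
    by (intro tendsto_intros filterlim_ident)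
  have "real_of_int \<lfloor>c * x\<rfloor> < c * x"
  proof -
    have "c * x \<noteq> real_of_int \<lfloor>c * x\<rfloor>"
      using assms by (metis Ints_of_int)
    then show ?thesis
      by linarith
  qed
  moreover have "c * x < real_of_int \<lfloor>c * x\<rfloor> + 1"
    by linarith
  ultimately have "eventually (\<lambda>y. real_of_int \<lfloor>c * x\<rfloor> < c * y) (nhds x)"
    "eventually (\<lambda>y. c * y < real_of_int \<lfloor>c * x\<rfloor> + 1) (nhds x)"
    using order_tendstoD[OF lim] by auto
  then show ?thesis
    by eventually_elim linarith
qed

lemma digit_set_measurable: "inj f \<Longrightarrow> {x. i \<in> digit_set f x} \<in> sets borel"
proof (cases "i \<in> range f")
  case True
  assume f: "inj f"
  obtain n where n: "i = f n"
    using True by blast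
  have "{x. i \<in> digit_set f x} = {x. \<lfloor>4 ^ Suc n * x\<rfloor> mod 4 = 2}"
    using f by (auto simp: digit_set_def n inj_def)
  also have "\<dots> \<in> sets borel"
    by measurable
  finally show ?thesis .
next
  case False
  then have "{x. i \<in> digit_set f x} = {}"
    by (auto simp: digit_set_def)
  then show ?thesis
    by simp
qed

lemma digit_set_cylinder_measurable:
  assumes f: "inj f" and D: "finite D"
  shows "{x. Q (digit_set f x \<inter> D)} \<in> sets borel"
proof -
  note meas1 = digit_set_measurable[OF f]
  have "{x. Q (digit_set f x \<inter> D)} = (\<Union>V\<in>{V. V \<subseteq> D \<and> Q V}. \<Inter>i\<in>D. {x. i \<in> digit_set f x \<longleftrightarrow> i \<in> V})"
    by (auto intro!: exI[of _ "digit_set f _ \<inter> D"] elim!: back_subst[of Q])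
  moreover have "{x. i \<in> digit_set f x \<longleftrightarrow> i \<in> V} \<in> sets borel" for i V
    using meas1[of i] borel_comp[OF meas1[of i]] by (cases "i \<in> V") (auto simp: Collect_neg_eq)
  ultimately show ?thesis
    using D by (cases "D = {}") (auto intro!: sets.finite_UN sets.finite_INT)
qed

text \<open>Codes lie in a bounded interval, so the laws are tight and a subsequence converges
  weakly on the line. Off the grid finitely many digits are locally constant, so the frontier of a
  cylinder lies in the grid. The grid is countable and therefore null for the limit, and the
  probabilities of cylinders converge.\<close>

lemma cylinder_limit:
  fixes q :: "nat \<Rightarrow> 'i set pmf"
  assumes I: "countable I" "infinite I"
  obtains s :: "nat \<Rightarrow> nat" and M :: "real measure" and R :: "real \<Rightarrow> 'i set"
  where "strict_mono s" "real_distribution M" "\<And>x. R x \<subseteq> I"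
    "\<And>D Q. finite D \<Longrightarrow> {x. Q (R x \<inter> D)} \<in> sets borel"
    "\<And>D Q. finite D \<Longrightarrow> D \<subseteq> I \<Longrightarrow>
       (\<lambda>n. measure_pmf.prob (q (s n)) {r. Q (r \<inter> D)}) \<longlonglongrightarrow> measure M {x. Q (R x \<inter> D)}"
proof -
  define f where "f = from_nat_into I"
  have f: "inj f" "range f = I"
    using bij_betw_from_nat_into[OF I] by (auto simp: f_def bij_betw_def)
  define code where "code r = digit_tail f r 0" for r
  define \<mu> where "\<mu> n = distr (measure_pmf (q n)) borel code" for n
  have \<mu>: "real_distribution (\<mu> n)" for n
    unfolding \<mu>_def by (intro prob_space.real_distribution_distr measure_pmf.prob_space_axioms) simp
  have mass: "measure (\<mu> n) {-1<..1} = 1" for n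
  proof -
    have "-1 < code r \<and> code r \<le> 1" for r
      unfolding code_def using digit_tail_bounds[of f r 0] by linarith
    then have "code -` {-1<..1} = UNIV"
      by auto
    then show ?thesis
      unfolding \<mu>_def by (subst measure_distr) auto
  qed
  have "tight \<mu>"
    unfolding tight_def
  proof (intro conjI allI impI \<mu>)
    fix \<epsilon> :: real assume "0 < \<epsilon>"
    then show "\<exists>a b. a < b \<and> (\<forall>n. 1 - \<epsilon> < measure (\<mu> n) {a<..b})"
      using mass by (intro exI[of _ "-1"] exI[of _ 1]) simp
  qed
  then obtain s M where s: "strict_mono (s :: nat \<Rightarrow> nat)" "real_distribution M" "weak_conv_m (\<mu> \<circ> id \<circ> s) M"
    using tight_imp_convergent_subsubsequence[of \<mu> id] by (auto simp: strict_mono_def)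
  have \<mu>s: "real_distribution ((\<mu> \<circ> id \<circ> s) n)" for n
    using \<mu> by simp
  interpret M: real_distribution M by fact
  have null: "emeasure M {v} = 0" if v: "4 ^ N * v \<in> \<int>" for v N
  proof (rule weak_limit_grid_null[OF \<mu>s s(2,3), where d = "1/3 / 4 ^ N"])
    fix n
    obtain z where z: "4 ^ N * v = real_of_int z"
      using v by (auto elim: Ints_cases)
    have "1/3 / 4 ^ N \<le> \<bar>code r - v\<bar>" for r
    proof -
      have "1/3 \<le> \<bar>4 ^ N * code r - 4 ^ N * v\<bar>"
        unfolding z code_def by (rule digit_code_far_from_grid)
      also have "\<dots> = 4 ^ N * \<bar>code r - v\<bar>"
        by (simp add: right_diff_distrib[symmetric] abs_mult)
      finally show ?thesis
        by (simp add: field_simps)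
    qed
    then show "AE x in (\<mu> \<circ> id \<circ> s) n. 1/3 / 4 ^ N \<le> \<bar>x - v\<bar>"
      unfolding comp_def \<mu>_def by (subst AE_distr_iff) auto
  qed simp
  define grid where "grid = (\<Union>N::nat. {v::real. 4 ^ N * v \<in> \<int>})"
  have "countable {v::real. 4 ^ N * v \<in> \<int>}" for N :: nat
  proof -
    have "{v::real. 4 ^ N * v \<in> \<int>} \<subseteq> (\<lambda>z. real_of_int z / 4 ^ N) ` UNIV"
      by (auto elim!: Ints_cases simp: field_simps image_iff)
    then show ?thesis
      by (rule countable_subset) auto
  qed
  then have cgrid: "countable grid"
    by (simp add: grid_def)
  have gridM: "grid \<in> null_sets M"
    unfolding grid_def
  proof (rule null_sets_UN)
    fix N :: nat
    have c: "countable {v::real. 4 ^ N * v \<in> \<int>}"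
      by (rule countable_subset[OF _ cgrid]) (auto simp: grid_def)
    have "(\<Union>v\<in>{v::real. 4 ^ N * v \<in> \<int>}. {v}) \<in> null_sets M"
      by (rule null_sets_UN'[OF c]) (use null in \<open>auto simp: null_sets_def\<close>)
    then show "{v::real. 4 ^ N * v \<in> \<int>} \<in> null_sets M"
      by simp
  qed
  show thesis
  proof (rule that[of s M "digit_set f"])
    show "digit_set f x \<subseteq> I" for x
      using f(2) by (auto simp: digit_set_def)
    show meas: "{x. Q (digit_set f x \<inter> D)} \<in> sets borel" if "finite D" for D Q
      by (rule digit_set_cylinder_measurable[OF f(1) that])
    fix D :: "'i set" and Q
    assume D: "finite D" "D \<subseteq> I"
    let ?A = "{x. Q (digit_set f x \<inter> D)}"
    have A: "?A \<in> sets borel"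
      using meas[OF D(1)] .
    have loc: "eventually (\<lambda>y. digit_set f y \<inter> D = digit_set f x \<inter> D) (nhds x)" if x: "x \<notin> grid" for x
    proof -
      have "\<forall>i\<in>D. eventually (\<lambda>y. i \<in> digit_set f y \<longleftrightarrow> i \<in> digit_set f x) (nhds x)"
      proof
        fix i assume "i \<in> D"
        then obtain n where n: "i = f n"
          using D f by auto
        have mem: "i \<in> digit_set f y \<longleftrightarrow> \<lfloor>4 ^ Suc n * y\<rfloor> mod 4 = 2" for y
          using f(1) by (auto simp: digit_set_def n inj_def)
        have "4 ^ Suc n * x \<notin> \<int>"
          using x unfolding grid_def by blast
        from floor_locally_constant[OF this] show "eventually (\<lambda>y. i \<in> digit_set f y \<longleftrightarrow> i \<in> digit_set f x) (nhds x)"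
          unfolding mem by eventually_elim simp
      qed
      then have "eventually (\<lambda>y. \<forall>i\<in>D. i \<in> digit_set f y \<longleftrightarrow> i \<in> digit_set f x) (nhds x)"
        using D(1) by (simp add: eventually_ball_finite_distrib)
      then show ?thesis
        by eventually_elim blast
    qed
    have "frontier ?A \<subseteq> grid"
    proof
      fix x assume x: "x \<in> frontier ?A"
      show "x \<in> grid"
      proof (rule ccontr)
        assume "x \<notin> grid"
        from loc[OF this] have "eventually (\<lambda>y. y \<in> ?A \<longleftrightarrow> x \<in> ?A) (nhds x)"
          by eventually_elim simp
        then obtain S where S: "open S" "x \<in> S" "\<forall>y\<in>S. y \<in> ?A \<longleftrightarrow> x \<in> ?A"
          unfolding eventually_nhds by blast
        have "x \<in> closure ?A" "x \<in> closure (- ?A)"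
          using x by (auto simp: frontier_closures)
        then have "S \<inter> ?A \<noteq> {}" "S \<inter> - ?A \<noteq> {}"
          using S(2) open_Int_closure_eq_empty[OF S(1)] by blast+
        then show False
          using S(3) by blast
      qed
    qed
    then have "frontier ?A \<in> null_sets M"
      using gridM by (rule null_sets_subset[rotated 2]) auto
    then have "emeasure M (frontier ?A) = 0"
      by auto
    then have "(\<lambda>n. measure ((\<mu> \<circ> id \<circ> s) n) ?A) \<longlonglongrightarrow> measure M ?A"
      using weak_conv_imp_continuity_set_conv[OF \<mu>s s(2,3) A] by blast
    moreover have "measure ((\<mu> \<circ> id \<circ> s) n) ?A = measure_pmf.prob (q (s n)) {r. Q (r \<inter> D)}" for n
    proof -
      have "digit_set f (code r) \<inter> D = r \<inter> D" for r
        unfolding code_def digit_set_code using D f by auto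
      then have "code -` ?A = {r. Q (r \<inter> D)}"
        by auto
      then show ?thesis
        using A by (simp add: \<mu>_def measure_distr)
    qed
    ultimately show "(\<lambda>n. measure_pmf.prob (q (s n)) {r. Q (r \<inter> D)}) \<longlonglongrightarrow> measure M ?A"
      by simp
  qed (use s in auto)
qed

section \<open>Entropy of random words that are close to few code words\<close>

lemma gibbs_inequality:
  fixes p q :: "'j \<Rightarrow> real"
  assumes "finite J" "\<And>j. j \<in> J \<Longrightarrow> 0 \<le> p j" "\<And>j. j \<in> J \<Longrightarrow> 0 < q j" "sum p J = 1" "sum q J \<le> 1"
  shows "- (\<Sum>j\<in>J. p j * ln (p j)) \<le> - (\<Sum>j\<in>J. p j * ln (q j))"
proof -
  have "p j * ln (q j) - p j * ln (p j) \<le> q j - p j" if j: "j \<in> J" for j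
  proof (cases "p j = 0")
    case False
    then have p: "0 < p j"
      using assms(2)[OF j] by simp
    have "ln (q j / p j) \<le> q j / p j - 1"
      using p assms(3)[OF j] by (intro ln_le_minus_one) simp
    then have "p j * ln (q j / p j) \<le> p j * (q j / p j - 1)"
      using p by (intro mult_left_mono) auto
    then show ?thesis
      using p assms(3)[OF j] by (simp add: ln_div right_diff_distrib)
  qed (use assms(3)[OF j] in auto)
  then have "(\<Sum>j\<in>J. p j * ln (q j) - p j * ln (p j)) \<le> (\<Sum>j\<in>J. q j - p j)"
    by (intro sum_mono)
  then show ?thesis
    using assms(4,5) by (simp add: sum_subtractf)
qed

text \<open>Gibbs' inequality is applied with the mixture, over the code words \<open>\<psi>\<close>, of the product measures
  that give mass \<open>1 - \<theta>\<close> to the letter \<open>\<psi> g\<close> at \<open>g\<close> and spread \<open>\<theta>\<close> over all letters.\<close>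

lemma entropy_word_bound:
  fixes p :: "'j \<Rightarrow> real" and u :: "'j \<Rightarrow> 'g \<Rightarrow> 'l"
  assumes J: "finite J" "\<And>j. j \<in> J \<Longrightarrow> 0 \<le> p j" "sum p J = 1"
    and W: "finite W" and inj: "inj_on (\<lambda>j. restrict (u j) W) J"
    and \<Lambda>: "finite \<Lambda>" "\<Lambda> \<noteq> {}" "\<And>j g. j \<in> J \<Longrightarrow> g \<in> W \<Longrightarrow> u j g \<in> \<Lambda>"
    and \<Psi>: "finite \<Psi>" "\<And>j. j \<in> J \<Longrightarrow> \<exists>\<psi>\<in>\<Psi>. real (card {g \<in> W. u j g \<noteq> \<psi> g}) \<le> e j"
    and e: "(\<Sum>j\<in>J. p j * e j) \<le> \<delta> * real (card W)" and \<theta>: "0 < \<theta>" "\<theta> < 1"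
  shows "- (\<Sum>j\<in>J. p j * ln (p j)) \<le>
    ln (real (card \<Psi>)) + real (card W) * (\<delta> * ln (real (card \<Lambda>) / \<theta>) - ln (1 - \<theta>))"
proof -
  define k where "k = real (card \<Lambda>)"
  have k: "1 \<le> k"
    using \<Lambda> by (simp add: k_def Suc_leI card_gt_0_iff)
  \<comment> \<open>\<open>w l m\<close> is the weight of the letter \<open>l\<close> under the
    prediction \<open>m\<close>. The sum over \<open>l\<close> is at most 1 also for a prediction
    outside the alphabet, and total mass at most 1 suffices for Gibbs' inequality.\<close>
  define w where "w l m = (if l = m then 1 - \<theta> else \<theta> / k)" for l m :: 'l
  have w0: "0 < w l m" for l m
    using \<theta> k by (simp add: w_def)
  have wn: "w l m \<noteq> 0" for l m
    using w0[of l m] by simp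
  have wsum0: "0 \<le> (\<Sum>l\<in>\<Lambda>. w l m)" for m
    using w0 by (intro sum_nonneg less_imp_le)
  have wsum: "(\<Sum>l\<in>\<Lambda>. w l m) \<le> 1" for m
  proof -
    have "(\<Sum>l\<in>\<Lambda>. w l m) \<le> (\<Sum>l\<in>\<Lambda>. (if l = m then 1 - \<theta> else 0) + \<theta> / k)"
      using \<theta> k by (intro sum_mono) (auto simp: w_def)
    also have "\<dots> \<le> (1 - \<theta>) + \<theta>"
      using \<theta> k \<Lambda>(1) by (auto simp: sum.distrib k_def[symmetric])
    finally show ?thesis
      by simp
  qed
  have ne: "\<Psi> \<noteq> {}"
    using J(3) \<Psi>(2) by fastforce
  then have c\<Psi>: "0 < real (card \<Psi>)"
    using \<Psi>(1) by (simp add: card_gt_0_iff)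
  define Q where "Q v = (\<Sum>\<psi>\<in>\<Psi>. \<Prod>g\<in>W. w (v g) (\<psi> g)) / real (card \<Psi>)" for v :: "'g \<Rightarrow> 'l"
  have Q0: "0 < Q v" for v
    unfolding Q_def using c\<Psi> ne \<Psi>(1) w0 by (intro divide_pos_pos sum_pos prod_pos) auto
  have Qres: "Q (restrict v W) = Q v" for v
    unfolding Q_def by (intro arg_cong2[where f = "(/)"] sum.cong prod.cong) auto
  have "(\<Sum>v\<in>W \<rightarrow>\<^sub>E \<Lambda>. Q v) = (\<Sum>\<psi>\<in>\<Psi>. \<Sum>v\<in>W \<rightarrow>\<^sub>E \<Lambda>. \<Prod>g\<in>W. w (v g) (\<psi> g)) / real (card \<Psi>)"
    unfolding Q_def sum_divide_distrib[symmetric] by (subst sum.swap) simp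
  also have "\<dots> = (\<Sum>\<psi>\<in>\<Psi>. \<Prod>g\<in>W. \<Sum>l\<in>\<Lambda>. w l (\<psi> g)) / real (card \<Psi>)"
    using W \<Lambda>(1) by (simp add: prod_sum_PiE)
  also have "\<dots> \<le> (\<Sum>\<psi>\<in>\<Psi>. 1) / real (card \<Psi>)"
    using wsum wsum0 by (intro divide_right_mono sum_mono prod_le_1) auto
  also have "\<dots> = 1"
    using c\<Psi> by simp
  finally have QE: "(\<Sum>v\<in>W \<rightarrow>\<^sub>E \<Lambda>. Q v) \<le> 1" .
  have "(\<Sum>j\<in>J. Q (u j)) = (\<Sum>v\<in>(\<lambda>j. restrict (u j) W) ` J. Q v)"
    using sum.reindex[OF inj, of Q] Qres by simp
  also have "\<dots> \<le> (\<Sum>v\<in>W \<rightarrow>\<^sub>E \<Lambda>. Q v)"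
  proof (rule sum_mono2)
    show "finite (W \<rightarrow>\<^sub>E \<Lambda>)"
      using W \<Lambda>(1) by (intro finite_PiE) auto
    show "(\<lambda>j. restrict (u j) W) ` J \<subseteq> W \<rightarrow>\<^sub>E \<Lambda>"
      using \<Lambda>(3) by auto
    show "0 \<le> Q v" for v
      using Q0 less_imp_le by blast
  qed
  finally have QJ: "(\<Sum>j\<in>J. Q (u j)) \<le> 1"
    using QE by linarith
  define C where "C = ln (real (card \<Psi>)) - real (card W) * ln (1 - \<theta>)"
  have k\<theta>: "0 \<le> ln (k / \<theta>)"
    using k \<theta> by (simp add: field_simps)
  have lnQ: "- ln (Q (u j)) \<le> C + e j * ln (k / \<theta>)" if j: "j \<in> J" for j
  proof -
    obtain \<psi> where \<psi>: "\<psi> \<in> \<Psi>" "real (card {g \<in> W. u j g \<noteq> \<psi> g}) \<le> e j"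
      using \<Psi>(2)[OF j] by blast
    let ?E = "{g \<in> W. u j g \<noteq> \<psi> g}"
    \<comment> \<open>One summand of the mixture is enough, that of the near code word. Its share in
      the mixture costs \<open>ln (card \<Psi>)\<close>, every letter costs
      \<open>- ln (1 - \<theta>)\<close>, and every mismatch at most
      \<open>ln (k / \<theta>)\<close> more.\<close>
    have "(\<Prod>g\<in>W. w (u j g) (\<psi> g)) / real (card \<Psi>) \<le> Q (u j)"
      unfolding Q_def using \<psi>(1) \<Psi>(1) w0
      by (intro divide_right_mono member_le_sum prod_nonneg less_imp_le[OF w0] ballI) auto
    then have "ln ((\<Prod>g\<in>W. w (u j g) (\<psi> g)) / real (card \<Psi>)) \<le> ln (Q (u j))"
      using w0 c\<Psi> by (intro ln_mono divide_pos_pos prod_pos) auto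
    moreover have "ln ((\<Prod>g\<in>W. w (u j g) (\<psi> g)) / real (card \<Psi>)) = (\<Sum>g\<in>W. ln (w (u j g) (\<psi> g))) - ln (real (card \<Psi>))"
      using w0 c\<Psi> W by (subst ln_div) (auto intro!: prod_pos simp: ln_prod wn)
    moreover have "(\<Sum>g\<in>W. ln (1 - \<theta>) - (if g \<in> ?E then ln (k / \<theta>) else 0)) \<le> (\<Sum>g\<in>W. ln (w (u j g) (\<psi> g)))"
    proof (rule sum_mono)
      fix g assume "g \<in> W"
      have "ln (1 - \<theta>) \<le> 0"
        using \<theta> by simp
      moreover have "ln (\<theta> / k) = - ln (k / \<theta>)"
        using \<theta> k by (simp add: ln_div)
      ultimately show "ln (1 - \<theta>) - (if g \<in> ?E then ln (k / \<theta>) else 0) \<le> ln (w (u j g) (\<psi> g))"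
        using \<open>g \<in> W\<close> by (simp add: w_def)
    qed
    moreover have "(\<Sum>g\<in>W. ln (1 - \<theta>) - (if g \<in> ?E then ln (k / \<theta>) else 0)) = real (card W) * ln (1 - \<theta>) - real (card ?E) * ln (k / \<theta>)"
      using W by (simp add: sum_subtractf sum.inter_filter[symmetric])
    moreover have "real (card ?E) * ln (k / \<theta>) \<le> e j * ln (k / \<theta>)"
      using \<psi>(2) k\<theta> by (rule mult_right_mono)
    ultimately show ?thesis
      unfolding C_def by linarith
  qed
  have "- (\<Sum>j\<in>J. p j * ln (p j)) \<le> - (\<Sum>j\<in>J. p j * ln (Q (u j)))"
    using J Q0 QJ by (intro gibbs_inequality) auto
  also have "\<dots> = (\<Sum>j\<in>J. p j * (- ln (Q (u j))))"
    by (simp add: sum_negf)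
  also have "\<dots> \<le> (\<Sum>j\<in>J. p j * (C + e j * ln (k / \<theta>)))"
    using J(2) lnQ by (intro sum_mono mult_left_mono) auto
  also have "\<dots> = (\<Sum>j\<in>J. p j) * C + (\<Sum>j\<in>J. p j * e j) * ln (k / \<theta>)"
    by (simp add: distrib_left sum.distrib sum_distrib_right mult.assoc)
  also have "\<dots> \<le> C + \<delta> * real (card W) * ln (k / \<theta>)"
    using J(3) e k\<theta> by (simp add: mult_right_mono)
  finally show ?thesis
    unfolding C_def k_def by (simp add: algebra_simps)
qed

section \<open>Cylinder sets and the limit law of the finite orders\<close>

text \<open>Arbitrary predicates of a finite restriction are allowed instead of prescribed patterns:
  this makes the family an algebra and lets every event about finitely many pairs be used
  directly.\<close>

definition order_cylinders :: "('a, 'b) monoid_scheme \<Rightarrow> 'a rel set set" where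
  "order_cylinders G = {{r \<in> Z_orders G. Q (r \<inter> D)} |D Q. finite D \<and> D \<subseteq> carrier G \<times> carrier G}"

lemma order_cylinderI:
  "finite D \<Longrightarrow> D \<subseteq> carrier G \<times> carrier G \<Longrightarrow> {r \<in> Z_orders G. Q (r \<inter> D)} \<in> order_cylinders G"
  unfolding order_cylinders_def by blast

lemma order_cylinders_subset: "order_cylinders G \<subseteq> Pow (Z_orders G)"
  by (auto simp: order_cylinders_def)

lemma Z_orders_subset: "r \<in> Z_orders G \<Longrightarrow> r \<subseteq> carrier G \<times> carrier G"
  by (simp add: Z_orders_def)

lemma space_Z_order_space: "space (Z_order_space G) = Z_orders G"
  by (simp add: Z_order_space_def)

text \<open>There are only countably many pairs of a finite set and a pattern on it, and an open set
  is the union of those it contains. A basic open set may also constrain pairs outside the carrier,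
  but there all elements of \<open>Z_orders G\<close> agree.\<close>

lemma indicator_preimage_open:
  assumes U: "open (U :: ('a \<times> 'a \<Rightarrow> bool) set)" and C: "countable (carrier G)"
  shows "(\<lambda>r p. p \<in> r) -` U \<inter> Z_orders G \<in> sigma_sets (Z_orders G) (order_cylinders G)"
proof -
  let ?f = "\<lambda>(r :: 'a rel) p. p \<in> r" and ?CC = "carrier G \<times> carrier G"
  define J where "J = {(D, V). finite D \<and> D \<subseteq> ?CC \<and> V \<subseteq> D \<and> {r \<in> Z_orders G. r \<inter> D = V} \<subseteq> ?f -` U}"
  have "countable ?CC"
    using C by simp
  then have "countable {D. finite D \<and> D \<subseteq> ?CC}"
    by (rule countable_Collect_finite_subset[of ?CC, simplified conj_commute])
  then have "countable ({D. finite D \<and> D \<subseteq> ?CC} \<times> {D. finite D \<and> D \<subseteq> ?CC})"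
    by simp
  moreover have "J \<subseteq> {D. finite D \<and> D \<subseteq> ?CC} \<times> {D. finite D \<and> D \<subseteq> ?CC}"
    by (auto simp: J_def intro: finite_subset)
  ultimately have cJ: "countable J"
    by (rule countable_subset[rotated])
  have "?f -` U \<inter> Z_orders G = (\<Union>(D, V)\<in>J. {r \<in> Z_orders G. r \<inter> D = V})"
  proof (intro equalityI subsetI)
    fix r assume r: "r \<in> ?f -` U \<inter> Z_orders G"
    have "openin (product_topology (\<lambda>i. euclidean) UNIV) U"
      using U by (simp add: open_fun_def)
    then obtain X where X: "?f r \<in> (\<Pi>\<^sub>E i\<in>UNIV. X i)" "finite {i. X i \<noteq> topspace (euclidean :: bool topology)}"
      "(\<Pi>\<^sub>E i\<in>UNIV. X i) \<subseteq> U"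
      using product_topology_open_contains_basis[of "\<lambda>i. euclidean" UNIV U "?f r"] r by auto
    define D where "D = {i. X i \<noteq> UNIV} \<inter> ?CC"
    have "?f r' \<in> U" if r': "r' \<in> Z_orders G" "r' \<inter> D = r \<inter> D" for r'
    proof -
      have "?f r' i \<in> X i" for i
      proof (cases "i \<in> D \<or> X i = UNIV")
        case True
        then have "X i = UNIV \<or> ?f r' i = ?f r i"
          using r'(2) by blast
        then show ?thesis
          using PiE_mem[OF X(1) UNIV_I, of i] by auto
      next
        case False
        then have "i \<notin> ?CC"
          by (auto simp: D_def)
        then have "?f r' i = ?f r i"
          using Z_orders_subset r'(1) r by blast
        then show ?thesis
          using PiE_mem[OF X(1) UNIV_I, of i] by auto
      qed
      then show ?thesis
        using X(3) by (auto simp: PiE_iff)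
    qed
    then have "(D, r \<inter> D) \<in> J"
      using X(2) by (auto simp: J_def D_def)
    then show "r \<in> (\<Union>(D, V)\<in>J. {r \<in> Z_orders G. r \<inter> D = V})"
      using r by auto
  qed (auto simp: J_def)
  moreover have "{r \<in> Z_orders G. r \<inter> D = V} \<in> sigma_sets (Z_orders G) (order_cylinders G)" if "(D, V) \<in> J" for D V
    using that by (intro sigma_sets.Basic order_cylinderI[where Q = "\<lambda>r. r = V"]) (auto simp: J_def)
  ultimately show ?thesis
    using cJ by (auto intro!: sigma_sets_UNION)
qed

text \<open>With cylinders as generators, measurability of maps and equality of measures can be
  tested on events about finitely many pairs.\<close>

lemma sets_Z_order_space:
  fixes G :: "('a, 'b) monoid_scheme"
  assumes C: "countable (carrier G)"
  shows "sets (Z_order_space G) = sigma_sets (Z_orders G) (order_cylinders G)"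
proof
  let ?f = "\<lambda>(r :: 'a rel) p. p \<in> r"
  have sp: "space (sigma (Z_orders G) (order_cylinders G)) = Z_orders G"
    "sets (sigma (Z_orders G) (order_cylinders G)) = sigma_sets (Z_orders G) (order_cylinders G)"
    by (rule space_measure_of[OF order_cylinders_subset] sets_measure_of[OF order_cylinders_subset])+
  have m: "?f \<in> borel_measurable (sigma (Z_orders G) (order_cylinders G))"
    by (rule borel_measurableI) (simp add: sp indicator_preimage_open[OF _ C])
  show "sets (Z_order_space G) \<subseteq> sigma_sets (Z_orders G) (order_cylinders G)"
    unfolding Z_order_space_def sets_vimage_algebra
  proof (rule sigma_sets_mono, rule subsetI)
    fix A assume "A \<in> {?f -` A \<inter> Z_orders G |A. A \<in> sets borel}"
    then show "A \<in> sigma_sets (Z_orders G) (order_cylinders G)"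
      using measurable_sets[OF m] by (auto simp: sp)
  qed
  have single: "{r \<in> Z_orders G. p \<in> r} \<in> sets (Z_order_space G)" for p
  proof -
    have "{r \<in> Z_orders G. p \<in> r} = ?f -` {v. v p} \<inter> Z_orders G"
      by auto
    moreover have "open ((\<lambda>v :: 'a \<times> 'a \<Rightarrow> bool. v p) -` {True})"
      using continuous_on_product_coordinates[of p] by (intro open_vimage discrete_topology_class.open_discrete)
    then have "{v :: 'a \<times> 'a \<Rightarrow> bool. v p} \<in> sets borel"
      by (simp add: vimage_def borel_open)
    ultimately show ?thesis
      unfolding Z_order_space_def by (simp only: in_vimage_algebra)
  qed
  show "sigma_sets (Z_orders G) (order_cylinders G) \<subseteq> sets (Z_order_space G)"
  proof (rule sets.sigma_sets_subset'[of _ "Z_order_space G" "Z_orders G"])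
    show "Z_orders G \<in> sets (Z_order_space G)"
      using sets.top[of "Z_order_space G"] by (simp add: space_Z_order_space)
    show "order_cylinders G \<subseteq> sets (Z_order_space G)"
    proof
      fix A assume "A \<in> order_cylinders G"
      then obtain D Q where A: "A = {r \<in> Z_orders G. Q (r \<inter> D)}" "finite D"
        by (auto simp: order_cylinders_def)
      have "A = (\<Union>V\<in>{V. V \<subseteq> D \<and> Q V}. {r \<in> Z_orders G. r \<inter> D = V})"
        by (auto simp: A(1))
      moreover have "{r \<in> Z_orders G. r \<inter> D = V} \<in> sets (Z_order_space G)" if V: "V \<subseteq> D" for V
      proof -
        have "{r \<in> Z_orders G. r \<inter> D = V} = {r \<in> space (Z_order_space G). \<forall>p\<in>D. p \<in> r \<longleftrightarrow> p \<in> V}"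
          using V by (auto simp: space_Z_order_space)
        also have "\<dots> \<in> sets (Z_order_space G)"
        proof (rule sets.sets_Collect_finite_All[OF _ A(2)])
          fix p
          have "{r \<in> space (Z_order_space G). p \<in> r} \<in> sets (Z_order_space G)"
            using single[of p] by (simp add: space_Z_order_space)
          then show "{r \<in> space (Z_order_space G). p \<in> r \<longleftrightarrow> p \<in> V} \<in> sets (Z_order_space G)"
            using sets.sets_Collect_neg[of "Z_order_space G" "\<lambda>r. p \<in> r"] by (cases "p \<in> V") simp_all
        qed
        finally show ?thesis .
      qed
      ultimately show "A \<in> sets (Z_order_space G)"
        using A(2) by (auto intro!: sets.finite_UN)
    qed
  qed
qed

section \<open>Frequencies of events in the finite orders\<close>

locale tiled_group = group G for G (structure) +
  fixes E :: "nat \<Rightarrow> 'a set" and \<epsilon> :: "nat \<Rightarrow> real" and \<L> :: "nat \<Rightarrow> 'a list set" and N :: "nat \<Rightarrow> nat"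
    and X :: "nat \<Rightarrow> 'a list"
  assumes countable_carrier: "countable (carrier G)" and infinite_carrier: "infinite (carrier G)"
    and E: "\<And>k. finite (E k)" "\<And>k. E k \<subseteq> carrier G" "\<And>k n. k \<le> n \<Longrightarrow> E k \<subseteq> E n" "(\<Union>k. E k) = carrier G"
    and eps: "\<And>k. 0 < \<epsilon> k" "\<And>k. \<epsilon> k \<le> 1/4" "\<And>k n. k \<le> n \<Longrightarrow> \<epsilon> n \<le> \<epsilon> k" "\<epsilon> \<longlonglongrightarrow> 0"
    and shapes: "\<And>k. finite (\<L> k)" "\<And>k. \<L> k \<noteq> {}"
      "\<And>k L. L \<in> \<L> k \<Longrightarrow> distinct L \<and> almost_inv (E k) (\<epsilon> k) (set L) \<and> N k \<le> length L"
      "\<And>k. 0 < N k" "\<And>k. (2 + 4 * ln (real (card (\<L> k)) * real (N k))) / real (N k) \<le> \<epsilon> k"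
    and X: "\<And>n. distinct (X n)" "\<And>n. almost_inv (E n) (\<epsilon> n) (set (X n))"
      "\<And>k n. k \<le> n \<Longrightarrow> \<exists>Ts. X n = concat Ts \<and> (\<forall>T\<in>set Ts. approx_tile (\<L> k) (\<epsilon> k) T)"
begin

definition tile_bound :: "nat \<Rightarrow> nat" where
  "tile_bound k = 2 * (\<Sum>L\<in>\<L> k. length L)"

text \<open>The order of \<open>X n\<close> seen from \<open>g\<close>. Pairs that the list does not
  reach are left unrelated, so the relation is total only where the window around \<open>g\<close>
  fits into the list.\<close>

definition rel_at :: "nat \<Rightarrow> 'a \<Rightarrow> 'a rel" where
  "rel_at n g = {(a, b) \<in> carrier G \<times> carrier G. subseq [a \<otimes> g, b \<otimes> g] (X n)}"

definition freq :: "nat \<Rightarrow> ('a \<Rightarrow> bool) \<Rightarrow> real" where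
  "freq n P = real (card {g \<in> set (X n). P g}) / real (length (X n))"

lemma X_set: "set (X n) \<subseteq> carrier G" "0 < length (X n)" "card (set (X n)) = length (X n)"
  using X(1,2)[of n] by (auto simp: almost_inv_def distinct_card)

lemma blocks:
  assumes "k \<le> n"
  obtains Ts where "X n = concat Ts" "\<And>T. T \<in> set Ts \<Longrightarrow> approx_tile (\<L> k) (\<epsilon> k) T \<and> length T \<le> tile_bound k"
proof -
  obtain Ts where Ts: "X n = concat Ts" "\<forall>T\<in>set Ts. approx_tile (\<L> k) (\<epsilon> k) T"
    using X(3)[OF assms] by blast
  have "length T \<le> tile_bound k" if T: "T \<in> set Ts" for T
  proof -
    obtain L where L: "L \<in> \<L> k" "real (length T) \<le> (1 + \<epsilon> k) * real (length L)"
      using Ts(2) T by (auto simp: approx_tile_def)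
    have "(1 + \<epsilon> k) * real (length L) \<le> 2 * real (length L)"
      using eps(2)[of k] by (intro mult_right_mono) auto
    moreover have "length L \<le> (\<Sum>L\<in>\<L> k. length L)"
      using L(1) shapes(1) by (intro member_le_sum) auto
    ultimately show ?thesis
      using L(2) unfolding tile_bound_def by linarith
  qed
  then show thesis
    using that Ts by blast
qed

lemma freq_mono: "(\<And>g. g \<in> set (X n) \<Longrightarrow> P g \<Longrightarrow> Q g) \<Longrightarrow> freq n P \<le> freq n Q"
  unfolding freq_def by (intro divide_right_mono of_nat_mono card_mono) auto

lemma freq_cong: "(\<And>g. g \<in> set (X n) \<Longrightarrow> P g \<longleftrightarrow> Q g) \<Longrightarrow> freq n P = freq n Q"
  by (intro antisym freq_mono) auto

lemma freq_Un: "freq n (\<lambda>g. P g \<or> Q g) \<le> freq n P + freq n Q"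
proof -
  have "{g \<in> set (X n). P g \<or> Q g} = {g \<in> set (X n). P g} \<union> {g \<in> set (X n). Q g}"
    by auto
  then have "card {g \<in> set (X n). P g \<or> Q g} \<le> card {g \<in> set (X n). P g} + card {g \<in> set (X n). Q g}"
    by (simp only: card_Un_le)
  then show ?thesis
    unfolding freq_def add_divide_distrib[symmetric] by (intro divide_right_mono) (auto simp flip: of_nat_add)
qed

lemma freq_shift_le:
  assumes h: "h \<in> carrier G" and F: "finite F" and P: "\<And>g. g \<in> set (X n) \<Longrightarrow> P g \<Longrightarrow> h \<otimes> g \<in> F"
  shows "freq n P \<le> real (card F) / real (length (X n))"
proof -
  have "card {g \<in> set (X n). P g} = card ((\<lambda>g. h \<otimes> g) ` {g \<in> set (X n). P g})"
    using X_set(1) h by (intro card_image[symmetric] inj_on_ltrans) auto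
  also have "\<dots> \<le> card F"
    using P F by (intro card_mono) auto
  finally show ?thesis
    unfolding freq_def by (intro divide_right_mono) auto
qed

lemma freq_escape: "h \<in> E n \<Longrightarrow> freq n (\<lambda>g. h \<otimes> g \<notin> set (X n)) \<le> \<epsilon> n"
  using X(2)[of n] X_set(2,3)[of n] by (simp add: freq_def almost_inv_def escape_def divide_simps)

lemma in_E_eventually:
  assumes "finite A" "A \<subseteq> carrier G"
  obtains k0 where "\<And>k. k0 \<le> k \<Longrightarrow> A \<subseteq> E k"
proof -
  have "\<forall>a\<in>A. \<exists>k. a \<in> E k"
    using assms(2) E(4) by blast
  then obtain k where k: "\<And>a. a \<in> A \<Longrightarrow> a \<in> E (k a)"
    by metis
  have "A \<subseteq> E j" if j: "Max (insert 0 (k ` A)) \<le> j" for j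
  proof
    fix a assume a: "a \<in> A"
    have "k a \<le> Max (insert 0 (k ` A))"
      using assms(1) a by (intro Max_ge) auto
    then show "a \<in> E j"
      using k[OF a] E(3)[of "k a" j] j by auto
  qed
  then show thesis
    using that by blast
qed

lemma eps_eventually:
  assumes "0 < (\<delta>::real)"
  obtains k0 where "\<And>k. k0 \<le> k \<Longrightarrow> \<epsilon> k < \<delta>"
  using order_tendstoD(2)[OF eps(4) assms] unfolding eventually_sequentially by blast

text \<open>One inequality holds by injectivity of left multiplication once the escaping points are
  set aside; the other is the same inequality for \<open>inv h\<close>.\<close>

lemma freq_shift_invariant:
  assumes h: "h \<in> E n" "inv h \<in> E n" "h \<in> carrier G"
  shows "\<bar>freq n (\<lambda>g. P (h \<otimes> g)) - freq n P\<bar> \<le> \<epsilon> n"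
proof -
  have half: "freq n (\<lambda>g. P (h \<otimes> g)) \<le> freq n P + \<epsilon> n" if h: "h \<in> E n" "h \<in> carrier G" for h P
  proof -
    have "freq n (\<lambda>g. P (h \<otimes> g)) \<le> freq n (\<lambda>g. (h \<otimes> g \<in> set (X n) \<and> P (h \<otimes> g)) \<or> h \<otimes> g \<notin> set (X n))"
      by (rule freq_mono) auto
    also have "\<dots> \<le> freq n (\<lambda>g. h \<otimes> g \<in> set (X n) \<and> P (h \<otimes> g)) + freq n (\<lambda>g. h \<otimes> g \<notin> set (X n))"
      by (rule freq_Un)
    also have "freq n (\<lambda>g. h \<otimes> g \<in> set (X n) \<and> P (h \<otimes> g)) \<le> freq n P"
      unfolding freq_def[of n P] by (rule freq_shift_le[OF h(2)]) auto
    finally show ?thesis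
      using freq_escape[OF h(1)] by linarith
  qed
  have "freq n P = freq n (\<lambda>g. P (h \<otimes> (inv h \<otimes> g)))"
    using X_set(1) h(3) by (intro freq_cong) (auto simp: m_assoc[symmetric] subset_iff)
  also have "\<dots> \<le> freq n (\<lambda>g. P (h \<otimes> g)) + \<epsilon> n"
    using half[OF h(2), of "\<lambda>g. P (h \<otimes> g)"] h(3) by simp
  finally show ?thesis
    using half[OF h(1,3), of P] by linarith
qed

lemma prob_rel_at:
  "measure_pmf.prob (map_pmf (rel_at n) (pmf_of_set (set (X n)))) {r. Q (r \<inter> D)} = freq n (\<lambda>g. Q (rel_at n g \<inter> D))"
proof -
  have "set (X n) \<noteq> {}"
    using X_set(2)[of n] by auto
  then show ?thesis
    using X_set(3)[of n] by (simp add: measure_pmf_of_set freq_def Int_def vimage_def)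
qed

text \<open>A change of the viewpoint is exactly the action on orders, so almost invariance of the
  set of viewpoints turns into invariance of the limit law.\<close>

lemma rel_at_shift:
  assumes "h \<in> carrier G" "g \<in> carrier G"
  shows "rel_at n (h \<otimes> g) = order_action G h (rel_at n g)"
  using assms by (auto simp: rel_at_def order_action_def m_assoc)

text \<open>For \<open>x = a \<otimes> g\<close> the point \<open>b \<otimes> g\<close> is
  \<open>(b \<otimes> inv a) \<otimes> x\<close>, so the gap estimate for the single element
  \<open>b \<otimes> inv a\<close> applies. The bound depends neither on \<open>n\<close> nor on
  \<open>A\<close>, which allows both to grow.\<close>

lemma freq_between:
  assumes ab: "a \<in> carrier G" "b \<in> carrier G" "b \<otimes> inv a \<in> E k" and kn: "k \<le> n" and A: "finite A" "A \<subseteq> carrier G"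
  shows "freq n (\<lambda>g. tile_bound k < card {d \<in> A. (a, d) \<in> rel_at n g \<and> (d, b) \<in> rel_at n g}) \<le> 8 * \<epsilon> k"
proof -
  obtain Ts where Ts: "X n = concat Ts" "\<And>T. T \<in> set Ts \<Longrightarrow> approx_tile (\<L> k) (\<epsilon> k) T \<and> length T \<le> tile_bound k"
    using blocks[OF kn] by blast
  let ?h = "b \<otimes> inv a"
  let ?F = "{x \<in> set (X n). tile_bound k < card {z. subseq [x, z] (X n) \<and> subseq [z, ?h \<otimes> x] (X n)}}"
  have hc: "?h \<in> carrier G"
    using ab by simp
  have F: "real (card ?F) \<le> 8 * \<epsilon> k * real (length (X n))"
    using separated_card[OF _ _ Ts(2) shapes(3) eps(1,2) ab(3) hc] X(1)[of n] X_set(1)[of n] unfolding Ts(1) by blast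
  have "freq n (\<lambda>g. tile_bound k < card {d \<in> A. (a, d) \<in> rel_at n g \<and> (d, b) \<in> rel_at n g}) \<le> real (card ?F) / real (length (X n))"
  proof (rule freq_shift_le[OF ab(1)])
    fix g assume g: "g \<in> set (X n)" "tile_bound k < card {d \<in> A. (a, d) \<in> rel_at n g \<and> (d, b) \<in> rel_at n g}"
    let ?D = "{d \<in> A. (a, d) \<in> rel_at n g \<and> (d, b) \<in> rel_at n g}"
    have gc: "g \<in> carrier G"
      using g X_set(1) by blast
    have hag: "?h \<otimes> (a \<otimes> g) = b \<otimes> g"
    proof -
      have "?h \<otimes> (a \<otimes> g) = b \<otimes> (inv a \<otimes> (a \<otimes> g))"
        using ab gc by (simp add: m_assoc)
      also have "inv a \<otimes> (a \<otimes> g) = g"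
        using ab gc by (simp add: m_assoc[symmetric])
      finally show ?thesis .
    qed
    have "?D \<noteq> {}"
      using g(2) by (metis card.empty not_less_zero)
    then obtain d where "subseq [a \<otimes> g, d \<otimes> g] (X n)"
      by (auto simp: rel_at_def)
    then have ag: "a \<otimes> g \<in> set (X n)"
      using subseq_pair_set by fast
    have fin: "finite {z. subseq [a \<otimes> g, z] (X n) \<and> subseq [z, ?h \<otimes> (a \<otimes> g)] (X n)}"
      by (rule finite_subset[of _ "set (X n)"]) (auto dest: subseq_pair_set)
    have "card ?D = card (rtrans ?D g)"
      using A(2) gc by (intro card_rtrans[symmetric]) auto
    also have "\<dots> \<le> card {z. subseq [a \<otimes> g, z] (X n) \<and> subseq [z, ?h \<otimes> (a \<otimes> g)] (X n)}"
      using fin unfolding hag by (intro card_mono) (auto simp: rel_at_def)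
    finally show "a \<otimes> g \<in> ?F"
      using ag g(2) by simp
  qed simp
  also have "\<dots> \<le> 8 * \<epsilon> k"
    using F X_set(2)[of n] by (simp add: divide_le_eq)
  finally show ?thesis .
qed

lemma freq_not_total:
  assumes "a \<in> E n" "b \<in> E n" "a \<noteq> b"
  shows "freq n (\<lambda>g. (a, b) \<notin> rel_at n g \<and> (b, a) \<notin> rel_at n g) \<le> 2 * \<epsilon> n"
proof -
  have ab: "a \<in> carrier G" "b \<in> carrier G"
    using assms E(2) by auto
  have "freq n (\<lambda>g. (a, b) \<notin> rel_at n g \<and> (b, a) \<notin> rel_at n g) \<le>
      freq n (\<lambda>g. a \<otimes> g \<notin> set (X n) \<or> b \<otimes> g \<notin> set (X n))"
  proof (rule freq_mono)
    fix g assume g: "g \<in> set (X n)" "(a, b) \<notin> rel_at n g \<and> (b, a) \<notin> rel_at n g"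
    have "a \<otimes> g \<noteq> b \<otimes> g"
      using ab assms(3) g(1) X_set(1) by (auto simp: subset_iff)
    then show "a \<otimes> g \<notin> set (X n) \<or> b \<otimes> g \<notin> set (X n)"
      using subseq_pair_total[of "a \<otimes> g" "X n" "b \<otimes> g"] g(2) ab by (auto simp: rel_at_def)
  qed
  also have "\<dots> \<le> freq n (\<lambda>g. a \<otimes> g \<notin> set (X n)) + freq n (\<lambda>g. b \<otimes> g \<notin> set (X n))"
    by (rule freq_Un)
  finally show ?thesis
    using freq_escape[OF assms(1)] freq_escape[OF assms(2)] by linarith
qed

lemma freq_zero: "(\<And>g. g \<in> set (X n) \<Longrightarrow> \<not> P g) \<Longrightarrow> freq n P = 0"
  by (auto simp: freq_def)

end

section \<open>Almost sure properties of the limit law\<close>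

locale limit_law = tiled_group G E \<epsilon> \<L> N X for G (structure) and E \<epsilon> \<L> N X +
  fixes s :: "nat \<Rightarrow> nat" and M :: "real measure" and R :: "real \<Rightarrow> 'a rel"
  assumes s: "strict_mono s" and M: "real_distribution M"
    and R_subset: "\<And>x. R x \<subseteq> carrier G \<times> carrier G"
    and R_meas: "\<And>D Q. finite D \<Longrightarrow> {x. Q (R x \<inter> D)} \<in> sets borel"
    and R_lim: "\<And>D Q. finite D \<Longrightarrow> D \<subseteq> carrier G \<times> carrier G \<Longrightarrow>
      (\<lambda>n. freq (s n) (\<lambda>g. Q (rel_at (s n) g \<inter> D))) \<longlonglongrightarrow> measure M {x. Q (R x \<inter> D)}"
begin

sublocale M: real_distribution M
  by (rule M)

lemma s_ge: "n \<le> s n"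
  using s by (rule seq_suble)

lemma cyl_le:
  assumes D: "finite D" "D \<subseteq> carrier G \<times> carrier G"
    and le: "\<And>n. k \<le> n \<Longrightarrow> freq n (\<lambda>g. Q (rel_at n g \<inter> D)) \<le> c"
  shows "measure M {x. Q (R x \<inter> D)} \<le> c"
proof (rule LIMSEQ_le_const2[OF R_lim[OF D]])
  show "\<exists>K. \<forall>n\<ge>K. freq (s n) (\<lambda>g. Q (rel_at (s n) g \<inter> D)) \<le> c"
    using le s_ge order_trans by blast
qed

lemma eps_s: "(\<lambda>n. \<epsilon> (s n)) \<longlonglongrightarrow> 0"
  using LIMSEQ_subseq_LIMSEQ[OF eps(4) s] by (simp add: comp_def)

lemma cyl_zero:
  assumes D: "finite D" "D \<subseteq> carrier G \<times> carrier G"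
    and le: "\<And>n. k \<le> n \<Longrightarrow> freq n (\<lambda>g. Q (rel_at n g \<inter> D)) \<le> C * \<epsilon> n"
  shows "measure M {x. Q (R x \<inter> D)} = 0"
proof -
  have "(\<lambda>n. C * \<epsilon> (s n)) \<longlonglongrightarrow> C * 0"
    by (intro tendsto_intros eps_s)
  then have "measure M {x. Q (R x \<inter> D)} \<le> C * 0"
    by (rule LIMSEQ_le[OF R_lim[OF D]]) (use le s_ge order_trans in blast)
  then show ?thesis
    using measure_nonneg[of M] by (simp add: antisym)
qed

lemma cyl_AE_not:
  assumes D: "finite D" "D \<subseteq> carrier G \<times> carrier G"
    and le: "\<And>n. k \<le> n \<Longrightarrow> freq n (\<lambda>g. Q (rel_at n g \<inter> D)) \<le> C * \<epsilon> n"
  shows "AE x in M. \<not> Q (R x \<inter> D)"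
proof -
  have "emeasure M {x. Q (R x \<inter> D)} = 0"
    using cyl_zero[OF D le] by (simp add: M.emeasure_eq_measure)
  then show ?thesis
    using R_meas[OF D(1)] by (intro AE_I[of _ _ "{x. Q (R x \<inter> D)}"]) auto
qed

lemma shift_pattern:
  assumes "D \<subseteq> carrier G \<times> carrier G" "h \<in> carrier G"
  shows "order_action G h r \<inter> D = {(a, b) \<in> D. (a \<otimes> h, b \<otimes> h) \<in> r \<inter> (\<lambda>(a, b). (a \<otimes> h, b \<otimes> h)) ` D}"
  using assms by (auto simp: order_action_def)

text \<open>The shifted event is a cylinder over the pairs of \<open>D\<close> multiplied by
  \<open>h\<close> from the right. In \<open>X n\<close> the two frequencies differ by at most
  \<open>\<epsilon> n\<close>, so their limits agree.\<close>

lemma cyl_shift: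
  assumes D: "finite D" "D \<subseteq> carrier G \<times> carrier G" and h: "h \<in> carrier G"
  shows "measure M {x. Q (order_action G h (R x) \<inter> D)} = measure M {x. Q (R x \<inter> D)}"
proof -
  let ?D = "(\<lambda>(a, b). (a \<otimes> h, b \<otimes> h)) ` D"
  define Q' where "Q' r = Q {(a, b) \<in> D. (a \<otimes> h, b \<otimes> h) \<in> r}" for r
  have Q': "Q (order_action G h r \<inter> D) = Q' (r \<inter> ?D)" for r
    unfolding Q'_def shift_pattern[OF D(2) h] ..
  have D': "finite ?D" "?D \<subseteq> carrier G \<times> carrier G"
    using D h by auto
  obtain k where k: "\<And>j. k \<le> j \<Longrightarrow> {h, inv h} \<subseteq> E j"
    using in_E_eventually[of "{h, inv h}"] h by auto
  let ?a = "\<lambda>n. freq n (\<lambda>g. Q (rel_at n g \<inter> D))" and ?b = "\<lambda>n. freq n (\<lambda>g. Q' (rel_at n g \<inter> ?D))"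
  have diff: "\<bar>?b n - ?a n\<bar> \<le> \<epsilon> n" if n: "k \<le> n" for n
  proof -
    have "?b n = freq n (\<lambda>g. Q (rel_at n (h \<otimes> g) \<inter> D))"
      using X_set(1) h by (intro freq_cong) (auto simp: Q'[symmetric] rel_at_shift subset_iff)
    then show ?thesis
      using freq_shift_invariant[of h n "\<lambda>g. Q (rel_at n g \<inter> D)"] k[OF n] h by simp
  qed
  have "(\<lambda>n. ?b (s n) - ?a (s n)) \<longlonglongrightarrow> 0"
  proof (rule Lim_null_comparison[OF _ eps_s])
    show "\<forall>\<^sub>F n in sequentially. norm (?b (s n) - ?a (s n)) \<le> \<epsilon> (s n)"
      using diff s_ge order_trans unfolding eventually_sequentially real_norm_def by blast
  qed
  moreover have "(\<lambda>n. ?b (s n) - ?a (s n)) \<longlonglongrightarrow> measure M {x. Q' (R x \<inter> ?D)} - measure M {x. Q (R x \<inter> D)}"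
    by (intro tendsto_diff R_lim D D')
  ultimately have "measure M {x. Q' (R x \<inter> ?D)} - measure M {x. Q (R x \<inter> D)} = 0"
    using LIMSEQ_unique by blast
  then show ?thesis
    unfolding Q' by simp
qed

lemma AE_irrefl: "a \<in> carrier G \<Longrightarrow> AE x in M. (a, a) \<notin> R x"
proof -
  assume a: "a \<in> carrier G"
  have "AE x in M. \<not> (a, a) \<in> R x \<inter> {(a, a)}"
  proof (rule cyl_AE_not[where k = 0 and C = 0])
    show "freq n (\<lambda>g. (a, a) \<in> rel_at n g \<inter> {(a, a)}) \<le> 0 * \<epsilon> n" for n
      using subseq_pair_irrefl[OF X(1)] by (subst freq_zero) (auto simp: rel_at_def)
  qed (use a in auto)
  then show ?thesis
    by simp
qed

lemma AE_trans:
  assumes a: "a \<in> carrier G" "b \<in> carrier G" "c \<in> carrier G"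
  shows "AE x in M. (a, b) \<in> R x \<longrightarrow> (b, c) \<in> R x \<longrightarrow> (a, c) \<in> R x"
proof -
  let ?D = "{(a, b), (b, c), (a, c)}"
  have "AE x in M. \<not> ((a, b) \<in> R x \<inter> ?D \<and> (b, c) \<in> R x \<inter> ?D \<and> (a, c) \<notin> R x \<inter> ?D)"
  proof (rule cyl_AE_not[where k = 0 and C = 0])
    show "freq n (\<lambda>g. (a, b) \<in> rel_at n g \<inter> ?D \<and> (b, c) \<in> rel_at n g \<inter> ?D \<and> (a, c) \<notin> rel_at n g \<inter> ?D) \<le> 0 * \<epsilon> n" for n
    proof -
      have "\<not> ((a, b) \<in> rel_at n g \<inter> ?D \<and> (b, c) \<in> rel_at n g \<inter> ?D \<and> (a, c) \<notin> rel_at n g \<inter> ?D)" for g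
        using subseq_pair_trans[OF X(1)[of n], of "a \<otimes> g" "b \<otimes> g" "c \<otimes> g"] a by (simp add: rel_at_def)
      then show ?thesis
        by (subst freq_zero) auto
    qed
  qed (use a in auto)
  then show ?thesis
    by eventually_elim auto
qed

lemma AE_total:
  assumes a: "a \<in> carrier G" "b \<in> carrier G" "a \<noteq> b"
  shows "AE x in M. (a, b) \<in> R x \<or> (b, a) \<in> R x"
proof -
  let ?D = "{(a, b), (b, a)}"
  obtain k where k: "\<And>j. k \<le> j \<Longrightarrow> {a, b} \<subseteq> E j"
    using in_E_eventually[of "{a, b}"] a by auto
  have "AE x in M. \<not> ((a, b) \<notin> R x \<inter> ?D \<and> (b, a) \<notin> R x \<inter> ?D)"
  proof (rule cyl_AE_not[where k = k and C = 2])
    show "freq n (\<lambda>g. (a, b) \<notin> rel_at n g \<inter> ?D \<and> (b, a) \<notin> rel_at n g \<inter> ?D) \<le> 2 * \<epsilon> n" if "k \<le> n" for n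
      using freq_not_total[of a n b] k[OF that] a(3) by simp
  qed (use a in auto)
  then show ?thesis
    by eventually_elim auto
qed

text \<open>The bound \<open>8 * \<epsilon> k\<close> is the same for all finite parts of the group,
  so by continuity from below it bounds the probability that the interval exceeds
  \<open>tile_bound k\<close> in some finite part. As \<open>k\<close> grows this tends to 0: almost
  surely some level bounds the whole interval.\<close>

lemma AE_finite_interval:
  assumes a: "a \<in> carrier G" "b \<in> carrier G"
  shows "AE x in M. finite {d \<in> carrier G. (a, d) \<in> R x \<and> (d, b) \<in> R x}"
proof -
  define I where "I m x = {d \<in> E m. (a, d) \<in> R x \<and> (d, b) \<in> R x}" for m x
  define A where "A k m = {x. tile_bound k < card (I m x)}" for k m
  have finI: "finite (I m x)" for m x
    using E(1) by (simp add: I_def)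
  have mono: "I m x \<subseteq> I m' x" if "m \<le> m'" for m m' x
    using E(3)[OF that] by (auto simp: I_def)
  have Aeq: "A k m = {x. (\<lambda>r. tile_bound k < card {d \<in> E m. (a, d) \<in> r \<and> (d, b) \<in> r}) (R x \<inter> ({a} \<times> E m \<union> E m \<times> {b}))}" for k m
  proof -
    have "{d \<in> E m. (a, d) \<in> R x \<inter> ({a} \<times> E m \<union> E m \<times> {b}) \<and> (d, b) \<in> R x \<inter> ({a} \<times> E m \<union> E m \<times> {b})} = I m x" for x
      by (auto simp: I_def)
    then show ?thesis
      by (simp add: A_def)
  qed
  have Ameas: "A k m \<in> sets M" for k m
    unfolding Aeq M.events_eq_borel using E(1) by (intro R_meas) auto
  obtain k0 where k0: "\<And>j. k0 \<le> j \<Longrightarrow> {b \<otimes> inv a} \<subseteq> E j"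
    using in_E_eventually[of "{b \<otimes> inv a}"] a by auto
  have le: "measure M (A k m) \<le> 8 * \<epsilon> k" if k: "k0 \<le> k" for k m
    unfolding Aeq
  proof (rule cyl_le[where k = k])
    fix n assume n: "k \<le> n"
    let ?D = "{a} \<times> E m \<union> E m \<times> {b}"
    have "{d \<in> E m. (a, d) \<in> r \<inter> ?D \<and> (d, b) \<in> r \<inter> ?D} = {d \<in> E m. (a, d) \<in> r \<and> (d, b) \<in> r}" for r
      by auto
    then show "freq n (\<lambda>g. tile_bound k < card {d \<in> E m. (a, d) \<in> rel_at n g \<inter> ?D \<and> (d, b) \<in> rel_at n g \<inter> ?D}) \<le> 8 * \<epsilon> k"
      using freq_between[OF a _ n E(1,2), of m] k0[OF k] by simp
  qed (use a E in auto)
  have "measure M (\<Union>m. A k m) \<le> 8 * \<epsilon> k" if k: "k0 \<le> k" for k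
  proof (rule LIMSEQ_le_const2[OF M.finite_Lim_measure_incseq])
    show "range (A k) \<subseteq> sets M"
      using Ameas by auto
    show "incseq (A k)"
    proof (rule incseq_SucI, rule subsetI)
      fix m x assume "x \<in> A k m"
      moreover have "card (I m x) \<le> card (I (Suc m) x)"
        using mono[of m "Suc m"] finI by (intro card_mono) auto
      ultimately show "x \<in> A k (Suc m)"
        by (simp add: A_def)
    qed
    show "\<exists>n. \<forall>m\<ge>n. measure M (A k m) \<le> 8 * \<epsilon> k"
      using le[OF k] by blast
  qed
  moreover have inf_sub: "(\<Inter>k\<in>{k0..}. \<Union>m. A k m) \<subseteq> (\<Union>m. A k m)" if "k0 \<le> k" for k
    using that by blast
  have Bmeas: "(\<Union>m. A k m) \<in> sets M" for k
    using Ameas by auto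
  have Smeas: "(\<Inter>k\<in>{k0..}. \<Union>m. A k m) \<in> sets M"
    using Ameas by (intro sets.countable_INT'') auto
  ultimately have "measure M (\<Inter>k\<in>{k0..}. \<Union>m. A k m) \<le> 8 * \<epsilon> k" if "k0 \<le> k" for k
    using M.finite_measure_mono[OF inf_sub[OF that] Bmeas] that by (meson order_trans)
  then have "measure M (\<Inter>k\<in>{k0..}. \<Union>m. A k m) \<le> 8 * 0"
    by (intro LIMSEQ_le_const[OF tendsto_mult_left[OF eps(4), of 8]]) blast
  then have "emeasure M (\<Inter>k\<in>{k0..}. \<Union>m. A k m) = 0"
    using measure_nonneg[of M] by (simp add: M.emeasure_eq_measure antisym)
  then have "AE x in M. x \<notin> (\<Inter>k\<in>{k0..}. \<Union>m. A k m)"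
    using Smeas by (intro AE_I[of _ _ "\<Inter>k\<in>{k0..}. \<Union>m. A k m"]) auto
  then show ?thesis
  proof eventually_elim
    case (elim x)
    then obtain k where k: "\<And>m. card (I m x) \<le> tile_bound k"
      by (auto simp: A_def not_less)
    have U: "{d \<in> carrier G. (a, d) \<in> R x \<and> (d, b) \<in> R x} = (\<Union>m. I m x)"
      using E(4) E(2) by (auto simp: I_def)
    show ?case
    proof (rule ccontr)
      assume "infinite {d \<in> carrier G. (a, d) \<in> R x \<and> (d, b) \<in> R x}"
      then obtain S where S: "finite S" "card S = Suc (tile_bound k)" "S \<subseteq> (\<Union>m. I m x)"
        unfolding U using infinite_arbitrarily_large by blast
      then have "\<forall>d\<in>S. \<exists>m. d \<in> I m x"
        by blast
      then obtain m where m: "\<And>d. d \<in> S \<Longrightarrow> d \<in> I (m d) x"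
        by metis
      have "S \<subseteq> I (Max (insert 0 (m ` S))) x"
      proof
        fix d assume d: "d \<in> S"
        have "m d \<le> Max (insert 0 (m ` S))"
          using S(1) d by (intro Max_ge) auto
        then show "d \<in> I (Max (insert 0 (m ` S))) x"
          using m[OF d] mono by blast
      qed
      then have "card S \<le> tile_bound k"
        using card_mono[OF finI] k order_trans by blast
      then show False
        using S(2) by simp
    qed
  qed
qed

definition oriented :: "bool \<Rightarrow> 'a rel \<Rightarrow> 'a rel" where
  "oriented d r = (if d then r else r\<inverse>)"

text \<open>By invariance, each of the members of a finite set \<open>A\<close> is the extreme element of \<open>A\<close> with
  probability at least that of \<open>c\<close> being the extreme element of the group.\<close>

lemma AE_not_extreme:
  assumes c: "c \<in> carrier G"
  shows "AE x in M. \<exists>b\<in>carrier G - {c}. (c, b) \<notin> oriented d (R x)"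
proof -
  define ext where "ext A a r \<longleftrightarrow> (\<forall>b\<in>A - {a}. (a, b) \<in> oriented d r)" for A a and r :: "'a rel"
  have ext_cyl: "ext A a (r \<inter> (A \<times> A)) \<longleftrightarrow> ext A a r" if "a \<in> A" for A a r
    using that by (auto simp: ext_def oriented_def)
  have extM: "{x. ext A a (R x)} \<in> sets M" if A: "finite A" "a \<in> A" for A a
    using R_meas[of "A \<times> A" "ext A a"] A ext_cyl[OF A(2)] by simp
  \<comment> \<open>The event that \<open>c\<close> is extreme in the whole group, written as a
    countable intersection of cylinders.\<close>
  define Ec where "Ec = (\<Inter>m\<in>{m. c \<in> E m}. {x. ext (E m) c (R x)})"
  have EcM: "Ec \<in> sets M"
    unfolding Ec_def using extM E(1) E(4) c by (intro sets.countable_INT'') auto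
  have Ec_sub: "Ec \<subseteq> {x. ext A c (R x)}" if A: "finite A" "A \<subseteq> carrier G" "c \<in> A" for A
  proof -
    obtain k where "A \<subseteq> E k"
      using in_E_eventually[OF A(1,2)] by (metis order_refl)
    then show ?thesis
      using A(3) unfolding Ec_def ext_def by blast
  qed
  have bound: "real (card A) * measure M Ec \<le> 1" if A: "finite A" "A \<subseteq> carrier G" for A
  proof -
    have one: "measure M Ec \<le> measure M {x. ext A a (R x)}" if a: "a \<in> A" for a
    proof -
      \<comment> \<open>This shift carries \<open>c\<close> to \<open>a\<close>, and correspondingly
        a set containing \<open>c\<close> to \<open>A\<close>.\<close>
      let ?h = "inv c \<otimes> a"
      let ?A = "rtrans A (inv ?h)"
      have ac: "a \<in> carrier G" and hc: "?h \<in> carrier G"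
        using a A c by auto
      have ch: "c \<otimes> ?h = a"
        using ac c by (simp add: m_assoc[symmetric])
      have cA: "c \<in> ?A"
      proof -
        have "a \<otimes> inv ?h = c"
          using ac c by (simp add: inv_mult_group m_assoc[symmetric])
        then show ?thesis
          using a by (intro image_eqI[of _ _ a]) auto
      qed
      have fA: "finite ?A" "?A \<subseteq> carrier G"
        using A hc by auto
      have "measure M Ec \<le> measure M {x. ext ?A c (R x)}"
        using Ec_sub[OF fA cA] extM[OF fA(1) cA] by (intro M.finite_measure_mono) auto
      also have "\<dots> = measure M {x. ext ?A c (order_action G ?h (R x))}"
      proof -
        have "?A \<times> ?A \<subseteq> carrier G \<times> carrier G"
          using fA(2) by blast
        then show ?thesis
          using cyl_shift[of "?A \<times> ?A" ?h "ext ?A c"] fA(1) hc ext_cyl[OF cA] by simp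
      qed
      also have "\<dots> \<le> measure M {x. ext A a (R x)}"
      proof (rule M.finite_measure_mono[OF _ extM[OF A(1) a]])
        show "{x. ext ?A c (order_action G ?h (R x))} \<subseteq> {x. ext A a (R x)}"
        proof (intro subsetI CollectI)
          fix x assume x: "x \<in> {x. ext ?A c (order_action G ?h (R x))}"
          show "ext A a (R x)"
            unfolding ext_def
          proof
            fix b assume b: "b \<in> A - {a}"
            then have bc: "b \<in> carrier G"
              using A by blast
            have bh: "(b \<otimes> inv ?h) \<otimes> ?h = b"
              using bc hc by (simp add: m_assoc)
            then have "b \<otimes> inv ?h \<noteq> c"
              using b ch by auto
            then have "(c, b \<otimes> inv ?h) \<in> oriented d (order_action G ?h (R x))"
              using x b by (auto simp: ext_def)
            then show "(a, b) \<in> oriented d (R x)"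
              using bh ch by (auto simp: oriented_def order_action_def split: if_splits)
          qed
        qed
      qed
      finally show ?thesis .
    qed
    \<comment> \<open>In each finite order at most one member of \<open>A\<close> is extreme, so the
      frequencies add up to at most 1, and so do their limits.\<close>
    have disj: "(\<Sum>a\<in>A. measure M {x. ext A a (R x)}) \<le> 1"
    proof (rule LIMSEQ_le_const2)
      show "(\<lambda>n. \<Sum>a\<in>A. freq (s n) (\<lambda>g. ext A a (rel_at (s n) g \<inter> (A \<times> A)))) \<longlonglongrightarrow> (\<Sum>a\<in>A. measure M {x. ext A a (R x)})"
      proof (rule tendsto_sum)
        fix a assume a: "a \<in> A"
        show "(\<lambda>n. freq (s n) (\<lambda>g. ext A a (rel_at (s n) g \<inter> (A \<times> A)))) \<longlonglongrightarrow> measure M {x. ext A a (R x)}"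
          using R_lim[of "A \<times> A" "ext A a"] A ext_cyl[OF a] by auto
      qed
      have "(\<Sum>a\<in>A. freq n (\<lambda>g. ext A a (rel_at n g \<inter> (A \<times> A)))) \<le> 1" for n
      proof -
        have uniq: "a = a'" if "a \<in> A" "a' \<in> A" "ext A a (rel_at n g)" "ext A a' (rel_at n g)" for a a' g
        proof (rule ccontr)
          assume "a \<noteq> a'"
          then have "(a, a') \<in> rel_at n g" "(a', a) \<in> rel_at n g"
            using that by (auto simp: ext_def oriented_def split: if_splits)
          then show False
            using subseq_pair_asym[OF X(1)] by (auto simp: rel_at_def)
        qed
        have "(\<Sum>a\<in>A. card {g \<in> set (X n). ext A a (rel_at n g)}) = card (\<Union>a\<in>A. {g \<in> set (X n). ext A a (rel_at n g)})"
          using A uniq by (intro card_UN_disjoint[symmetric]) auto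
        also have "\<dots> \<le> card (set (X n))"
          by (intro card_mono) auto
        finally have "(\<Sum>a\<in>A. card {g \<in> set (X n). ext A a (rel_at n g)}) \<le> length (X n)"
          by (simp add: X_set)
        moreover have "(\<Sum>a\<in>A. freq n (\<lambda>g. ext A a (rel_at n g \<inter> (A \<times> A)))) = real (\<Sum>a\<in>A. card {g \<in> set (X n). ext A a (rel_at n g)}) / real (length (X n))"
          using ext_cyl by (simp add: freq_def sum_divide_distrib[symmetric])
        ultimately show ?thesis
          by (simp add: divide_le_eq X_set(2) del: of_nat_sum)
      qed
      then show "\<exists>k. \<forall>n\<ge>k. (\<Sum>a\<in>A. freq (s n) (\<lambda>g. ext A a (rel_at (s n) g \<inter> (A \<times> A)))) \<le> 1"
        by blast
    qed
    have "real (card A) * measure M Ec = (\<Sum>a\<in>A. measure M Ec)"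
      by simp
    also have "\<dots> \<le> (\<Sum>a\<in>A. measure M {x. ext A a (R x)})"
      by (intro sum_mono one)
    finally show ?thesis
      using disj by linarith
  qed
  have "measure M Ec = 0"
  proof (rule ccontr)
    assume "measure M Ec \<noteq> 0"
    then have pos: "0 < measure M Ec"
      using measure_nonneg[of M Ec] by linarith
    then obtain n :: nat where "1 < real n * measure M Ec"
      using reals_Archimedean3 by blast
    moreover obtain A where "finite A" "card A = n" "A \<subseteq> carrier G"
      using infinite_arbitrarily_large[OF infinite_carrier] by blast
    ultimately show False
      using bound by fastforce
  qed
  then have "AE x in M. x \<notin> Ec"
    using EcM by (intro AE_I[of _ _ Ec]) (auto simp: M.emeasure_eq_measure)
  then show ?thesis
  proof eventually_elim
    case (elim x)
    then obtain m where "c \<in> E m" "\<not> ext (E m) c (R x)"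
      by (auto simp: Ec_def)
    then show ?case
      using E(2)[of m] by (auto simp: ext_def)
  qed
qed

lemma AE_Z_orders: "AE x in M. R x \<in> Z_orders G"
proof -
  note c = countable_carrier
  have "AE x in M. \<forall>a\<in>carrier G. (a, a) \<notin> R x"
    by (rule AE_ball_countable'[OF _ c]) (rule AE_irrefl)
  moreover have "AE x in M. \<forall>a\<in>carrier G. \<forall>b\<in>carrier G. \<forall>d\<in>carrier G. (a, b) \<in> R x \<longrightarrow> (b, d) \<in> R x \<longrightarrow> (a, d) \<in> R x"
    by (intro AE_ball_countable'[OF _ c] AE_trans)
  moreover have "AE x in M. \<forall>a\<in>carrier G. \<forall>b\<in>carrier G. a \<noteq> b \<longrightarrow> (a, b) \<in> R x \<or> (b, a) \<in> R x"
    by (intro AE_ball_countable'[OF _ c] AE_impI AE_total)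
  moreover have "AE x in M. \<forall>a\<in>carrier G. \<forall>b\<in>carrier G. finite {d \<in> carrier G. (a, d) \<in> R x \<and> (d, b) \<in> R x}"
    by (intro AE_ball_countable'[OF _ c] AE_finite_interval)
  moreover have "AE x in M. \<forall>a\<in>carrier G. \<exists>b\<in>carrier G - {a}. (a, b) \<notin> oriented True (R x)"
    by (intro AE_ball_countable'[OF _ c] AE_not_extreme)
  moreover have "AE x in M. \<forall>a\<in>carrier G. \<exists>b\<in>carrier G - {a}. (a, b) \<notin> oriented False (R x)"
    by (intro AE_ball_countable'[OF _ c] AE_not_extreme)
  ultimately show ?thesis
  proof eventually_elim
    case (elim x)
    note R = R_subset[of x]
    have "trans (R x)"
      using elim(2) R by (intro transI) blast
    moreover have "irrefl (R x)"
      using elim(1) R by (auto simp: irrefl_def)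
    moreover have "total_on (carrier G) (R x)"
      using elim(3) by (auto simp: total_on_def)
    moreover have "finite (order_interval G (R x) a b)" if "(a, b) \<in> R x" for a b
      using elim(4) that R unfolding order_interval_def by auto
    moreover have "\<exists>b\<in>carrier G. (b, a) \<in> R x" if a: "a \<in> carrier G" for a
    proof -
      obtain b where "b \<in> carrier G" "b \<noteq> a" "(a, b) \<notin> R x"
        using elim(5) a by (auto simp: oriented_def)
      then show ?thesis
        using elim(3) a by blast
    qed
    moreover have "\<exists>b\<in>carrier G. (a, b) \<in> R x" if a: "a \<in> carrier G" for a
    proof -
      obtain b where "b \<in> carrier G" "b \<noteq> a" "(b, a) \<notin> R x"
        using elim(6) a by (auto simp: oriented_def)
      then show ?thesis
        using elim(3) a by blast
    qed
    ultimately show ?case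
      using R unfolding Z_orders_def strict_linear_order_on_def by blast
  qed
qed

text \<open>\<open>R\<close> takes its values in \<open>Z_orders G\<close> only almost surely. On a
  null set it is replaced by one fixed order, which leaves the probabilities of cylinders unchanged,
  and \<open>\<nu>\<close> is the image law.\<close>

lemma exists_order_measure:
  obtains \<nu> where "prob_space \<nu>" "space \<nu> = Z_orders G" "sets \<nu> = sets (Z_order_space G)"
    "\<And>D Q. finite D \<Longrightarrow> measure \<nu> {r \<in> Z_orders G. Q (r \<inter> D)} = measure M {x. Q (R x \<inter> D)}"
proof -
  obtain Z where "{x \<in> space M. R x \<notin> Z_orders G} \<subseteq> Z" "emeasure M Z = 0" "Z \<in> sets M"
    using AE_E[OF AE_Z_orders] .
  then have Z: "Z \<in> sets M" "emeasure M Z = 0" "\<And>x. x \<notin> Z \<Longrightarrow> R x \<in> Z_orders G"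
    by (auto simp: M.space_eq_univ)
  \<comment> \<open>An order to serve as this default exists because the exceptional null set cannot
    be the whole line.\<close>
  have "\<exists>r0. r0 \<in> Z_orders G"
  proof (rule ccontr)
    assume "\<not> (\<exists>r0. r0 \<in> Z_orders G)"
    then have "Z = UNIV"
      using Z(3) by blast
    then show False
      using Z(2) M.emeasure_space_1 by (simp add: M.space_eq_univ)
  qed
  then obtain r0 where r0: "r0 \<in> Z_orders G"
    by blast
  define R' where "R' x = (if x \<in> Z then r0 else R x)" for x
  have R'Z: "R' x \<in> Z_orders G" for x
    using Z(3) r0 by (simp add: R'_def)
  have cyl: "{x. Q (R' x \<inter> D)} \<in> sets M" if "finite D" for D Q
  proof -
    have "{x. Q (R' x \<inter> D)} = (Z \<inter> {x. Q (r0 \<inter> D)}) \<union> ({x. Q (R x \<inter> D)} - Z)"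
      by (auto simp: R'_def)
    moreover have "Z \<inter> {x. Q (r0 \<inter> D)} \<in> sets M"
      using Z(1) by (cases "Q (r0 \<inter> D)") auto
    ultimately show ?thesis
      using Z(1) R_meas[OF that, of Q] by auto
  qed
  have R'M: "R' \<in> measurable M (Z_order_space G)"
  proof (rule measurable_sigma_sets[OF sets_Z_order_space[OF countable_carrier] order_cylinders_subset])
    show "R' \<in> space M \<rightarrow> Z_orders G"
      using R'Z by simp
    fix A assume "A \<in> order_cylinders G"
    then obtain D Q where A: "A = {r \<in> Z_orders G. Q (r \<inter> D)}" "finite D"
      by (auto simp: order_cylinders_def)
    then have "R' -` A \<inter> space M = {x. Q (R' x \<inter> D)}"
      using R'Z by (auto simp: M.space_eq_univ)
    then show "R' -` A \<inter> space M \<in> sets M"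
      using cyl[OF A(2)] by simp
  qed
  let ?\<nu> = "distr M (Z_order_space G) R'"
  show thesis
  proof (rule that[of ?\<nu>])
    show "prob_space ?\<nu>"
      by (rule M.prob_space_distr[OF R'M])
    fix D Q assume D: "finite (D :: 'a rel)"
    let ?D = "D \<inter> (carrier G \<times> carrier G)"
    have eq: "r \<inter> D = r \<inter> ?D" if "r \<in> Z_orders G" for r
      using Z_orders_subset[OF that] by blast
    have "{r \<in> Z_orders G. Q (r \<inter> D)} = {r \<in> Z_orders G. Q (r \<inter> ?D)}"
      using eq by auto
    also have "\<dots> \<in> order_cylinders G"
      using D by (intro order_cylinderI) auto
    finally have "{r \<in> Z_orders G. Q (r \<inter> D)} \<in> sets (Z_order_space G)"
      unfolding sets_Z_order_space[OF countable_carrier] by (rule sigma_sets.Basic)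
    then have "measure ?\<nu> {r \<in> Z_orders G. Q (r \<inter> D)} = measure M {x. Q (R' x \<inter> D)}"
      using R'Z R'M by (subst measure_distr) (auto simp: vimage_def M.space_eq_univ)
    also have "\<dots> = measure M {x. Q (R x \<inter> D)}"
    proof (rule M.finite_measure_eq_AE)
      have "AE x in M. x \<notin> Z"
        using Z by (intro AE_I[of _ _ Z]) auto
      then show "AE x in M. x \<in> {x. Q (R' x \<inter> D)} \<longleftrightarrow> x \<in> {x. Q (R x \<inter> D)}"
        by eventually_elim (simp add: R'_def)
    qed (use cyl[OF D] R_meas[OF D] in auto)
    finally show "measure ?\<nu> {r \<in> Z_orders G. Q (r \<inter> D)} = measure M {x. Q (R x \<inter> D)}" .
  qed (auto simp: space_Z_order_space)
qed

end

section \<open>Invariance and the uniform Folner property\<close>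

lemma interval_infix:
  assumes "distinct X" "subseq [x, y] X"
  shows "\<exists>P I S. X = P @ I @ S \<and> I = x # tl I \<and>
    (\<forall>z. z \<in> set I \<longleftrightarrow> z = x \<or> z = y \<or> (subseq [x, z] X \<and> subseq [z, y] X))"
proof -
  have xy: "x \<in> set X" "y \<in> set X" "x \<noteq> y"
    using subseq_pair_set[OF assms(2)] subseq_pair_irrefl[OF assms(1), of x] assms(2) by auto
  obtain P Q where PQ: "X = P @ x # Q"
    using split_list[OF xy(1)] by blast
  have yQ: "y \<in> set Q"
  proof (rule ccontr)
    assume "y \<notin> set Q"
    then have "y \<in> set P"
      using xy PQ by auto
    then have "subseq [y, x] X"
      using PQ by (simp add: subseq_pair_append)
    then show False
      using subseq_pair_asym[OF assms] by simp
  qed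
  then obtain Z S where ZS: "Q = Z @ y # S"
    using split_list by metis
  have X: "X = P @ (x # Z @ [y]) @ S"
    using PQ ZS by simp
  have "z \<in> set (x # Z @ [y]) \<longleftrightarrow> z = x \<or> z = y \<or> (subseq [x, z] X \<and> subseq [z, y] X)" for z
  proof
    assume "z \<in> set (x # Z @ [y])"
    then show "z = x \<or> z = y \<or> (subseq [x, z] X \<and> subseq [z, y] X)"
      unfolding X by (auto simp: subseq_pair_append subseq_pair_Cons subseq_singleton_left)
  next
    assume z: "z = x \<or> z = y \<or> (subseq [x, z] X \<and> subseq [z, y] X)"
    then show "z \<in> set (x # Z @ [y])"
      using between_subset_block[OF X assms(1), of x y z] by auto
  qed
  then show ?thesis
    using X by (intro exI[of _ P] exI[of _ "x # Z @ [y]"] exI[of _ S]) simp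
qed

lemma first_leaving:
  assumes "\<exists>z\<in>set I. z \<notin> A" "I = x # J" "x \<in> A"
  obtains I1 w z I2 where "I = I1 @ w # z # I2" "w \<in> A" "z \<notin> A"
proof -
  have "\<exists>I1 w z I2. I = I1 @ w # z # I2 \<and> w \<in> A \<and> z \<notin> A"
    using assms
  proof (induction I arbitrary: x J)
    case (Cons a I)
    then have a: "a = x" "I = J" "x \<in> A" "\<exists>z\<in>set I. z \<notin> A"
      by auto
    then obtain b K where K: "I = b # K"
      by (cases I) auto
    show ?case
    proof (cases "b \<in> A")
      case True
      then obtain I1 w z I2 where "I = I1 @ w # z # I2" "w \<in> A" "z \<notin> A"
        using Cons.IH[OF a(4) K] by blast
      then show ?thesis
        by (intro exI[of _ "a # I1"]) auto
    next
      case False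
      then show ?thesis
        using a K by (intro exI[of _ "[]"]) auto
    qed
  qed simp
  then show thesis
    using that by blast
qed

context group begin

text \<open>\<open>K <#> A\<close> contains a translate of \<open>A\<close> by one
  \<open>g0\<close>, and translates have equal size; so the part of \<open>A\<close> that is missed
  is at most one escape count. The part of \<open>K <#> A\<close> outside \<open>A\<close> is
  bounded by the sum of \<open>card K\<close> escape counts.\<close>

lemma set_invariant_of_escape:
  assumes A: "finite A" "A \<noteq> {}" "A \<subseteq> carrier G" and K: "finite K" "K \<noteq> {}" "K \<subseteq> carrier G"
    and esc: "\<And>g. g \<in> K \<Longrightarrow> real (card (escape g A)) \<le> c" and small: "2 * real (card K) * c < e * real (card A)"
  shows "set_invariant G K e A"
proof -
  have eq: "K <#> A = (\<Union>g\<in>K. (\<lambda>x. g \<otimes> x) ` A)"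
    by (auto simp: set_mult_def)
  have ltr: "card ((\<lambda>x. g \<otimes> x) ` A - A) = card (escape g A)" if g: "g \<in> K" for g
  proof -
    have "(\<lambda>x. g \<otimes> x) ` A - A = (\<lambda>x. g \<otimes> x) ` escape g A"
      by (auto simp: escape_def)
    moreover have "inj_on (\<lambda>x. g \<otimes> x) (escape g A)"
      using g A K escape_subset by (intro inj_on_ltrans) (auto simp: subset_iff)
    ultimately show ?thesis
      by (simp add: card_image)
  qed
  obtain g0 where g0: "g0 \<in> K"
    using K by blast
  have c0: "0 \<le> c"
    using esc[OF g0] by linarith
  have "card (A - (K <#> A)) \<le> card (A - (\<lambda>x. g0 \<otimes> x) ` A)"
    using A g0 unfolding eq by (intro card_mono) auto
  also have "\<dots> = card ((\<lambda>x. g0 \<otimes> x) ` A - A)"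
  proof -
    have "card ((\<lambda>x. g0 \<otimes> x) ` A) = card A"
      using A K g0 by (intro card_image inj_on_ltrans) auto
    then show ?thesis
      using A(1) by (simp add: card_Diff_subset_Int Int_commute)
  qed
  finally have "real (card (A - (K <#> A))) \<le> c"
    using ltr[OF g0] esc[OF g0] by simp
  also have "\<dots> \<le> real (card K) * c"
  proof -
    have "1 \<le> real (card K)"
      using K by (simp add: Suc_leI card_gt_0_iff)
    then show ?thesis
      using mult_right_mono[of 1 "real (card K)" c] c0 by simp
  qed
  finally have 1: "real (card (A - (K <#> A))) \<le> real (card K) * c" .
  have "(K <#> A) - A \<subseteq> (\<Union>g\<in>K. (\<lambda>x. g \<otimes> x) ` A - A)"
    unfolding eq by blast
  then have "card ((K <#> A) - A) \<le> card (\<Union>g\<in>K. (\<lambda>x. g \<otimes> x) ` A - A)"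
    using A K by (intro card_mono) auto
  also have "\<dots> \<le> (\<Sum>g\<in>K. card ((\<lambda>x. g \<otimes> x) ` A - A))"
    by (rule card_UN_le[OF K(1)])
  finally have "real (card ((K <#> A) - A)) \<le> (\<Sum>g\<in>K. real (card ((\<lambda>x. g \<otimes> x) ` A - A)))"
    unfolding of_nat_sum[symmetric] of_nat_le_iff .
  also have "\<dots> \<le> (\<Sum>g\<in>K. c)"
    using ltr esc by (intro sum_mono) auto
  finally have 2: "real (card ((K <#> A) - A)) \<le> real (card K) * c"
    by simp
  have "card (sym_diff A (K <#> A)) \<le> card (A - (K <#> A)) + card ((K <#> A) - A)"
    by (rule card_Un_le)
  then have "real (card (sym_diff A (K <#> A))) < e * real (card A)"
    using 1 2 small by linarith
  then show ?thesis
    using A by (simp add: set_invariant_def divide_less_eq card_gt_0_iff)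
qed

lemma order_action_interval:
  assumes "h \<in> carrier G" "a \<in> carrier G" "b \<in> carrier G"
  shows "order_interval G (order_action G h r) a b = rtrans (order_interval G r (a \<otimes> h) (b \<otimes> h)) (inv h)"
proof (intro equalityI subsetI)
  fix x assume x: "x \<in> order_interval G (order_action G h r) a b"
  then have xc: "x \<in> carrier G"
    using assms by (auto simp: order_interval_def)
  have "x \<otimes> h \<in> order_interval G r (a \<otimes> h) (b \<otimes> h)"
    using x assms by (auto simp: order_interval_def order_action_def)
  moreover have "x = (x \<otimes> h) \<otimes> inv h"
    using xc assms by (simp add: m_assoc)
  ultimately show "x \<in> rtrans (order_interval G r (a \<otimes> h) (b \<otimes> h)) (inv h)"
    by blast
next
  fix x assume "x \<in> rtrans (order_interval G r (a \<otimes> h) (b \<otimes> h)) (inv h)"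
  then obtain y where y: "y \<in> order_interval G r (a \<otimes> h) (b \<otimes> h)" "x = y \<otimes> inv h"
    by blast
  then have yc: "y \<in> carrier G"
    using assms by (auto simp: order_interval_def)
  then have "x \<otimes> h = y" "x \<in> carrier G"
    using y(2) assms by (simp_all add: m_assoc)
  moreover have "y = a \<otimes> h \<Longrightarrow> x = a" "y = b \<otimes> h \<Longrightarrow> x = b"
    using y(2) assms by (simp_all add: m_assoc)
  ultimately show "x \<in> order_interval G (order_action G h r) a b"
    using y(1) assms by (auto simp: order_interval_def order_action_def)
qed

lemma order_action_Z_orders:
  assumes h: "h \<in> carrier G" and r: "r \<in> Z_orders G"
  shows "order_action G h r \<in> Z_orders G"
proof -
  let ?r = "order_action G h r"
  have rr: "r \<subseteq> carrier G \<times> carrier G" "trans r" "irrefl r" "total_on (carrier G) r"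
    "\<And>a b. (a, b) \<in> r \<Longrightarrow> finite (order_interval G r a b)"
    "\<And>a. a \<in> carrier G \<Longrightarrow> \<exists>b\<in>carrier G. (b, a) \<in> r" "\<And>a. a \<in> carrier G \<Longrightarrow> \<exists>b\<in>carrier G. (a, b) \<in> r"
    using r by (auto simp: Z_orders_def strict_linear_order_on_def)
  have "trans ?r"
    using rr(2) unfolding trans_def order_action_def by blast
  moreover have "irrefl ?r"
    using rr(3) unfolding irrefl_def order_action_def by blast
  moreover have "total_on (carrier G) ?r"
  proof (rule total_onI)
    fix a b assume ab: "a \<in> carrier G" "b \<in> carrier G" "a \<noteq> b"
    then have "a \<otimes> h \<noteq> b \<otimes> h"
      using h by simp
    then show "(a, b) \<in> ?r \<or> (b, a) \<in> ?r"
      using rr(4) ab h unfolding total_on_def order_action_def by auto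
  qed
  moreover have "finite (order_interval G ?r a b)" if "(a, b) \<in> ?r" for a b
  proof -
    have "a \<in> carrier G" "b \<in> carrier G" "(a \<otimes> h, b \<otimes> h) \<in> r"
      using that by (auto simp: order_action_def)
    then show ?thesis
      using rr(5) by (simp only: order_action_interval[OF h] finite_imageI)
  qed
  moreover have "\<exists>b\<in>carrier G. (b, a) \<in> ?r" if a: "a \<in> carrier G" for a
  proof -
    obtain c where "c \<in> carrier G" "(c, a \<otimes> h) \<in> r"
      using rr(6) a h by blast
    moreover have "(c \<otimes> inv h) \<otimes> h = c" if "c \<in> carrier G" for c
      using that h by (simp add: m_assoc)
    ultimately show ?thesis
      using a h by (intro bexI[of _ "c \<otimes> inv h"]) (auto simp: order_action_def)
  qed
  moreover have "\<exists>b\<in>carrier G. (a, b) \<in> ?r" if a: "a \<in> carrier G" for a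
  proof -
    obtain c where "c \<in> carrier G" "(a \<otimes> h, c) \<in> r"
      using rr(7) a h by blast
    moreover have "(c \<otimes> inv h) \<otimes> h = c" if "c \<in> carrier G" for c
      using that h by (simp add: m_assoc)
    ultimately show ?thesis
      using a h by (intro bexI[of _ "c \<otimes> inv h"]) (auto simp: order_action_def)
  qed
  moreover have "?r \<subseteq> carrier G \<times> carrier G"
    by (auto simp: order_action_def)
  ultimately show ?thesis
    unfolding Z_orders_def strict_linear_order_on_def by blast
qed

end

lemma Int_stable_order_cylinders: "Int_stable (order_cylinders G)"
proof (rule Int_stableI)
  fix A B assume "A \<in> order_cylinders G" "B \<in> order_cylinders G"
  then obtain D Q D' Q' where A: "A = {r \<in> Z_orders G. Q (r \<inter> D)}" "finite D" "D \<subseteq> carrier G \<times> carrier G"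
    and B: "B = {r \<in> Z_orders G. Q' (r \<inter> D')}" "finite D'" "D' \<subseteq> carrier G \<times> carrier G"
    unfolding order_cylinders_def by blast
  have "r \<inter> (D \<union> D') \<inter> D = r \<inter> D" "r \<inter> (D \<union> D') \<inter> D' = r \<inter> D'" for r
    by auto
  then have "A \<inter> B = {r \<in> Z_orders G. (\<lambda>v. Q (v \<inter> D) \<and> Q' (v \<inter> D')) (r \<inter> (D \<union> D'))}"
    by (auto simp: A(1) B(1))
  then show "A \<inter> B \<in> order_cylinders G"
    using order_cylinderI[of "D \<union> D'" G "\<lambda>v. Q (v \<inter> D) \<and> Q' (v \<inter> D')"] A B by auto
qed

locale order_law = limit_law G E \<epsilon> \<L> N X s M R for G (structure) and E \<epsilon> \<L> N X s M R +
  fixes \<nu> :: "'a rel measure"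
  assumes \<nu>: "prob_space \<nu>" "space \<nu> = Z_orders G" "sets \<nu> = sets (Z_order_space G)"
    and \<nu>_cyl: "\<And>D Q. finite D \<Longrightarrow> measure \<nu> {r \<in> Z_orders G. Q (r \<inter> D)} = measure M {x. Q (R x \<inter> D)}"
begin

sublocale \<nu>: prob_space \<nu>
  by (rule \<nu>)

lemma sets_\<nu>: "sets \<nu> = sigma_sets (Z_orders G) (order_cylinders G)"
  using \<nu>(3) sets_Z_order_space[OF countable_carrier] by simp

lemma cyl_sets: "finite D \<Longrightarrow> {r \<in> Z_orders G. Q (r \<inter> D)} \<in> sets \<nu>"
proof -
  assume D: "finite D"
  have "r \<inter> D = r \<inter> (D \<inter> (carrier G \<times> carrier G))" if "r \<in> Z_orders G" for r
    using Z_orders_subset[OF that] by blast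
  then have "{r \<in> Z_orders G. Q (r \<inter> D)} = {r \<in> Z_orders G. Q (r \<inter> (D \<inter> (carrier G \<times> carrier G)))}"
    by auto
  also have "\<dots> \<in> order_cylinders G"
    using D by (intro order_cylinderI) auto
  finally show ?thesis
    unfolding sets_\<nu> by (rule sigma_sets.Basic)
qed

lemma order_action_measurable:
  assumes h: "h \<in> carrier G"
  shows "order_action G h \<in> measurable \<nu> \<nu>"
proof (rule measurable_sigma_sets[OF sets_\<nu> order_cylinders_subset])
  show "order_action G h \<in> space \<nu> \<rightarrow> Z_orders G"
    using order_action_Z_orders[OF h] \<nu>(2) by auto
  fix A assume "A \<in> order_cylinders G"
  then obtain D Q where A: "A = {r \<in> Z_orders G. Q (r \<inter> D)}" "finite D" "D \<subseteq> carrier G \<times> carrier G"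
    unfolding order_cylinders_def by blast
  let ?D = "(\<lambda>(a, b). (a \<otimes> h, b \<otimes> h)) ` D"
  let ?Q = "\<lambda>v. Q {(a, b) \<in> D. (a \<otimes> h, b \<otimes> h) \<in> v}"
  have "order_action G h -` A \<inter> space \<nu> = {r \<in> Z_orders G. ?Q (r \<inter> ?D)}"
    using order_action_Z_orders[OF h] by (auto simp: A(1) \<nu>(2) shift_pattern[OF A(3) h])
  moreover have "{r \<in> Z_orders G. ?Q (r \<inter> ?D)} \<in> sets \<nu>"
    using A(2) by (intro cyl_sets[of ?D ?Q]) simp
  ultimately show "order_action G h -` A \<inter> space \<nu> \<in> sets \<nu>"
    by (simp only:)
qed

lemma order_action_cyl:
  assumes D: "finite D" "D \<subseteq> carrier G \<times> carrier G" and h: "h \<in> carrier G"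
  shows "measure \<nu> {r \<in> Z_orders G. Q (order_action G h r \<inter> D)} = measure \<nu> {r \<in> Z_orders G. Q (r \<inter> D)}"
proof -
  let ?D = "(\<lambda>(a, b). (a \<otimes> h, b \<otimes> h)) ` D"
  have "measure \<nu> {r \<in> Z_orders G. Q (order_action G h r \<inter> D)} =
      measure \<nu> {r \<in> Z_orders G. (\<lambda>v. Q {(a, b) \<in> D. (a \<otimes> h, b \<otimes> h) \<in> v}) (r \<inter> ?D)}"
    by (simp add: shift_pattern[OF D(2) h])
  also have "\<dots> = measure M {x. Q {(a, b) \<in> D. (a \<otimes> h, b \<otimes> h) \<in> R x \<inter> ?D}}"
    using D by (intro \<nu>_cyl) auto
  also have "\<dots> = measure M {x. Q (order_action G h (R x) \<inter> D)}"
    by (simp add: shift_pattern[OF D(2) h])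
  also have "\<dots> = measure \<nu> {r \<in> Z_orders G. Q (r \<inter> D)}"
    using cyl_shift[OF D h] \<nu>_cyl[OF D(1)] by simp
  finally show ?thesis .
qed

lemma order_action_distr:
  assumes h: "h \<in> carrier G"
  shows "distr \<nu> \<nu> (order_action G h) = \<nu>"
proof (rule measure_eqI_generator_eq[OF Int_stable_order_cylinders[of G] order_cylinders_subset])
  fix A assume "A \<in> order_cylinders G"
  then obtain D Q where A: "A = {r \<in> Z_orders G. Q (r \<inter> D)}" "finite D" "D \<subseteq> carrier G \<times> carrier G"
    unfolding order_cylinders_def by blast
  have "order_action G h -` A \<inter> space \<nu> = {r \<in> Z_orders G. Q (order_action G h r \<inter> D)}"
    using order_action_Z_orders[OF h] by (auto simp: A(1) \<nu>(2))
  then have "measure \<nu> (order_action G h -` A \<inter> space \<nu>) = measure \<nu> A"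
    using order_action_cyl[OF A(2,3) h] by (simp add: A(1))
  moreover have "A \<in> sets \<nu>"
    using cyl_sets A by simp
  ultimately show "emeasure (distr \<nu> \<nu> (order_action G h)) A = emeasure \<nu> A"
    using order_action_measurable[OF h] by (simp add: emeasure_distr \<nu>.emeasure_eq_measure)
next
  show "range (\<lambda>_ :: nat. Z_orders G) \<subseteq> order_cylinders G"
    using order_cylinderI[of "{}" G "\<lambda>_. True"] by auto
  show "emeasure (distr \<nu> \<nu> (order_action G h)) (Z_orders G) \<noteq> \<infinity>" for i :: nat
    using \<nu>.emeasure_space_1 order_action_measurable[OF h] \<nu>(2)
    by (metis \<nu>.prob_space_distr prob_space.emeasure_space_1 space_distr ennreal_one_neq_top infinity_ennreal_def)
qed (auto simp: sets_\<nu>)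

lemma multiorder_\<nu>: "multiorder G \<nu>"
  unfolding multiorder_def using \<nu> order_action_measurable order_action_distr by blast

text \<open>The condition on the number of shapes contains this, as its logarithm is nonnegative. It
  makes the last point of a tile negligible when far neighbours are counted.\<close>

lemma eps_N: "2 \<le> \<epsilon> k * real (N k)"
proof -
  have "1 \<le> card (\<L> k)" "1 \<le> N k"
    using shapes(1,2,4)[of k] by (auto simp: Suc_leI card_gt_0_iff)
  then have "1 * 1 \<le> real (card (\<L> k)) * real (N k)"
    by (intro mult_mono) auto
  then have "0 \<le> ln (real (card (\<L> k)) * real (N k))"
    by simp
  then have "2 / real (N k) \<le> (2 + 4 * ln (real (card (\<L> k)) * real (N k))) / real (N k)"
    by (intro divide_right_mono) auto
  then have "2 / real (N k) \<le> \<epsilon> k"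
    using shapes(5)[of k] by linarith
  then show ?thesis
    using shapes(4)[of k] by (simp add: field_simps)
qed

text \<open>The quotients of two points in a common right translate of a shape of level
  \<open>k\<close>. The next element of the order rarely lies outside this finite set of left
  factors.\<close>

definition neighbourhood :: "nat \<Rightarrow> 'a set" where
  "neighbourhood k = (\<Union>L\<in>\<L> k. \<Union>x\<in>set L. \<Union>y\<in>set L. {x \<otimes> inv y})"

lemma neighbourhood: "finite (neighbourhood k)" "neighbourhood k \<subseteq> carrier G"
  using shapes(1)[of k] shapes(3)[of _ k] unfolding neighbourhood_def by (auto simp: almost_inv_def subset_iff)

definition far :: "nat \<Rightarrow> nat \<Rightarrow> 'a set" where
  "far k n = {x. \<exists>y A B. X n = A @ x # y # B \<and> y \<notin> (\<lambda>d. d \<otimes> x) ` neighbourhood k}"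

lemma far_card:
  assumes "k \<le> n"
  shows "finite (far k n)" "real (card (far k n)) \<le> 9 * \<epsilon> k * real (length (X n))"
proof -
  obtain Ts where Ts: "X n = concat Ts" "\<And>T. T \<in> set Ts \<Longrightarrow> approx_tile (\<L> k) (\<epsilon> k) T \<and> length T \<le> tile_bound k"
    using blocks[OF assms] by blast
  have "far k n \<subseteq> set (X n)"
    by (auto simp: far_def)
  then show "finite (far k n)"
    by (rule finite_subset) simp
  show "real (card (far k n)) \<le> 9 * \<epsilon> k * real (length (X n))"
    unfolding far_def Ts(1)
    by (rule far_neighbours_card[OF _ _ _ shapes(3) eps(1,2) eps_N neighbourhood_def])
      (use Ts X(1)[of n] X_set(1)[of n] in auto)
qed

text \<open>That the interval from \<open>a\<close> to \<open>b\<close> equals \<open>A\<close>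
  depends on all points of the group. Inspecting it only in a finite window \<open>A'\<close> gives
  a cylinder, whose probability can be taken from the finite orders.\<close>

definition interval_event :: "'a \<Rightarrow> 'a \<Rightarrow> 'a set \<Rightarrow> 'a set \<Rightarrow> 'a rel \<Rightarrow> bool" where
  "interval_event a b A A' r \<longleftrightarrow> (a, b) \<in> r \<and>
     (\<forall>x\<in>A'. x \<in> A \<longleftrightarrow> x = a \<or> x = b \<or> ((a, x) \<in> r \<and> (x, b) \<in> r))"

text \<open>If the interval of \<open>rel_at n g\<close> looks like \<open>A\<close> from the neighbourhood of \<open>A\<close> but is not a
  translate of \<open>A\<close>, then leaving the translate inside the interval is a jump to a far element.\<close>

lemma freq_interval_event:
  assumes A: "finite A" "A \<subseteq> carrier G" "a \<in> A" "b \<in> A"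
    and K: "finite K" "K \<noteq> {}" "K \<subseteq> E k"
    and big: "2 * real (card K) * (8 * \<epsilon> k * real (card A) + 2 * real (tile_bound k)) < e * real (card A)"
    and bad: "\<not> set_invariant G K e A" and kn: "k \<le> n" "j \<le> n"
    and A': "A' = A \<union> (\<Union>d\<in>neighbourhood j. \<Union>x\<in>A. {d \<otimes> x})"
  shows "freq n (\<lambda>g. interval_event a b A A' (rel_at n g)) \<le> 9 * real (card A) * \<epsilon> j"
proof -
  have ab: "a \<in> carrier G" "b \<in> carrier G"
    using A by auto
  have A'c: "A' \<subseteq> carrier G"
    using A(2) neighbourhood(2)[of j] unfolding A' by (auto simp: subset_iff)
  obtain Ts where Ts: "X n = concat Ts" "\<And>T. T \<in> set Ts \<Longrightarrow> approx_tile (\<L> k) (\<epsilon> k) T \<and> length T \<le> tile_bound k"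
    using blocks[OF kn(1)] by blast
  have ex: "\<exists>\<alpha>\<in>A. \<alpha> \<otimes> g \<in> far j n" if g: "g \<in> set (X n)" "interval_event a b A A' (rel_at n g)" for g
  proof -
    have gc: "g \<in> carrier G"
      using g X_set(1) by blast
    have rel: "(x, y) \<in> rel_at n g \<longleftrightarrow> subseq [x \<otimes> g, y \<otimes> g] (X n)" if "x \<in> carrier G" "y \<in> carrier G" for x y
      using that by (simp add: rel_at_def)
    have "subseq [a \<otimes> g, b \<otimes> g] (X n)"
      using g(2) rel ab by (simp add: interval_event_def)
    from interval_infix[OF X(1) this] obtain P I S where I: "X n = P @ I @ S" "I = (a \<otimes> g) # tl I"
      "\<And>z. z \<in> set I \<longleftrightarrow> z = a \<otimes> g \<or> z = b \<otimes> g \<or> (subseq [a \<otimes> g, z] (X n) \<and> subseq [z, b \<otimes> g] (X n))"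
      by blast
    have mem: "x \<otimes> g \<in> set I \<longleftrightarrow> x \<in> A" if x: "x \<in> A'" for x
    proof -
      have xc: "x \<in> carrier G"
        using x A'c by blast
      have "x \<in> A \<longleftrightarrow> x = a \<or> x = b \<or> ((a, x) \<in> rel_at n g \<and> (x, b) \<in> rel_at n g)"
        using g(2) x by (simp add: interval_event_def)
      then show ?thesis
        unfolding I(3) using rel ab xc gc by simp
    qed
    have AI: "rtrans A g \<subseteq> set I"
      using mem A' by auto
    \<comment> \<open>Were the interval an exact translate of \<open>A\<close>, the estimate for
      stretches of \<open>X n\<close> would make \<open>A\<close> invariant, against
      \<open>bad\<close>.\<close>
    have "set I \<noteq> rtrans A g"
    proof
      assume eq: "set I = rtrans A g"
      have dI: "distinct I"
        using X(1)[of n] I(1) by simp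
      have lI: "length I = card A"
        using distinct_card[OF dI] eq card_rtrans[OF A(2) gc] by simp
      have "set_invariant G K e A"
      proof (rule set_invariant_of_escape[where c = "8 * \<epsilon> k * real (card A) + 2 * real (tile_bound k)"])
        fix h assume h: "h \<in> K"
        then have hE: "h \<in> E k" "h \<in> carrier G"
          using K E(2) by auto
        have "card (escape h A) = card (escape h (set I))"
          unfolding eq escape_rtrans[OF A(2) gc hE(2)]
          using card_rtrans[OF order_trans[OF escape_subset A(2)] gc] by simp
        also have "real \<dots> \<le> 8 * \<epsilon> k * real (length I) + 2 * real (tile_bound k)"
          by (rule infix_escape[OF _ _ _ Ts(2) shapes(3) eps(1,2) hE])
            (use I(1) Ts(1) X(1)[of n] X_set(1)[of n] in auto)
        finally show "real (card (escape h A)) \<le> 8 * \<epsilon> k * real (card A) + 2 * real (tile_bound k)"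
          by (simp add: lI)
      qed (use A K E(2) big in auto)
      then show False
        using bad by blast
    qed
    then have "\<exists>z\<in>set I. z \<notin> rtrans A g"
      using AI by blast
    moreover have "a \<otimes> g \<in> rtrans A g"
      using A by blast
    ultimately obtain I1 w z I2 where w: "I = I1 @ w # z # I2" "w \<in> rtrans A g" "z \<notin> rtrans A g"
      using first_leaving[OF _ I(2)] by metis
    obtain \<alpha> where \<alpha>: "\<alpha> \<in> A" "w = \<alpha> \<otimes> g"
      using w(2) by blast
    have "z \<notin> (\<lambda>d. d \<otimes> w) ` neighbourhood j"
    proof
      assume "z \<in> (\<lambda>d. d \<otimes> w) ` neighbourhood j"
      then obtain d where d: "d \<in> neighbourhood j" "z = d \<otimes> w"
        by blast
      have zd: "z = (d \<otimes> \<alpha>) \<otimes> g"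
        using d \<alpha> A(2) neighbourhood(2)[of j] gc by (auto simp: m_assoc subset_iff)
      have "d \<otimes> \<alpha> \<in> A'"
        using d(1) \<alpha>(1) unfolding A' by blast
      then have "d \<otimes> \<alpha> \<in> A"
        using mem[of "d \<otimes> \<alpha>"] zd w(1) by simp
      then show False
        using w(3) zd by blast
    qed
    moreover have "X n = (P @ I1) @ w # z # (I2 @ S)"
      using I(1) w(1) by simp
    ultimately have "w \<in> far j n"
      unfolding far_def by blast
    then show ?thesis
      using \<alpha> by blast
  qed
  have "{g \<in> set (X n). interval_event a b A A' (rel_at n g)} \<subseteq> (\<Union>\<alpha>\<in>A. {g \<in> set (X n). \<alpha> \<otimes> g \<in> far j n})"
    using ex by blast
  then have "card {g \<in> set (X n). interval_event a b A A' (rel_at n g)} \<le> card (\<Union>\<alpha>\<in>A. {g \<in> set (X n). \<alpha> \<otimes> g \<in> far j n})"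
    using A(1) by (intro card_mono) auto
  also have "\<dots> \<le> (\<Sum>\<alpha>\<in>A. card {g \<in> set (X n). \<alpha> \<otimes> g \<in> far j n})"
    by (rule card_UN_le[OF A(1)])
  finally have "freq n (\<lambda>g. interval_event a b A A' (rel_at n g)) \<le> (\<Sum>\<alpha>\<in>A. freq n (\<lambda>g. \<alpha> \<otimes> g \<in> far j n))"
    unfolding freq_def sum_divide_distrib[symmetric] of_nat_sum[symmetric] by (intro divide_right_mono of_nat_mono) auto
  also have "\<dots> \<le> (\<Sum>\<alpha>\<in>A. 9 * \<epsilon> j)"
  proof (rule sum_mono)
    fix \<alpha> assume "\<alpha> \<in> A"
    then have "freq n (\<lambda>g. \<alpha> \<otimes> g \<in> far j n) \<le> real (card (far j n)) / real (length (X n))"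
      using A(2) far_card(1)[OF kn(2)] by (intro freq_shift_le) auto
    also have "\<dots> \<le> 9 * \<epsilon> j"
      using far_card(2)[OF kn(2)] X_set(2)[of n] by (simp add: divide_le_eq)
    finally show "freq n (\<lambda>g. \<alpha> \<otimes> g \<in> far j n) \<le> 9 * \<epsilon> j" .
  qed
  also have "\<dots> = 9 * real (card A) * \<epsilon> j"
    by simp
  finally show ?thesis .
qed

text \<open>Two levels are at work. The level \<open>k\<close>, which makes long stretches
  invariant, stays fixed; the level \<open>j\<close>, which measures rare far jumps, tends to
  infinity. An interval equal to \<open>A\<close> satisfies the events of all windows
  \<open>A' j\<close>, whose probabilities are at most
  \<open>9 * card A * \<epsilon> j\<close>.\<close>

lemma AE_not_bad_interval:
  assumes A: "finite A" "A \<subseteq> carrier G" "a \<in> carrier G" "b \<in> carrier G"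
    and K: "finite K" "K \<noteq> {}" "K \<subseteq> E k"
    and big: "2 * real (card K) * (8 * \<epsilon> k * real (card A) + 2 * real (tile_bound k)) < e * real (card A)"
    and bad: "\<not> set_invariant G K e A"
  shows "AE r in \<nu>. (a, b) \<in> r \<longrightarrow> order_interval G r a b \<noteq> A"
proof (cases "a \<in> A \<and> b \<in> A")
  case False
  then show ?thesis
    by (intro AE_I2) (auto simp: order_interval_def)
next
  case True
  define A' where "A' j = A \<union> (\<Union>d\<in>neighbourhood j. \<Union>x\<in>A. {d \<otimes> x})" for j
  have A'f: "finite (A' j)" "A' j \<subseteq> carrier G" "A \<subseteq> A' j" for j
    using A neighbourhood[of j] unfolding A'_def by (auto simp: subset_iff)
  define F where "F j = {r \<in> Z_orders G. interval_event a b A (A' j) (r \<inter> (A' j \<times> A' j))}" for j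
  have Int: "interval_event a b A (A' j) (r \<inter> (A' j \<times> A' j)) \<longleftrightarrow> interval_event a b A (A' j) r" for j r
    using True A'f(3)[of j] by (auto simp: interval_event_def)
  have Fm: "F j \<in> sets \<nu>" for j
    unfolding F_def using A'f by (intro cyl_sets) auto
  have Fle: "measure \<nu> (F j) \<le> 9 * real (card A) * \<epsilon> j" for j
  proof -
    have "measure \<nu> (F j) = measure M {x. interval_event a b A (A' j) (R x \<inter> (A' j \<times> A' j))}"
      unfolding F_def using A'f by (intro \<nu>_cyl) auto
    also have "\<dots> \<le> 9 * real (card A) * \<epsilon> j"
    proof (rule cyl_le[where k = "max k j"])
      fix n assume n: "max k j \<le> n"
      show "freq n (\<lambda>g. interval_event a b A (A' j) (rel_at n g \<inter> (A' j \<times> A' j))) \<le> 9 * real (card A) * \<epsilon> j"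
        unfolding Int using True n
        by (intro freq_interval_event[OF A(1,2) _ _ K big bad]) (auto simp: A'_def)
    qed (use A'f[of j] in auto)
    finally show ?thesis .
  qed
  have "measure \<nu> (\<Inter>j. F j) \<le> 9 * real (card A) * \<epsilon> j" for j
    using \<nu>.finite_measure_mono[of "\<Inter>j. F j" "F j"] Fm Fle[of j] by (meson INT_lower UNIV_I order_trans)
  then have "measure \<nu> (\<Inter>j. F j) \<le> 9 * real (card A) * 0"
    by (intro LIMSEQ_le_const[OF tendsto_mult_left[OF eps(4)]]) auto
  then have "emeasure \<nu> (\<Inter>j. F j) = 0"
    using measure_nonneg[of \<nu>] by (simp add: \<nu>.emeasure_eq_measure antisym)
  moreover have "(\<Inter>j. F j) \<in> sets \<nu>"
    using Fm by auto
  ultimately have "AE r in \<nu>. r \<notin> (\<Inter>j. F j)"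
    by (intro AE_I[of _ _ "\<Inter>j. F j"]) auto
  moreover have "AE r in \<nu>. r \<in> Z_orders G"
    using AE_space[of \<nu>] by (simp add: \<nu>(2))
  ultimately show ?thesis
  proof eventually_elim
    case (elim r)
    then obtain j where j: "\<not> interval_event a b A (A' j) r"
      by (auto simp: F_def Int)
    show ?case
    proof (intro impI notI)
      assume "(a, b) \<in> r" "order_interval G r a b = A"
      then have "interval_event a b A (A' j) r"
        using A'f(2)[of j] by (auto simp: interval_event_def order_interval_def)
      then show False
        using j by blast
    qed
  qed
qed

lemma uniformly_folner_\<nu>: "uniformly_folner G \<nu>"
  unfolding uniformly_folner_def
proof (intro allI impI)
  fix K and e :: real
  assume "finite K \<and> K \<noteq> {} \<and> K \<subseteq> carrier G \<and> 0 < e"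
  then have K: "finite K" "K \<noteq> {}" "K \<subseteq> carrier G" and e: "0 < e"
    by auto
  have cK: "0 < real (card K)"
    using K by (simp add: card_gt_0_iff)
  obtain k1 where k1: "\<And>j. k1 \<le> j \<Longrightarrow> K \<subseteq> E j"
    using in_E_eventually[OF K(1,3)] by blast
  \<comment> \<open>Half of \<open>e\<close> is reserved for each term of \<open>big\<close>: this
    choice gives \<open>16 * card K * \<epsilon> k < e / 2\<close>, and the choice of
    \<open>n\<close> gives \<open>4 * card K * tile_bound k < e / 2 * card A\<close>.\<close>
  obtain k2 where k2: "\<And>j. k2 \<le> j \<Longrightarrow> \<epsilon> j < e / (32 * real (card K))"
    using eps_eventually[of "e / (32 * real (card K))"] e cK by auto
  define k where "k = max k1 k2"
  have kE: "K \<subseteq> E k" and ek: "\<epsilon> k < e / (32 * real (card K))"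
    using k1 k2 by (auto simp: k_def)
  obtain n :: nat where n: "8 * real (card K) * real (tile_bound k) / e < real n"
    using reals_Archimedean2 by blast
  have big: "2 * real (card K) * (8 * \<epsilon> k * real (card A) + 2 * real (tile_bound k)) < e * real (card A)"
    if "n \<le> card A" for A :: "'a set"
  proof -
    have "8 * real (card K) * real (tile_bound k) / e < real (card A)"
      using n that by linarith
    then have 1: "8 * real (card K) * real (tile_bound k) < e * real (card A)"
      using e by (simp add: field_simps)
    have "32 * real (card K) * \<epsilon> k \<le> e"
      using ek cK by (simp add: field_simps)
    then have "32 * real (card K) * \<epsilon> k * real (card A) \<le> e * real (card A)"
      by (intro mult_right_mono) auto
    then show ?thesis
      using 1 by (simp add: algebra_simps)
  qed
  \<comment> \<open>An interval is one of countably many finite sets, so the exceptional null sets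
    for fixed \<open>a\<close>, \<open>b\<close> and \<open>A\<close> can be united.\<close>
  have cF: "countable {A. finite A \<and> A \<subseteq> carrier G}"
    by (rule countable_Collect_finite_subset[OF countable_carrier, simplified conj_commute])
  have "AE r in \<nu>. \<forall>a\<in>carrier G. \<forall>b\<in>carrier G. \<forall>A\<in>{A. finite A \<and> A \<subseteq> carrier G}.
      n \<le> card A \<and> \<not> set_invariant G K e A \<longrightarrow> (a, b) \<in> r \<longrightarrow> order_interval G r a b \<noteq> A"
    by (intro AE_ball_countable'[OF _ countable_carrier] AE_ball_countable'[OF _ cF] AE_impI)
      (rule AE_not_bad_interval[OF _ _ _ _ K(1,2) kE big]; simp)
  moreover have "AE r in \<nu>. r \<in> Z_orders G"
    using AE_space[of \<nu>] by (simp add: \<nu>(2))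
  ultimately have "AE r in \<nu>. \<forall>a b. (a, b) \<in> r \<and> n \<le> card (order_interval G r a b) \<longrightarrow>
           set_invariant G K e (order_interval G r a b)"
  proof eventually_elim
    case (elim r)
    show ?case
    proof (intro allI impI)
      fix a b assume ab: "(a, b) \<in> r \<and> n \<le> card (order_interval G r a b)"
      then have abc: "a \<in> carrier G" "b \<in> carrier G"
        using Z_orders_subset[OF elim(2)] by auto
      have "finite (order_interval G r a b)"
        using elim(2) ab by (simp add: Z_orders_def)
      moreover have "order_interval G r a b \<subseteq> carrier G"
        using abc by (auto simp: order_interval_def)
      ultimately show "set_invariant G K e (order_interval G r a b)"
        using elim(1) ab abc by blast
    qed
  qed
  then show "\<exists>n::nat. AE r in \<nu>. \<forall>a b. (a, b) \<in> r \<and> n \<le> card (order_interval G r a b) \<longrightarrow>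
           set_invariant G K e (order_interval G r a b)"
    by blast
qed

end

section \<open>Entropy\<close>

text \<open>Complements have the same symmetric difference. A countable union is first cut off to a
  finite one, at the cost of half of \<open>\<delta>\<close>, and then approximated term by
  term.\<close>

lemma algebra_approximation:
  assumes fin: "finite_measure M" and alg: "algebra (space M) \<A>" and gen: "sets M = sigma_sets (space M) \<A>"
    and A: "A \<in> sets M" and \<delta>: "0 < (\<delta>::real)"
  shows "\<exists>C\<in>\<A>. measure M (sym_diff A C) < \<delta>"
proof -
  interpret finite_measure M by fact
  interpret alg: algebra "space M" \<A> by fact
  have sub: "\<A> \<subseteq> sets M"
    unfolding gen by auto
  from A have "A \<in> sigma_sets (space M) \<A>"
    by (simp add: gen)
  then have "\<forall>\<delta>>0. \<exists>C\<in>\<A>. measure M (sym_diff A C) < \<delta>"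
  proof induction
    case (Basic a)
    then show ?case
      by (auto intro!: bexI[of _ a])
  next
    case Empty
    then show ?case
      by (auto intro!: bexI[of _ "{}"])
  next
    case (Compl a)
    show ?case
    proof (intro allI impI)
      fix \<delta> :: real assume "0 < \<delta>"
      then obtain C where C: "C \<in> \<A>" "measure M (sym_diff a C) < \<delta>"
        using Compl by blast
      have "a \<subseteq> space M"
        using Compl.hyps sigma_sets_into_sp[OF alg.space_closed] by blast
      moreover have "C \<subseteq> space M"
        using C(1) alg.space_closed by blast
      ultimately have "sym_diff (space M - a) (space M - C) = sym_diff a C"
        by blast
      then show "\<exists>C\<in>\<A>. measure M (sym_diff (space M - a) C) < \<delta>"
        using C by (intro bexI[of _ "space M - C"]) auto
    qed
  next
    case (Union a)
    have am: "a i \<in> sets M" for i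
      using Union.hyps by (simp add: gen)
    show ?case
    proof (intro allI impI)
      fix \<delta> :: real assume \<delta>: "0 < \<delta>"
      have "(\<lambda>n. measure M (\<Union>i<n. a i)) \<longlonglongrightarrow> measure M (\<Union>n. \<Union>i<n. a i)"
        using am by (intro finite_Lim_measure_incseq) (auto simp: incseq_def intro: less_le_trans)
      moreover have "(\<Union>n. \<Union>i<n. a i) = (\<Union>i. a i)"
        by auto
      ultimately have "(\<lambda>n. measure M (\<Union>i<n. a i)) \<longlonglongrightarrow> measure M (\<Union>i. a i)"
        by simp
      then have "eventually (\<lambda>n. measure M (\<Union>i. a i) - \<delta> / 2 < measure M (\<Union>i<n. a i)) sequentially"
        using \<delta> by (intro order_tendstoD) auto
      then obtain n where n: "measure M (\<Union>i. a i) - \<delta> / 2 < measure M (\<Union>i<n. a i)"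
        by (auto simp: eventually_sequentially)
      have "\<forall>i. \<exists>C\<in>\<A>. measure M (sym_diff (a i) C) < \<delta> / (2 * (1 + real n))"
        using Union.IH \<delta> by simp
      then obtain C where C: "\<And>i. C i \<in> \<A>" "\<And>i. measure M (sym_diff (a i) (C i)) < \<delta> / (2 * (1 + real n))"
        by metis
      have Cm: "C i \<in> sets M" for i
        using C(1) sub by blast
      have UC: "(\<Union>i<n. C i) \<in> \<A>"
        using C(1) by (intro alg.finite_UN) auto
      have "sym_diff (\<Union>i. a i) (\<Union>i<n. C i) \<subseteq> ((\<Union>i. a i) - (\<Union>i<n. a i)) \<union> (\<Union>i<n. sym_diff (a i) (C i))"
        by blast
      then have "measure M (sym_diff (\<Union>i. a i) (\<Union>i<n. C i)) \<le>
          measure M (((\<Union>i. a i) - (\<Union>i<n. a i)) \<union> (\<Union>i<n. sym_diff (a i) (C i)))"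
        using am Cm by (intro finite_measure_mono) auto
      also have "\<dots> \<le> measure M ((\<Union>i. a i) - (\<Union>i<n. a i)) + measure M (\<Union>i<n. sym_diff (a i) (C i))"
        using am Cm by (intro measure_Un_le) auto
      also have "measure M ((\<Union>i. a i) - (\<Union>i<n. a i)) = measure M (\<Union>i. a i) - measure M (\<Union>i<n. a i)"
        using am by (intro finite_measure_Diff) auto
      also have "measure M (\<Union>i<n. sym_diff (a i) (C i)) \<le> (\<Sum>i<n. measure M (sym_diff (a i) (C i)))"
        using am Cm by (intro finite_measure_subadditive_finite) auto
      also have "\<dots> \<le> (\<Sum>i<n. \<delta> / (2 * (1 + real n)))"
        using C(2) by (intro sum_mono less_imp_le)
      also have "\<dots> \<le> \<delta> / 2"
        using \<delta> by (simp add: field_simps)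
      finally have "measure M (sym_diff (\<Union>i. a i) (\<Union>i<n. C i)) < \<delta>"
        using n by linarith
      then show "\<exists>C\<in>\<A>. measure M (sym_diff (\<Union>i. a i) C) < \<delta>"
        using UC by blast
    qed
  qed
  then show ?thesis
    using \<delta> by blast
qed

lemma algebra_order_cylinders: "algebra (Z_orders G) (order_cylinders G)"
proof (rule algebra_iff_Int[THEN iffD2], intro conjI ballI)
  show "order_cylinders G \<subseteq> Pow (Z_orders G)"
    by (rule order_cylinders_subset)
  show "{} \<in> order_cylinders G"
    using order_cylinderI[of "{}" G "\<lambda>_. False"] by simp
  show "Z_orders G - A \<in> order_cylinders G" if "A \<in> order_cylinders G" for A
  proof -
    obtain D Q where A: "A = {r \<in> Z_orders G. Q (r \<inter> D)}" "finite D" "D \<subseteq> carrier G \<times> carrier G"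
      using \<open>A \<in> order_cylinders G\<close> unfolding order_cylinders_def by blast
    have "Z_orders G - A = {r \<in> Z_orders G. (\<lambda>v. \<not> Q v) (r \<inter> D)}"
      by (auto simp: A(1))
    then show ?thesis
      using order_cylinderI[OF A(2,3), of "\<lambda>v. \<not> Q v"] by simp
  qed
  show "A \<inter> B \<in> order_cylinders G" if "A \<in> order_cylinders G" "B \<in> order_cylinders G" for A B
    using Int_stable_order_cylinders that by (auto simp: Int_stable_def)
qed

definition part_of :: "'x set set \<Rightarrow> 'x \<Rightarrow> 'x set" where
  "part_of P x = (THE A. A \<in> P \<and> x \<in> A)"

lemma part_of:
  assumes "partition_on S P" "x \<in> S"
  shows "part_of P x \<in> P" "x \<in> part_of P x" "A \<in> P \<Longrightarrow> x \<in> A \<longleftrightarrow> part_of P x = A"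
proof -
  have "\<exists>!A. A \<in> P \<and> x \<in> A"
  proof (rule ex_ex1I)
    show "\<exists>A. A \<in> P \<and> x \<in> A"
      using assms partition_onD1 by blast
    show "A = B" if "A \<in> P \<and> x \<in> A" "B \<in> P \<and> x \<in> B" for A B
      using disjointD[OF partition_onD2[OF assms(1)], of A B] that by blast
  qed
  then have *: "part_of P x \<in> P \<and> x \<in> part_of P x"
    unfolding part_of_def by (rule theI')
  then show "part_of P x \<in> P" "x \<in> part_of P x"
    by auto
  show "x \<in> A \<longleftrightarrow> part_of P x = A" if "A \<in> P"
    using * that \<open>\<exists>!A. A \<in> P \<and> x \<in> A\<close> by metis
qed

context prob_space begin

text \<open>A point determines the word over the alphabet \<open>P\<close> that lists the parts it
  visits under \<open>W\<close>. The cells of the join correspond to the words that occur, so its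
  entropy is that of a random word and can be estimated by coding.\<close>

lemma partition_join_cells:
  assumes P: "finite_measurable_partition M P" and W: "finite W" "W \<noteq> {}"
    and act: "\<And>h. h \<in> W \<Longrightarrow> act h \<in> measurable M M"
  defines "cell \<equiv> \<lambda>u. {r \<in> space M. \<forall>h\<in>W. part_of P (act h r) = u h}"
  defines "U \<equiv> {u \<in> W \<rightarrow>\<^sub>E P. cell u \<noteq> {}}"
  shows "partition_join M act W P = cell ` U" "inj_on cell U" "finite U" "cell u \<in> sets M" "(\<Sum>u\<in>U. prob (cell u)) = 1"
proof -
  have Pp: "finite P" "P \<subseteq> sets M" "partition_on (space M) P"
    using P by (auto simp: finite_measurable_partition_def)
  have act_sp: "act h r \<in> space M" if "h \<in> W" "r \<in> space M" for h r
    using measurable_space[OF act] that by blast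
  have uP: "(\<lambda>h\<in>W. part_of P (act h r)) \<in> U \<and> r \<in> cell (\<lambda>h\<in>W. part_of P (act h r))" if r: "r \<in> space M" for r
    using part_of(1)[OF Pp(3) act_sp] r by (auto simp: U_def cell_def)
  show inj: "inj_on cell U"
  proof (rule inj_onI)
    fix u v assume uv: "u \<in> U" "v \<in> U" "cell u = cell v"
    then obtain r where "r \<in> cell u" "r \<in> cell v"
      by (auto simp: U_def)
    then have "u h = v h" if "h \<in> W" for h
      using that by (simp add: cell_def)
    then show "u = v"
      using uv by (intro PiE_ext[of u W "\<lambda>_. P" v]) (auto simp: U_def)
  qed
  show finU: "finite U"
    unfolding U_def using W(1) Pp(1) by (intro finite_subset[OF _ finite_PiE[of W "\<lambda>_. P"]]) auto
  show cm: "cell u \<in> sets M" for u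
  proof -
    have "{r \<in> space M. part_of P (act h r) = u h} \<in> sets M" if h: "h \<in> W" for h
    proof (cases "u h \<in> P")
      case True
      then have "{r \<in> space M. part_of P (act h r) = u h} = act h -` u h \<inter> space M"
        using part_of(3)[OF Pp(3) act_sp[OF h] True] by auto
      then show ?thesis
        using measurable_sets[OF act[OF h]] True Pp(2) by auto
    next
      case False
      then have "part_of P (act h r) \<noteq> u h" if "r \<in> space M" for r
        using part_of(1)[OF Pp(3) act_sp[OF h that]] by metis
      then have "{r \<in> space M. part_of P (act h r) = u h} = {}"
        by blast
      then show ?thesis
        by (simp only: sets.empty_sets)
    qed
    then show ?thesis
      unfolding cell_def by (intro sets.sets_Collect_finite_All W) auto
  qed
  show "(\<Sum>u\<in>U. prob (cell u)) = 1"
  proof -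
    have "(\<Sum>u\<in>U. prob (cell u)) = prob (\<Union>u\<in>U. cell u)"
    proof (rule finite_measure_finite_Union[symmetric, OF finU])
      show "disjoint_family_on cell U"
        unfolding disjoint_family_on_def
      proof (intro ballI impI)
        fix u v assume uv: "u \<in> U" "v \<in> U" "u \<noteq> v"
        show "cell u \<inter> cell v = {}"
        proof (rule ccontr)
          assume "cell u \<inter> cell v \<noteq> {}"
          then obtain r where "r \<in> cell u" "r \<in> cell v"
            by blast
          then have "cell u = cell v"
            by (auto simp: cell_def)
          then show False
            using inj uv by (auto dest: inj_onD)
        qed
      qed
    qed (use cm in auto)
    also have "(\<Union>u\<in>U. cell u) = space M"
    proof (intro equalityI subsetI)
      fix r assume "r \<in> space M"
      then show "r \<in> (\<Union>u\<in>U. cell u)"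
        using uP by blast
    qed (auto simp: cell_def)
    finally show ?thesis
      by (simp add: prob_space)
  qed
  let ?\<P> = "(\<lambda>g. partition_preimage M (act g) P) ` W"
  have pre: "A = {r' \<in> space M. part_of P (act h r') = part_of P (act h r)}"
    if pA: "h \<in> W" "A \<in> partition_preimage M (act h) P" "r \<in> A" for A h r
  proof -
    obtain B where B: "B \<in> P" "A = act h -` B \<inter> space M"
      using pA(2) by (auto simp: partition_preimage_def)
    have r: "r \<in> space M" "part_of P (act h r) = B"
      using pA(3) part_of(3)[OF Pp(3) act_sp[OF pA(1)] B(1)] by (auto simp: B(2))
    show ?thesis
      unfolding r(2) using part_of(3)[OF Pp(3) act_sp[OF pA(1)] B(1)] by (auto simp: B(2))
  qed
  have mem: "A = cell (\<lambda>h\<in>W. part_of P (act h r))" if A: "A \<in> partition_join M act W P" "r \<in> A" for A r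
  proof -
    obtain f where f: "f \<in> (\<Pi> P\<in>?\<P>. P)" "A = \<Inter> (f ` ?\<P>)"
      using A(1) unfolding partition_join_def common_refinement by blast
    have "f (partition_preimage M (act h) P) = {r' \<in> space M. part_of P (act h r') = part_of P (act h r)}" if h: "h \<in> W" for h
      using pre[OF h] f A(2) h by auto
    then have "A = (\<Inter>h\<in>W. {r' \<in> space M. part_of P (act h r') = part_of P (act h r)})"
      unfolding f(2) by auto
    also have "\<dots> = cell (\<lambda>h\<in>W. part_of P (act h r))"
      using W(2) by (auto simp: cell_def)
    finally show ?thesis .
  qed
  have cover: "\<exists>A\<in>partition_join M act W P. r \<in> A" if r: "r \<in> space M" for r
  proof -
    have "r \<in> \<Union> (partition_preimage M (act h) P)" if h: "h \<in> W" for h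
      using part_of(1,2)[OF Pp(3) act_sp[OF h r]] r unfolding partition_preimage_def by blast
    then have "r \<in> \<Union> (common_refinement ?\<P>)"
      unfolding Union_common_refinement by blast
    then show ?thesis
      by (auto simp: partition_join_def)
  qed
  have sub: "A \<subseteq> space M" if "A \<in> partition_join M act W P" for A
    using mem[OF that] by (auto simp: cell_def)
  show "partition_join M act W P = cell ` U"
  proof (intro equalityI subsetI)
    fix A assume A: "A \<in> partition_join M act W P"
    then have "A \<noteq> {}"
      by (auto simp: partition_join_def common_refinement_def)
    then obtain r where "r \<in> A"
      by blast
    then show "A \<in> cell ` U"
      using mem[OF A] uP sub[OF A] by blast
  next
    fix A assume "A \<in> cell ` U"
    then obtain u where u: "u \<in> U" "A = cell u"
      by blast
    then obtain r where r: "r \<in> cell u"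
      by (auto simp: U_def)
    then have "r \<in> space M"
      by (simp add: cell_def)
    then obtain B where B: "B \<in> partition_join M act W P" "r \<in> B"
      using cover by blast
    have "cell (\<lambda>h\<in>W. part_of P (act h r)) = cell u"
      using r by (auto simp: cell_def)
    then show "A \<in> partition_join M act W P"
      using mem[OF B] B(1) u(2) by simp
  qed
qed

end

context order_law
begin

text \<open>Each part is close to a cylinder. Outside the symmetric differences exactly one of the
  cylinder conditions holds, that of the part containing the point, so the choice in
  \<open>\<phi>\<close> returns this part.\<close>

lemma partition_approximation:
  assumes P: "finite_measurable_partition \<nu> P" and \<delta>: "0 < \<delta>"
  obtains D \<phi> where "finite D" "D \<subseteq> carrier G \<times> carrier G"
    "{r \<in> Z_orders G. part_of P r \<noteq> \<phi> (r \<inter> D)} \<in> sets \<nu>"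
    "measure \<nu> {r \<in> Z_orders G. part_of P r \<noteq> \<phi> (r \<inter> D)} \<le> \<delta>"
proof -
  have Pp: "finite P" "P \<subseteq> sets \<nu>" "partition_on (Z_orders G) P"
    using P \<nu>(2) by (auto simp: finite_measurable_partition_def)
  define d where "d = \<delta> / (1 + real (card P))"
  have d: "0 < d"
    using \<delta> by (simp add: d_def)
  have "\<exists>C\<in>order_cylinders G. measure \<nu> (sym_diff A C) < d" if "A \<in> P" for A
    using algebra_approximation[of \<nu> "order_cylinders G" A d] \<nu>.finite_measure_axioms algebra_order_cylinders[of G]
      sets_\<nu> \<nu>(2) that Pp(2) d by auto
  then have ex: "\<forall>A\<in>P. \<exists>D Q. finite D \<and> D \<subseteq> carrier G \<times> carrier G \<and> measure \<nu> (sym_diff A {r \<in> Z_orders G. Q (r \<inter> D)}) < d"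
  proof (intro ballI)
    fix A assume "A \<in> P"
    then obtain C where C: "C \<in> order_cylinders G" "measure \<nu> (sym_diff A C) < d"
      using \<open>\<And>A. A \<in> P \<Longrightarrow> \<exists>C\<in>order_cylinders G. measure \<nu> (sym_diff A C) < d\<close> by blast
    then obtain D Q where "C = {r \<in> Z_orders G. Q (r \<inter> D)}" "finite D" "D \<subseteq> carrier G \<times> carrier G"
      unfolding order_cylinders_def by blast
    then show "\<exists>D Q. finite D \<and> D \<subseteq> carrier G \<times> carrier G \<and> measure \<nu> (sym_diff A {r \<in> Z_orders G. Q (r \<inter> D)}) < d"
      using C(2) by blast
  qed
  from bchoice[OF ex] obtain DA where DA':
    "\<forall>A\<in>P. \<exists>Q. finite (DA A) \<and> DA A \<subseteq> carrier G \<times> carrier G \<and> measure \<nu> (sym_diff A {r \<in> Z_orders G. Q (r \<inter> DA A)}) < d"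
    by blast
  from bchoice[OF DA'] obtain QA where DA: "\<And>A. A \<in> P \<Longrightarrow> finite (DA A) \<and> DA A \<subseteq> carrier G \<times> carrier G"
    "\<And>A. A \<in> P \<Longrightarrow> measure \<nu> (sym_diff A {r \<in> Z_orders G. QA A (r \<inter> DA A)}) < d"
    by blast
  define D where "D = (\<Union>A\<in>P. DA A)"
  define \<phi> where "\<phi> v = (SOME A. A \<in> P \<and> QA A (v \<inter> DA A))" for v
  have D: "finite D" "D \<subseteq> carrier G \<times> carrier G"
    using Pp(1) DA(1) by (auto simp: D_def)
  have DD: "r \<inter> D \<inter> DA A = r \<inter> DA A" if "A \<in> P" for A r
    using that by (auto simp: D_def)
  let ?Bad = "{r \<in> Z_orders G. part_of P r \<noteq> \<phi> (r \<inter> D)}"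
  let ?S = "\<lambda>A. sym_diff A {r \<in> Z_orders G. QA A (r \<inter> DA A)}"
  have "?Bad \<subseteq> (\<Union>A\<in>P. ?S A)"
  proof
    fix r assume r: "r \<in> ?Bad"
    show "r \<in> (\<Union>A\<in>P. ?S A)"
    proof (rule ccontr)
      assume not: "r \<notin> (\<Union>A\<in>P. ?S A)"
      then have "A \<in> P \<and> QA A (r \<inter> D \<inter> DA A) \<longleftrightarrow> A = part_of P r" for A
      proof (cases "A \<in> P")
        case True
        then have "QA A (r \<inter> DA A) \<longleftrightarrow> r \<in> A"
          using not r by blast
        then show ?thesis
          using DD[OF True] part_of(3)[OF Pp(3) _ True] r True by auto
      next
        case False
        then show ?thesis
          using part_of(1)[OF Pp(3)] r by blast
      qed
      then have "\<phi> (r \<inter> D) = part_of P r"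
        unfolding \<phi>_def by simp
      then show False
        using r by simp
    qed
  qed
  moreover have Sm: "?S A \<in> sets \<nu>" if "A \<in> P" for A
    using Pp(2) that cyl_sets[of "DA A" "QA A"] DA(1)[OF that] by auto
  ultimately have "measure \<nu> ?Bad \<le> measure \<nu> (\<Union>A\<in>P. ?S A)"
    using Pp(1) by (intro \<nu>.finite_measure_mono) auto
  also have "\<dots> \<le> (\<Sum>A\<in>P. measure \<nu> (?S A))"
    using Sm Pp(1) by (intro \<nu>.finite_measure_subadditive_finite) auto
  also have "\<dots> \<le> (\<Sum>A\<in>P. d)"
    using DA(2) by (intro sum_mono less_imp_le)
  also have "\<dots> \<le> \<delta>"
    using \<delta> by (simp add: d_def field_simps)
  finally have "measure \<nu> ?Bad \<le> \<delta>" .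
  moreover have "?Bad \<in> sets \<nu>"
  proof -
    have "?Bad = Z_orders G - (\<Union>A\<in>P. A \<inter> {r \<in> Z_orders G. (\<lambda>v. \<phi> v = A) (r \<inter> D)})"
    proof -
      have "part_of P r \<noteq> \<phi> (r \<inter> D) \<longleftrightarrow> \<not> (\<exists>A\<in>P. r \<in> A \<and> \<phi> (r \<inter> D) = A)" if "r \<in> Z_orders G" for r
        using part_of[OF Pp(3) that] by metis
      then show ?thesis
        by blast
    qed
    moreover have "A \<inter> {r \<in> Z_orders G. (\<lambda>v. \<phi> v = A) (r \<inter> D)} \<in> sets \<nu>" if "A \<in> P" for A
      using Pp(2) that by (intro sets.Int cyl_sets D) auto
    then have "(\<Union>A\<in>P. A \<inter> {r \<in> Z_orders G. (\<lambda>v. \<phi> v = A) (r \<inter> D)}) \<in> sets \<nu>"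
      using Pp(1) by (intro sets.finite_UN)
    moreover have "Z_orders G \<in> sets \<nu>"
      using sets.top[of \<nu>] \<nu>(2) by simp
    ultimately show ?thesis
      by (simp only: sets.Diff)
  qed
  ultimately show thesis
    using that D by blast
qed

text \<open>A function of the restriction to \<open>D\<close> takes finitely many values. Its
  expectation is a finite combination of probabilities of cylinders, so bounds for averages over
  \<open>X n\<close> survive in the limit.\<close>

lemma cyl_expectation_le:
  assumes D: "finite D" "D \<subseteq> carrier G \<times> carrier G"
    and le: "\<And>n. k \<le> n \<Longrightarrow> (\<Sum>g\<in>set (X n). f (rel_at n g \<inter> D)) \<le> c * real (length (X n))"
  shows "(\<Sum>V\<in>Pow D. f V * measure \<nu> {r \<in> Z_orders G. r \<inter> D = V}) \<le> c"
proof (rule LIMSEQ_le_const2)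
  show "(\<lambda>n. \<Sum>V\<in>Pow D. f V * freq (s n) (\<lambda>g. rel_at (s n) g \<inter> D = V)) \<longlonglongrightarrow>
     (\<Sum>V\<in>Pow D. f V * measure \<nu> {r \<in> Z_orders G. r \<inter> D = V})"
    unfolding \<nu>_cyl[OF D(1), of "\<lambda>v. v = _"]
    by (intro tendsto_sum tendsto_mult_left R_lim[OF D, of "\<lambda>v. v = _"])
  have "(\<Sum>V\<in>Pow D. f V * freq n (\<lambda>g. rel_at n g \<inter> D = V)) \<le> c" if n: "k \<le> n" for n
  proof -
    have "(\<Sum>V\<in>Pow D. f V * freq n (\<lambda>g. rel_at n g \<inter> D = V)) =
        (\<Sum>V\<in>Pow D. \<Sum>g\<in>{g \<in> set (X n). rel_at n g \<inter> D = V}. f (rel_at n g \<inter> D)) / real (length (X n))"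
      unfolding freq_def sum_divide_distrib by (intro sum.cong) auto
    also have "(\<Sum>V\<in>Pow D. \<Sum>g\<in>{g \<in> set (X n). rel_at n g \<inter> D = V}. f (rel_at n g \<inter> D)) = (\<Sum>g\<in>set (X n). f (rel_at n g \<inter> D))"
      using D(1) by (intro sum.group) auto
    finally show ?thesis
      using le[OF n] X_set(2)[of n] by (simp add: divide_le_eq)
  qed
  then show "\<exists>K. \<forall>n\<ge>K. (\<Sum>V\<in>Pow D. f V * freq (s n) (\<lambda>g. rel_at (s n) g \<inter> D = V)) \<le> c"
    using s_ge order_trans by blast
qed

lemma order_pattern_rel_at:
  assumes "D \<subseteq> carrier G \<times> carrier G" "h \<in> carrier G" "g \<in> carrier G"
  shows "order_pattern D (X n) (h \<otimes> g) = order_action G h (rel_at n g) \<inter> D"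
  using assms unfolding rel_at_shift[OF assms(2,3), symmetric] by (auto simp: order_pattern_def rel_at_def)

text \<open>The prediction errors are counted in the finite windows \<open>X n\<close>, where the code of the level
  \<open>k\<close> tiles is available, and the best code is then a function of finitely many coordinates.\<close>

lemma expected_errors:
  fixes \<phi> :: "'a rel \<Rightarrow> 'l"
  assumes W: "finite W" "W \<subseteq> carrier G" "W \<noteq> {}"
    and V: "V = (\<Union>L\<in>\<L> k. \<Union>x\<in>set L. \<Union>y\<in>set L. \<Union>w\<in>W. {(x \<otimes> inv y) \<otimes> w})" "card V \<le> 2 * card W"
    and U: "U = (\<Union>L\<in>\<L> k. \<Union>x\<in>set L. \<Union>w\<in>W. {inv x \<otimes> w})"
    and D: "D \<subseteq> D' \<times> D'" "D' \<subseteq> E k" "finite D'"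
  defines "\<Psi> \<equiv> decode_pattern D \<phi> ` {S. S \<subseteq> \<L> k \<times> U \<and> real (N k) * real (card S) \<le> 4 * real (card W)}"
  defines "err \<equiv> \<lambda>y. Min ((\<lambda>\<psi>. card {h \<in> W. y h \<noteq> \<psi> h}) ` \<Psi>)"
  defines "DW \<equiv> (\<Union>h\<in>W. (\<lambda>(a, b). (a \<otimes> h, b \<otimes> h)) ` D)"
  defines "y \<equiv> \<lambda>v h. \<phi> {(a, b) \<in> D. (a \<otimes> h, b \<otimes> h) \<in> v}"
  shows "(\<Sum>v\<in>Pow DW. real (err (y v)) * measure \<nu> {r \<in> Z_orders G. r \<inter> DW = v}) \<le>
      (7 + 4 * real (card D')) * \<epsilon> k * real (card W)"
    and "finite \<Psi>" "\<Psi> \<noteq> {}"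
proof -
  have D'c: "D' \<subseteq> carrier G" and Dc: "D \<subseteq> carrier G \<times> carrier G"
    using D E(2)[of k] by auto
  have Df: "finite D"
    using D finite_subset by blast
  have Uf: "finite U"
    unfolding U using shapes(1) W by auto
  show fin: "finite \<Psi>"
    unfolding \<Psi>_def using shapes(1) Uf by auto
  show ne: "\<Psi> \<noteq> {}"
    unfolding \<Psi>_def by (auto intro!: exI[of _ "{}"])
  have DW: "finite DW" "DW \<subseteq> carrier G \<times> carrier G"
    using W Df Dc by (auto simp: DW_def)
  obtain k1 where k1: "\<And>j. k1 \<le> j \<Longrightarrow> W \<subseteq> E j"
    using in_E_eventually[OF W(1,2)] by blast
  show "(\<Sum>v\<in>Pow DW. real (err (y v)) * measure \<nu> {r \<in> Z_orders G. r \<inter> DW = v}) \<le>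
      (7 + 4 * real (card D')) * \<epsilon> k * real (card W)"
  proof (rule cyl_expectation_le[OF DW, where k = "max k k1"])
    fix n assume n: "max k k1 \<le> n"
    have kn: "k \<le> n"
      using n by simp
    obtain Ts where Ts: "X n = concat Ts" "\<And>T. T \<in> set Ts \<Longrightarrow> approx_tile (\<L> k) (\<epsilon> k) T"
      using blocks[OF kn] by metis
    obtain \<Gamma> where \<Gamma>: "real (card (set (X n) - \<Gamma>)) \<le> (6 + 4 * real (card D')) * \<epsilon> k * real (length (X n))"
      "\<And>g. g \<in> carrier G \<Longrightarrow> \<exists>S. S \<subseteq> \<L> k \<times> U \<and> real (N k) * real (card S) \<le> 4 * real (card W) \<and>
         (\<forall>h\<in>W. h \<otimes> g \<in> \<Gamma> \<longrightarrow> \<phi> (order_pattern D (X n) (h \<otimes> g)) = decode_pattern D \<phi> S h)"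
      using tile_code[OF shapes(1,3,4) eps(1,2) W(1,2) V U D(1,2) D'c D(3), of Ts \<phi>] Ts X(1)[of n] X_set(1)[of n]
      by metis
    have yv: "y (rel_at n g \<inter> DW) h = \<phi> (order_pattern D (X n) (h \<otimes> g))" if "g \<in> set (X n)" "h \<in> W" for g h
    proof -
      have "{(a, b) \<in> D. (a \<otimes> h, b \<otimes> h) \<in> rel_at n g \<inter> DW} = order_action G h (rel_at n g) \<inter> D"
        using that W(2) Dc by (auto simp: DW_def order_action_def)
      then show ?thesis
        unfolding y_def using order_pattern_rel_at[OF Dc] that W(2) X_set(1)[of n] by (metis subsetD)
    qed
    \<comment> \<open>The code of the tiles around \<open>g\<close> competes in the minimum that
      defines \<open>err\<close>, and it can fail only where \<open>h \<otimes> g\<close> misses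
      \<open>\<Gamma>\<close>.\<close>
    have one: "err (y (rel_at n g \<inter> DW)) \<le> card {h \<in> W. h \<otimes> g \<notin> \<Gamma>}" if g: "g \<in> set (X n)" for g
    proof -
      have "g \<in> carrier G"
        using g X_set(1) by blast
      from \<Gamma>(2)[OF this] obtain S where S: "S \<subseteq> \<L> k \<times> U" "real (N k) * real (card S) \<le> 4 * real (card W)"
        "\<forall>h\<in>W. h \<otimes> g \<in> \<Gamma> \<longrightarrow> \<phi> (order_pattern D (X n) (h \<otimes> g)) = decode_pattern D \<phi> S h"
        by (elim exE conjE)
      have "err (y (rel_at n g \<inter> DW)) \<le> card {h \<in> W. y (rel_at n g \<inter> DW) h \<noteq> decode_pattern D \<phi> S h}"
        unfolding err_def using fin S(1,2) by (intro Min_le) (auto simp: \<Psi>_def)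
      also have "\<dots> \<le> card {h \<in> W. h \<otimes> g \<notin> \<Gamma>}"
        using W(1) S(3) yv[OF g] by (intro card_mono) auto
      finally show ?thesis .
    qed
    have "(\<Sum>g\<in>set (X n). real (err (y (rel_at n g \<inter> DW)))) \<le> (\<Sum>g\<in>set (X n). real (card {h \<in> W. h \<otimes> g \<notin> \<Gamma>}))"
      by (intro sum_mono of_nat_mono one)
    also have "\<dots> = (\<Sum>g\<in>set (X n). \<Sum>h\<in>W. of_bool (h \<otimes> g \<notin> \<Gamma>))"
      using W(1) by (intro sum.cong) (auto simp: sum.inter_filter[symmetric] of_bool_def)
    also have "\<dots> = (\<Sum>h\<in>W. \<Sum>g\<in>set (X n). of_bool (h \<otimes> g \<notin> \<Gamma>))"
      by (rule sum.swap)
    also have "\<dots> = (\<Sum>h\<in>W. freq n (\<lambda>g. h \<otimes> g \<notin> \<Gamma>) * real (length (X n)))"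
      using X_set(2)[of n] by (intro sum.cong) (auto simp: freq_def sum.inter_filter[symmetric] of_bool_def)
    also have "\<dots> \<le> (\<Sum>h\<in>W. ((7 + 4 * real (card D')) * \<epsilon> k) * real (length (X n)))"
    proof (intro sum_mono mult_right_mono)
      fix h assume h: "h \<in> W"
      then have hE: "h \<in> E n" "h \<in> carrier G"
        using k1[of n] n W(2) by auto
      \<comment> \<open>The shifted point may have left \<open>X n\<close>, with frequency at most
        \<open>\<epsilon> n\<close>, or it is one of the bad points of the list; the first
        possibility raises the constant from 6 to 7.\<close>
      have "freq n (\<lambda>g. h \<otimes> g \<notin> \<Gamma>) \<le> freq n (\<lambda>g. h \<otimes> g \<notin> set (X n) \<or> h \<otimes> g \<in> set (X n) - \<Gamma>)"
        by (rule freq_mono) auto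
      also have "\<dots> \<le> freq n (\<lambda>g. h \<otimes> g \<notin> set (X n)) + freq n (\<lambda>g. h \<otimes> g \<in> set (X n) - \<Gamma>)"
        by (rule freq_Un)
      also have "freq n (\<lambda>g. h \<otimes> g \<notin> set (X n)) \<le> \<epsilon> k"
        using freq_escape[OF hE(1)] eps(3)[OF kn] by linarith
      also have "freq n (\<lambda>g. h \<otimes> g \<in> set (X n) - \<Gamma>) \<le> real (card (set (X n) - \<Gamma>)) / real (length (X n))"
        by (rule freq_shift_le[OF hE(2)]) auto
      also have "\<dots> \<le> (6 + 4 * real (card D')) * \<epsilon> k"
        using \<Gamma>(1) X_set(2)[of n] by (simp add: divide_le_eq)
      finally show "freq n (\<lambda>g. h \<otimes> g \<notin> \<Gamma>) \<le> (7 + 4 * real (card D')) * \<epsilon> k"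
        by (simp add: algebra_simps)
    qed simp
    also have "\<dots> = (7 + 4 * real (card D')) * \<epsilon> k * real (card W) * real (length (X n))"
      by simp
    finally show "(\<Sum>g\<in>set (X n). real (err (y (rel_at n g \<inter> DW)))) \<le>
        (7 + 4 * real (card D')) * \<epsilon> k * real (card W) * real (length (X n))" .
  qed
qed

end

context order_law
begin

text \<open>Three costs per element of the window: \<open>\<epsilon> k\<close> for the logarithm of
  the number of codes; the expected fraction of wrong letters, composed of decoding errors and of
  \<open>\<delta>\<close> for replacing \<open>P\<close> by a function of \<open>D\<close>, times
  \<open>ln (card P / \<theta>)\<close>; and \<open>- ln (1 - \<theta>)\<close> for leaving room for
  errors. The hypotheses \<open>V\<close> and \<open>U\<close> hold for windows that are nearly
  invariant under the finitely many elements coming from the shapes.\<close>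

lemma join_entropy_le:
  assumes P: "finite_measurable_partition \<nu> P"
    and D: "finite D" "D \<subseteq> carrier G \<times> carrier G" "D \<subseteq> D' \<times> D'" "D' \<subseteq> E k" "finite D'"
    and bad: "{r \<in> Z_orders G. part_of P r \<noteq> \<phi> (r \<inter> D)} \<in> sets \<nu>"
      "measure \<nu> {r \<in> Z_orders G. part_of P r \<noteq> \<phi> (r \<inter> D)} \<le> \<delta>"
    and W: "finite W" "W \<subseteq> carrier G" "W \<noteq> {}"
    and V: "card (\<Union>d\<in>neighbourhood k. \<Union>w\<in>W. {d \<otimes> w}) \<le> 2 * card W"
    and U: "card (\<Union>d\<in>(\<Union>L\<in>\<L> k. (\<lambda>x. inv x) ` set L). \<Union>w\<in>W. {d \<otimes> w}) \<le> 2 * card W"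
    and \<theta>: "0 < \<theta>" "\<theta> < 1"
  shows "shannon_entropy \<nu> (partition_join \<nu> (order_action G) W P) \<le>
    real (card W) * (\<epsilon> k + ((7 + 4 * real (card D')) * \<epsilon> k + \<delta>) * ln (real (card P) / \<theta>) - ln (1 - \<theta>))"
proof -
  define U' where "U' = (\<Union>L\<in>\<L> k. \<Union>x\<in>set L. \<Union>w\<in>W. {inv x \<otimes> w})"
  define V' where "V' = (\<Union>L\<in>\<L> k. \<Union>x\<in>set L. \<Union>y\<in>set L. \<Union>w\<in>W. {(x \<otimes> inv y) \<otimes> w})"
  have U'c: "card U' \<le> 2 * card W"
  proof -
    have "U' = (\<Union>d\<in>(\<Union>L\<in>\<L> k. (\<lambda>x. inv x) ` set L). \<Union>w\<in>W. {d \<otimes> w})"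
      unfolding U'_def by blast
    then show ?thesis
      using U by simp
  qed
  have V'c: "card V' \<le> 2 * card W"
  proof -
    have "V' = (\<Union>d\<in>neighbourhood k. \<Union>w\<in>W. {d \<otimes> w})"
      unfolding V'_def neighbourhood_def by blast
    then show ?thesis
      using V by simp
  qed
  define \<S> where "\<S> = {S. S \<subseteq> \<L> k \<times> U' \<and> real (N k) * real (card S) \<le> 4 * real (card W)}"
  define \<Psi> where "\<Psi> = decode_pattern D \<phi> ` \<S>"
  define err where "err = (\<lambda>y. Min ((\<lambda>\<psi>. card {h \<in> W. y h \<noteq> \<psi> h}) ` \<Psi>))"
  define DW where "DW = (\<Union>h\<in>W. (\<lambda>(a, b). (a \<otimes> h, b \<otimes> h)) ` D)"
  define y where "y = (\<lambda>v h. \<phi> {(a, b) \<in> D. (a \<otimes> h, b \<otimes> h) \<in> v})"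
  have errs: "(\<Sum>v\<in>Pow DW. real (err (y v)) * measure \<nu> {r \<in> Z_orders G. r \<inter> DW = v}) \<le>
      (7 + 4 * real (card D')) * \<epsilon> k * real (card W)" and fin\<Psi>: "finite \<Psi>" and ne\<Psi>: "\<Psi> \<noteq> {}"
    using expected_errors[OF W V'_def V'c U'_def D(3,4,5), of \<phi>]
    unfolding \<Psi>_def \<S>_def err_def DW_def y_def by blast+
  have finU': "finite U'"
    unfolding U'_def using shapes(1) W by auto
  \<comment> \<open>Positions range over \<open>U'\<close>, at most twice as large as the window, so
    there are at most \<open>2 * card (\<L> k) * card W\<close> possible pairs of shape and
    position, and a code consists of at most \<open>4 * card W / N k\<close> of them.\<close>
  have ln\<Psi>: "ln (real (card \<Psi>)) \<le> \<epsilon> k * real (card W)"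
  proof -
    have "0 < card (\<L> k)"
      using shapes(1,2) by (simp add: card_gt_0_iff)
    moreover have "real (card (\<L> k \<times> U')) \<le> 2 * real (card (\<L> k)) * real (card W)"
    proof -
      have "card (\<L> k \<times> U') \<le> card (\<L> k) * (2 * card W)"
        unfolding card_cartesian_product using U'c by (rule mult_le_mono2)
      then have "real (card (\<L> k \<times> U')) \<le> real (card (\<L> k) * (2 * card W))"
        by (rule of_nat_mono)
      then show ?thesis
        by simp
    qed
    ultimately have "real (card \<S>) \<le> exp ((2 + 4 * ln (real (card (\<L> k)) * real (N k))) / real (N k) * real (card W))"
      unfolding \<S>_def using shapes(1,4) finU' by (intro card_small_subsets_le) auto
    also have "\<dots> \<le> exp (\<epsilon> k * real (card W))"
      using mult_right_mono[OF shapes(5)[of k], of "real (card W)"] by simp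
    finally have "real (card \<S>) \<le> exp (\<epsilon> k * real (card W))" .
    moreover have "finite \<S>"
      unfolding \<S>_def using shapes(1) finU' by auto
    then have "card \<Psi> \<le> card \<S>"
      unfolding \<Psi>_def by (rule card_image_le)
    ultimately have "real (card \<Psi>) \<le> exp (\<epsilon> k * real (card W))"
      by linarith
    moreover have "0 < real (card \<Psi>)"
      using fin\<Psi> ne\<Psi> by (simp add: card_gt_0_iff)
    ultimately have "ln (real (card \<Psi>)) \<le> ln (exp (\<epsilon> k * real (card W)))"
      by (subst ln_le_cancel_iff) auto
    then show ?thesis
      by simp
  qed
  have Pp: "finite P" "P \<subseteq> sets \<nu>" "partition_on (Z_orders G) P"
    using P \<nu>(2) by (auto simp: finite_measurable_partition_def)
  define cell where "cell = (\<lambda>u. {r \<in> space \<nu>. \<forall>h\<in>W. part_of P (order_action G h r) = u h})"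
  define J where "J = {u \<in> W \<rightarrow>\<^sub>E P. cell u \<noteq> {}}"
  have am: "order_action G h \<in> measurable \<nu> \<nu>" if "h \<in> W" for h
    using order_action_measurable that W(2) by blast
  note cells = \<nu>.partition_join_cells[where act = "order_action G", OF P W(1,3) am]
  have join: "partition_join \<nu> (order_action G) W P = cell ` J"
    unfolding J_def cell_def by (rule cells(1))
  have inj: "inj_on cell J"
    unfolding J_def cell_def by (rule cells(2))
  have finJ: "finite J"
    unfolding J_def cell_def by (rule cells(3))
  have cm: "cell u \<in> sets \<nu>" for u
    unfolding cell_def by (rule cells(4))
  have sum1: "(\<Sum>u\<in>J. measure \<nu> (cell u)) = 1"
    unfolding J_def cell_def by (rule cells(5))
  have cell_rep: "(\<lambda>h\<in>W. part_of P (order_action G h r)) \<in> J \<and> r \<in> cell (\<lambda>h\<in>W. part_of P (order_action G h r))"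
    if r: "r \<in> Z_orders G" for r
    using part_of(1)[OF Pp(3) order_action_Z_orders[OF _ r]] W(2) r by (auto simp: J_def cell_def \<nu>(2))
  have Dsh: "{(a, b) \<in> D. (a \<otimes> h, b \<otimes> h) \<in> r \<inter> DW} = order_action G h r \<inter> D" if "h \<in> W" for h r
    using that W(2) D(2) by (auto simp: DW_def order_action_def)
  have DWf: "finite DW"
    using W(1) D(1) by (simp add: DW_def)
  define Bad where "Bad = {r \<in> Z_orders G. part_of P r \<noteq> \<phi> (r \<inter> D)}"
  define Bh where "Bh h = order_action G h -` Bad \<inter> space \<nu>" for h
  have Bm: "Bh h \<in> sets \<nu>" if "h \<in> W" for h
    unfolding Bh_def by (rule measurable_sets[OF am[OF that]]) (use bad(1) in \<open>simp add: Bad_def\<close>)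
  have Bp: "measure \<nu> (Bh h) \<le> \<delta>" if h: "h \<in> W" for h
  proof -
    have "measure \<nu> (Bh h) = measure (distr \<nu> \<nu> (order_action G h)) Bad"
      unfolding Bh_def by (rule measure_distr[OF am[OF h], symmetric]) (use bad(1) in \<open>simp add: Bad_def\<close>)
    then show ?thesis
      using order_action_distr[of h] h W(2) bad(2) by (auto simp: Bad_def)
  qed
  have err_min: "\<exists>\<psi>\<in>\<Psi>. card {h \<in> W. u h \<noteq> \<psi> h} = err u" for u
  proof -
    have "err u \<in> (\<lambda>\<psi>. card {h \<in> W. u h \<noteq> \<psi> h}) ` \<Psi>"
      unfolding err_def using fin\<Psi> ne\<Psi> by (intro Min_in) auto
    then show ?thesis
      by force
  qed
  \<comment> \<open>\<open>err\<close> is the Hamming distance to the set of code words, hence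
    Lipschitz with constant 1.\<close>
  have err_le: "err u \<le> err w + card {h \<in> W. u h \<noteq> w h}" for u w
  proof -
    obtain \<psi> where \<psi>: "\<psi> \<in> \<Psi>" "card {h \<in> W. w h \<noteq> \<psi> h} = err w"
      using err_min by blast
    have "err u \<le> card {h \<in> W. u h \<noteq> \<psi> h}"
      unfolding err_def using fin\<Psi> \<psi>(1) by (intro Min_le) auto
    also have "\<dots> \<le> card ({h \<in> W. w h \<noteq> \<psi> h} \<union> {h \<in> W. u h \<noteq> w h})"
      using W(1) by (intro card_mono) auto
    also have "\<dots> \<le> err w + card {h \<in> W. u h \<noteq> w h}"
      using card_Un_le[of "{h \<in> W. w h \<noteq> \<psi> h}" "{h \<in> W. u h \<noteq> w h}"] \<psi>(2) by simp
    finally show ?thesis .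
  qed
  have Vm: "{r \<in> Z_orders G. r \<inter> DW = v} \<in> sets \<nu>" for v
    using cyl_sets[OF DWf, of "\<lambda>w. w = v"] .
  have intI: "integrable \<nu> (\<lambda>r. c * indicator A r :: real)" if "A \<in> sets \<nu>" for A c
    using that by (intro integrable_mult_right integrable_real_indicator) (auto simp: \<nu>.emeasure_eq_measure)
  have intE: "(\<integral>r. (\<Sum>i\<in>I. c i * indicator (A i) r) \<partial>\<nu>) = (\<Sum>i\<in>I. c i * measure \<nu> (A i))"
    if "\<And>i. i \<in> I \<Longrightarrow> A i \<in> sets \<nu>" for I :: "'i set" and A and c :: "'i \<Rightarrow> real"
  proof (subst Bochner_Integration.integral_sum)
    show "integrable \<nu> (\<lambda>r. c i * indicator (A i) r)" if "i \<in> I" for i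
      using intI \<open>\<And>i. i \<in> I \<Longrightarrow> A i \<in> sets \<nu>\<close> that by blast
    show "(\<Sum>i\<in>I. \<integral>r. c i * indicator (A i) r \<partial>\<nu>) = (\<Sum>i\<in>I. c i * measure \<nu> (A i))"
      using that sets.sets_into_space[of _ \<nu>] by (intro sum.cong) (auto simp: Int_absorb2)
  qed
  \<comment> \<open>The pointwise comparison to be integrated: the error of the true word is at most
    that of the word \<open>y\<close> computed from finitely many pairs, plus the number of
    \<open>h\<close> where the two words differ, which are those with
    \<open>r \<in> Bh h\<close>.\<close>
  let ?lhs = "\<lambda>r. \<Sum>u\<in>J. real (err u) * indicator (cell u) r"
  let ?rhs = "\<lambda>r. (\<Sum>v\<in>Pow DW. real (err (y v)) * indicator {r \<in> Z_orders G. r \<inter> DW = v} r) + (\<Sum>h\<in>W. 1 * indicator (Bh h) r) :: real"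
  have "(\<Sum>u\<in>J. measure \<nu> (cell u) * real (err u)) = (\<integral>r. ?lhs r \<partial>\<nu>)"
    using cm by (subst intE) (auto simp: mult.commute)
  also have "\<dots> \<le> (\<integral>r. ?rhs r \<partial>\<nu>)"
  proof (rule integral_mono)
    fix r assume "r \<in> space \<nu>"
    then have r: "r \<in> Z_orders G"
      by (simp add: \<nu>(2))
    let ?u = "\<lambda>h\<in>W. part_of P (order_action G h r)"
    have "?lhs r = (\<Sum>u\<in>J. if u = ?u then real (err ?u) else 0)"
    proof (rule sum.cong[OF refl])
      fix u assume u: "u \<in> J"
      have "r \<in> cell u \<longleftrightarrow> u = ?u"
      proof
        assume "r \<in> cell u"
        then show "u = ?u"
          using u by (intro PiE_ext[of u W "\<lambda>_. P" ?u]) (use cell_rep[OF r] in \<open>auto simp: J_def cell_def\<close>)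
      qed (use cell_rep[OF r] in simp)
      then show "real (err u) * indicator (cell u) r = (if u = ?u then real (err ?u) else 0)"
        by (auto simp: indicator_def)
    qed
    also have "\<dots> = real (err ?u)"
      using finJ cell_rep[OF r] by simp
    also have "\<dots> \<le> real (err (y (r \<inter> DW))) + real (card {h \<in> W. ?u h \<noteq> y (r \<inter> DW) h})"
      using err_le[of ?u "y (r \<inter> DW)"] by linarith
    also have "real (card {h \<in> W. ?u h \<noteq> y (r \<inter> DW) h}) = (\<Sum>h\<in>W. 1 * indicator (Bh h) r)"
    proof -
      have "?u h \<noteq> y (r \<inter> DW) h \<longleftrightarrow> r \<in> Bh h" if h: "h \<in> W" for h
        unfolding y_def Dsh[OF h] using h W(2) r order_action_Z_orders[OF _ r, of h]
        by (auto simp: Bh_def Bad_def \<nu>(2))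
      then have "{h \<in> W. ?u h \<noteq> y (r \<inter> DW) h} = {h \<in> W. r \<in> Bh h}"
        by blast
      then show ?thesis
        using W(1) by (simp add: indicator_def sum.inter_filter[symmetric] of_bool_def)
    qed
    also have "real (err (y (r \<inter> DW))) = (\<Sum>v\<in>Pow DW. real (err (y v)) * indicator {r \<in> Z_orders G. r \<inter> DW = v} r)"
    proof -
      have "(\<Sum>v\<in>Pow DW. real (err (y v)) * indicator {r \<in> Z_orders G. r \<inter> DW = v} r) =
          (\<Sum>v\<in>Pow DW. if v = r \<inter> DW then real (err (y (r \<inter> DW))) else 0)"
        using r by (intro sum.cong) (auto simp: indicator_def)
      also have "\<dots> = real (err (y (r \<inter> DW)))"
        using DWf by simp
      finally show ?thesis
        by simp
    qed
    finally show "?lhs r \<le> ?rhs r" .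
  qed (intro Bochner_Integration.integrable_add Bochner_Integration.integrable_sum intI cm Vm Bm; assumption)+
  also have "\<dots> = (\<integral>r. (\<Sum>v\<in>Pow DW. real (err (y v)) * indicator {r \<in> Z_orders G. r \<inter> DW = v} r) \<partial>\<nu>) +
      (\<integral>r. (\<Sum>h\<in>W. 1 * indicator (Bh h) r) \<partial>\<nu>)"
    by (intro Bochner_Integration.integral_add Bochner_Integration.integrable_sum intI Vm Bm)
  also have "\<dots> = (\<Sum>v\<in>Pow DW. real (err (y v)) * measure \<nu> {r \<in> Z_orders G. r \<inter> DW = v}) + (\<Sum>h\<in>W. 1 * measure \<nu> (Bh h))"
    using Vm Bm by (intro arg_cong2[where f = "(+)"] intE)
  also have "\<dots> = (\<Sum>v\<in>Pow DW. real (err (y v)) * measure \<nu> {r \<in> Z_orders G. r \<inter> DW = v}) + (\<Sum>h\<in>W. measure \<nu> (Bh h))"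
    by simp
  also have "\<dots> \<le> (7 + 4 * real (card D')) * \<epsilon> k * real (card W) + (\<Sum>h\<in>W. \<delta>)"
    by (intro add_mono errs sum_mono Bp)
  also have "\<dots> = ((7 + 4 * real (card D')) * \<epsilon> k + \<delta>) * real (card W)"
    by (simp add: algebra_simps)
  finally have esum: "(\<Sum>u\<in>J. measure \<nu> (cell u) * real (err u)) \<le> ((7 + 4 * real (card D')) * \<epsilon> k + \<delta>) * real (card W)" .
  have "shannon_entropy \<nu> (partition_join \<nu> (order_action G) W P) = - (\<Sum>u\<in>J. measure \<nu> (cell u) * ln (measure \<nu> (cell u)))"
    unfolding shannon_entropy_def join using sum.reindex[OF inj] by simp
  also have "\<dots> \<le> ln (real (card \<Psi>)) +
      real (card W) * (((7 + 4 * real (card D')) * \<epsilon> k + \<delta>) * ln (real (card P) / \<theta>) - ln (1 - \<theta>))"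
  proof (rule entropy_word_bound[where u = "\<lambda>u. u" and e = "\<lambda>u. real (err u)", OF finJ _ sum1 W(1) _ Pp(1) _ _ fin\<Psi> _ esum \<theta>])
    show "inj_on (\<lambda>u. restrict u W) J"
      by (intro inj_onI) (auto simp: J_def restrict_PiE_iff PiE_restrict)
    have "J \<noteq> {}"
      using sum1 by auto
    then show "P \<noteq> {}"
      using W(3) by (auto simp: J_def PiE_eq_empty_iff)
    show "u h \<in> P" if "u \<in> J" "h \<in> W" for u h
      using that by (auto simp: J_def)
    show "\<exists>\<psi>\<in>\<Psi>. real (card {h \<in> W. u h \<noteq> \<psi> h}) \<le> real (err u)" for u
    proof -
      obtain \<psi> where "\<psi> \<in> \<Psi>" "card {h \<in> W. u h \<noteq> \<psi> h} = err u"
        using err_min[of u] by blast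
      then show ?thesis
        by (intro bexI[of _ \<psi>]) auto
    qed
  qed simp
  finally show ?thesis
    using ln\<Psi> by (simp add: algebra_simps)
qed

end

section \<open>Entropy along Folner sequences\<close>

context group begin

lemma folner_escape:
  assumes F: "folner_sequence G F" and g: "g \<in> carrier G" and e: "0 < (e::real)"
  shows "eventually (\<lambda>n. real (card (escape g (F n))) \<le> e * real (card (F n))) sequentially"
proof -
  have Fn: "finite (F n)" "F n \<noteq> {}" "F n \<subseteq> carrier G" for n
    using F by (auto simp: folner_sequence_def)
  have esc: "real (card (escape g (F n))) = real (card (F n)) - real (card (F n \<inter> (g <# F n)))" for n
  proof -
    have "F n \<inter> (g <# F n) = (\<lambda>x. g \<otimes> x) ` {x \<in> F n. g \<otimes> x \<in> F n}"
      by (auto simp: l_coset_def)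
    moreover have "inj_on (\<lambda>x. g \<otimes> x) {x \<in> F n. g \<otimes> x \<in> F n}"
      using Fn(3) g by (intro inj_on_ltrans) auto
    ultimately have "card (F n \<inter> (g <# F n)) = card {x \<in> F n. g \<otimes> x \<in> F n}"
      by (simp add: card_image)
    moreover have "card (F n) = card (escape g (F n) \<union> {x \<in> F n. g \<otimes> x \<in> F n})"
      by (rule arg_cong[where f = card]) (auto simp: escape_def)
    moreover have "\<dots> = card (escape g (F n)) + card {x \<in> F n. g \<otimes> x \<in> F n}"
      using Fn(1) by (intro card_Un_disjoint) (auto simp: escape_def)
    ultimately show ?thesis
      by simp
  qed
  have "(\<lambda>n. real (card (F n \<inter> (g <# F n))) / real (card (F n))) \<longlonglongrightarrow> 1"
    using F g by (simp add: folner_sequence_def)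
  then have "eventually (\<lambda>n. 1 - e < real (card (F n \<inter> (g <# F n))) / real (card (F n))) sequentially"
    using e by (intro order_tendstoD) auto
  then show ?thesis
  proof eventually_elim
    case (elim n)
    have "0 < real (card (F n))"
      using Fn by (simp add: card_gt_0_iff)
    then have "(1 - e) * real (card (F n)) < real (card (F n \<inter> (g <# F n)))"
      using elim by (simp add: less_divide_eq)
    then show ?case
      unfolding esc by (simp add: left_diff_distrib)
  qed
qed

lemma folner_sequence_almost_inv:
  assumes F: "folner_sequence G F" and K: "finite K" "K \<subseteq> carrier G" and e: "0 < (e::real)"
  shows "eventually (\<lambda>n. almost_inv K e (F n)) sequentially"
proof -
  have "eventually (\<lambda>n. \<forall>g\<in>K. real (card (escape g (F n))) \<le> e * real (card (F n))) sequentially"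
    using folner_escape[OF F _ e] K by (auto simp: eventually_ball_finite_distrib)
  then show ?thesis
    using F by (auto simp: almost_inv_def folner_sequence_def elim!: eventually_mono)
qed

text \<open>A product outside \<open>A\<close> is the image of an escaping point. Summed over
  \<open>K\<close>, the escape counts stay below \<open>card A\<close>.\<close>

lemma almost_inv_product_card:
  assumes A: "almost_inv K (1 / (1 + real (card K))) A" and K: "finite K" "K \<subseteq> carrier G"
  shows "card (\<Union>d\<in>K. \<Union>w\<in>A. {d \<otimes> w}) \<le> 2 * card A"
proof -
  have Af: "finite A" "A \<subseteq> carrier G"
    using A by (auto simp: almost_inv_def)
  have "(\<Union>d\<in>K. \<Union>w\<in>A. {d \<otimes> w}) \<subseteq> A \<union> (\<Union>d\<in>K. (\<lambda>x. d \<otimes> x) ` escape d A)"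
    by (auto simp: escape_def)
  then have "card (\<Union>d\<in>K. \<Union>w\<in>A. {d \<otimes> w}) \<le> card (A \<union> (\<Union>d\<in>K. (\<lambda>x. d \<otimes> x) ` escape d A))"
    using Af(1) K(1) by (intro card_mono) (auto simp: escape_def)
  also have "\<dots> \<le> card A + (\<Sum>d\<in>K. card ((\<lambda>x. d \<otimes> x) ` escape d A))"
    by (intro order_trans[OF card_Un_le] add_left_mono card_UN_le K(1))
  also have "\<dots> \<le> card A + (\<Sum>d\<in>K. card (escape d A))"
    using Af(1) by (intro add_left_mono sum_mono card_image_le) (auto simp: escape_def)
  finally have "real (card (\<Union>d\<in>K. \<Union>w\<in>A. {d \<otimes> w})) \<le> real (card A) + (\<Sum>d\<in>K. real (card (escape d A)))"
    by (simp only: of_nat_add[symmetric] of_nat_sum[symmetric] of_nat_le_iff)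
  also have "\<dots> \<le> real (card A) + (\<Sum>d\<in>K. 1 / (1 + real (card K)) * real (card A))"
    using A by (intro add_left_mono sum_mono) (auto simp: almost_inv_def)
  also have "\<dots> \<le> 2 * real (card A)"
    by (simp add: field_simps)
  finally show ?thesis
    by linarith
qed

end

context order_law
begin

lemma shannon_entropy_nonneg: "0 \<le> shannon_entropy \<nu> Q"
proof -
  have "measure \<nu> A * ln (measure \<nu> A) \<le> 0" for A
  proof (cases "measure \<nu> A = 0")
    case False
    then have "ln (measure \<nu> A) \<le> 0"
      using \<nu>.prob_le_1[of A] measure_nonneg[of \<nu> A] by (subst ln_le_zero_iff) linarith+
    then show ?thesis
      by (simp add: mult_nonneg_nonpos)
  qed simp
  then show ?thesis
    unfolding shannon_entropy_def by (simp add: sum_nonpos)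
qed

text \<open>The order of the choices matters: \<open>\<theta>\<close> with
  \<open>- ln (1 - \<theta>) = \<gamma> / 8\<close>; then \<open>\<delta>\<close> with
  \<open>\<delta> * c \<le> \<gamma> / 8\<close>; then \<open>D\<close>, which describes
  \<open>P\<close> up to \<open>\<delta>\<close>; then \<open>k\<close> with
  \<open>\<epsilon> k < \<gamma> / 8\<close> and decoding errors at most \<open>\<delta>\<close>.
  The three costs are at most \<open>\<gamma> / 8 + \<gamma> / 4 + \<gamma> / 8\<close>. Only the
  invariance of the window then depends on \<open>n\<close>.\<close>

lemma entropy_tendsto_0:
  assumes F: "folner_sequence G F" and P: "finite_measurable_partition \<nu> P"
  shows "(\<lambda>n. shannon_entropy \<nu> (partition_join \<nu> (order_action G) (F n) P) / real (card (F n))) \<longlonglongrightarrow> 0"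
proof (rule tendstoI)
  fix \<gamma> :: real assume \<gamma>: "0 < \<gamma>"
  have Fn: "finite (F n)" "F n \<noteq> {}" "F n \<subseteq> carrier G" for n
    using F by (auto simp: folner_sequence_def)
  have Pp: "finite P" "partition_on (space \<nu>) P"
    using P by (auto simp: finite_measurable_partition_def)
  have "P \<noteq> {}"
    using Pp(2) \<nu>.not_empty by (auto simp: partition_on_def)
  then have cP: "1 \<le> real (card P)"
    using Pp(1) by (simp add: Suc_leI card_gt_0_iff)
  define \<theta> where "\<theta> = 1 - exp (- (\<gamma> / 8))"
  have \<theta>: "0 < \<theta>" "\<theta> < 1" "ln (1 - \<theta>) = - (\<gamma> / 8)"
    using \<gamma> by (auto simp: \<theta>_def)
  define c where "c = ln (real (card P) / \<theta>)"
  have c: "0 \<le> c"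
    using \<theta> cP by (simp add: c_def field_simps)
  define \<delta> where "\<delta> = \<gamma> / (8 * (1 + c))"
  have \<delta>: "0 < \<delta>" "\<delta> * c \<le> \<gamma> / 8"
    using \<gamma> c by (auto simp: \<delta>_def field_simps)
  obtain D \<phi> where D: "finite D" "D \<subseteq> carrier G \<times> carrier G"
    "{r \<in> Z_orders G. part_of P r \<noteq> \<phi> (r \<inter> D)} \<in> sets \<nu>"
    "measure \<nu> {r \<in> Z_orders G. part_of P r \<noteq> \<phi> (r \<inter> D)} \<le> \<delta>"
    by (rule partition_approximation[OF P \<delta>(1)])
  define D' where "D' = fst ` D \<union> snd ` D"
  have D': "finite D'" "D' \<subseteq> carrier G" "D \<subseteq> D' \<times> D'"
    using D by (force simp: D'_def)+
  obtain k1 where k1: "\<And>j. k1 \<le> j \<Longrightarrow> D' \<subseteq> E j"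
    using in_E_eventually[OF D'(1,2)] by blast
  have m: "0 < min (\<gamma> / 8) (\<delta> / (7 + 4 * real (card D')))"
    using \<gamma> \<delta> by (simp add: add_pos_nonneg)
  obtain k2 where k2: "\<And>j. k2 \<le> j \<Longrightarrow> \<epsilon> j < min (\<gamma> / 8) (\<delta> / (7 + 4 * real (card D')))"
    using eps_eventually[OF m] by blast
  define k where "k = max k1 k2"
  have DE: "D' \<subseteq> E k"
    using k1 by (simp add: k_def)
  have ek: "\<epsilon> k < min (\<gamma> / 8) (\<delta> / (7 + 4 * real (card D')))"
    using k2[of k] by (simp add: k_def)
  have "0 < 7 + 4 * real (card D')"
    by simp
  then have ek2: "(7 + 4 * real (card D')) * \<epsilon> k \<le> \<delta>"
    using ek by (simp add: field_simps)
  define K1 where "K1 = (\<Union>L\<in>\<L> k. (\<lambda>x. inv x) ` set L)"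
  have K1: "finite K1" "K1 \<subseteq> carrier G"
    using shapes(1)[of k] shapes(3)[of _ k] by (auto simp: K1_def almost_inv_def subset_iff)
  have "eventually (\<lambda>n. almost_inv (neighbourhood k) (1 / (1 + real (card (neighbourhood k)))) (F n)) sequentially"
    by (rule folner_sequence_almost_inv[OF F neighbourhood]) (simp add: add_pos_nonneg)
  moreover have "eventually (\<lambda>n. almost_inv K1 (1 / (1 + real (card K1))) (F n)) sequentially"
    by (rule folner_sequence_almost_inv[OF F K1]) (simp add: add_pos_nonneg)
  ultimately show "eventually (\<lambda>n. dist (shannon_entropy \<nu> (partition_join \<nu> (order_action G) (F n) P) / real (card (F n))) 0 < \<gamma>) sequentially"
  proof eventually_elim
    case (elim n)
    have cF: "0 < real (card (F n))"
      using Fn by (simp add: card_gt_0_iff)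
    have "shannon_entropy \<nu> (partition_join \<nu> (order_action G) (F n) P) \<le>
        real (card (F n)) * (\<epsilon> k + ((7 + 4 * real (card D')) * \<epsilon> k + \<delta>) * c - ln (1 - \<theta>))"
      unfolding c_def
      by (rule join_entropy_le[OF P D(1,2) D'(3) DE D'(1) D(3,4) Fn(1,3,2) almost_inv_product_card[OF elim(1) neighbourhood]
            almost_inv_product_card[OF elim(2) K1, unfolded K1_def] \<theta>(1,2)])
    also have "\<dots> < real (card (F n)) * \<gamma>"
    proof (rule mult_strict_left_mono[OF _ cF])
      have "((7 + 4 * real (card D')) * \<epsilon> k + \<delta>) * c \<le> (2 * \<delta>) * c"
        using ek2 c by (intro mult_right_mono) auto
      then show "\<epsilon> k + ((7 + 4 * real (card D')) * \<epsilon> k + \<delta>) * c - ln (1 - \<theta>) < \<gamma>"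
        using \<theta>(3) \<delta>(2) ek \<gamma> by linarith
    qed
    finally show ?case
      using cF shannon_entropy_nonneg by (simp add: divide_less_eq mult.commute)
  qed
qed

lemma has_ks_entropy_\<nu>: "has_ks_entropy G \<nu> (order_action G) 0"
  unfolding has_ks_entropy_def
proof (intro allI impI exI[of _ "\<lambda>_. 0"] conjI)
  show "(\<lambda>n. shannon_entropy \<nu> (partition_join \<nu> (order_action G) (F n) P) / real (card (F n))) \<longlonglongrightarrow> 0"
    if "folner_sequence G F" "finite_measurable_partition \<nu> P" for F P
    using entropy_tendsto_0[OF that] .
  \<comment> \<open>The trivial partition makes the index set of the supremum nonempty; over the
    empty set it would be \<open>-\<infinity>\<close> instead of 0.\<close>
  have "finite_measurable_partition \<nu> {space \<nu>}"
    using \<nu>.not_empty by (auto simp: finite_measurable_partition_def partition_on_def disjoint_def)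
  then have "{P. finite_measurable_partition \<nu> P} \<noteq> {}"
    by blast
  then show "0 = (SUP P\<in>{P. finite_measurable_partition \<nu> P}. ereal 0)"
    by (simp add: zero_ereal_def)
qed

end

section \<open>Existence of the multiorder\<close>

lemma (in tiled_group) zero_entropy_multiorder:
  "\<exists>\<nu>. multiorder G \<nu> \<and> uniformly_folner G \<nu> \<and> has_ks_entropy G \<nu> (order_action G) 0"
proof (rule cylinder_limit[of "carrier G \<times> carrier G" "\<lambda>n. map_pmf (rel_at n) (pmf_of_set (set (X n)))"])
  show "countable (carrier G \<times> carrier G)" "infinite (carrier G \<times> carrier G)"
    using countable_carrier infinite_carrier by (auto simp: finite_cartesian_product_iff)
  fix s M R
  assume lim: "strict_mono s" "real_distribution M" "\<And>x. R x \<subseteq> carrier G \<times> carrier G"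
    "\<And>D Q. finite D \<Longrightarrow> {x. Q (R x \<inter> D)} \<in> sets borel"
    "\<And>D Q. finite D \<Longrightarrow> D \<subseteq> carrier G \<times> carrier G \<Longrightarrow>
       (\<lambda>n. measure_pmf.prob (map_pmf (rel_at (s n)) (pmf_of_set (set (X (s n))))) {r. Q (r \<inter> D)})
         \<longlonglongrightarrow> measure M {x. Q (R x \<inter> D)}"
  interpret limit_law G E \<epsilon> \<L> N X s M R
    by (intro limit_law.intro limit_law_axioms.intro tiled_group_axioms) (fact lim lim(5)[unfolded prob_rel_at])+
  show ?thesis
  proof (rule exists_order_measure)
    fix \<nu>
    assume \<nu>: "prob_space \<nu>" "space \<nu> = Z_orders G" "sets \<nu> = sets (Z_order_space G)"
      "\<And>D Q. finite D \<Longrightarrow> measure \<nu> {r \<in> Z_orders G. Q (r \<inter> D)} = measure M {x. Q (R x \<inter> D)}"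
    interpret order_law G E \<epsilon> \<L> N X s M R \<nu>
      by (intro order_law.intro order_law_axioms.intro limit_law_axioms) (fact \<nu>)+
    show ?thesis
      using multiorder_\<nu> uniformly_folner_\<nu> has_ks_entropy_\<nu> by blast
  qed
qed

theorem corollaryB7:
  fixes G :: "('a, 'b) monoid_scheme"
  assumes "countable_amenable_group G"
  shows "\<exists>\<nu>. multiorder G \<nu> \<and> uniformly_folner G \<nu> \<and> has_ks_entropy G \<nu> (order_action G) 0"
proof -
  obtain F where G: "group G" "infinite (carrier G)" "countable (carrier G)" and F: "folner_sequence G F"
    using assms by (auto simp: countable_amenable_group_def)
  interpret group G
    by (rule G)
  have fol: "\<exists>B. almost_inv K e B" if "finite K" "K \<subseteq> carrier G" "0 < (e::real)" for K e
    using folner_sequence_almost_inv[OF F that] by (auto simp: eventually_sequentially)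
  define E where "E k = from_nat_into (carrier G) ` {..k}" for k
  have ne: "carrier G \<noteq> {}"
    using G(2) by auto
  have E: "finite (E k)" "E k \<subseteq> carrier G" "k \<le> n \<Longrightarrow> E k \<subseteq> E n" "(\<Union>k. E k) = carrier G" for k n
  proof -
    show "E k \<subseteq> carrier G"
      using from_nat_into[OF ne] by (auto simp: E_def)
    show "(\<Union>k. E k) = carrier G"
    proof
      show "carrier G \<subseteq> (\<Union>k. E k)"
        using from_nat_into_surj[OF G(3)] by (fastforce simp: E_def)
    qed (use from_nat_into[OF ne] in \<open>auto simp: E_def\<close>)
  qed (auto simp: E_def)
  \<comment> \<open>The shift by 4 gives the bound 1/4 from level 0 on.\<close>
  define \<epsilon> where "\<epsilon> k = 1 / (real k + 4)" for k
  have \<epsilon>: "0 < \<epsilon> k" "\<epsilon> k \<le> 1/4" "k \<le> n \<Longrightarrow> \<epsilon> n \<le> \<epsilon> k" for k n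
    by (auto simp: \<epsilon>_def field_simps)
  have \<epsilon>lim: "\<epsilon> \<longlonglongrightarrow> 0"
    unfolding \<epsilon>_def by real_asymp
  show ?thesis
  proof (rule tile_hierarchy[of E \<epsilon>, OF fol G(2) E(1,2) \<epsilon>(1,2)])
    fix \<L> N X
    assume tiles: "\<And>k. finite (\<L> k)" "\<And>k. \<L> k \<noteq> {}"
      "\<And>k L. L \<in> \<L> k \<Longrightarrow> distinct L \<and> almost_inv (E k) (\<epsilon> k) (set L) \<and> N k \<le> length L"
      "\<And>k. 0 < N k" "\<And>k. (2 + 4 * ln (real (card (\<L> k)) * real (N k))) / real (N k) \<le> \<epsilon> k"
      "\<And>n. distinct (X n)" "\<And>n. almost_inv (E n) (\<epsilon> n) (set (X n))"
      "\<And>k n. k \<le> n \<Longrightarrow> \<exists>Ts. X n = concat Ts \<and> (\<forall>T\<in>set Ts. approx_tile (\<L> k) (\<epsilon> k) T)"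
    interpret tiled_group G E \<epsilon> \<L> N X
      by unfold_locales (fact G E \<epsilon> \<epsilon>lim tiles)+
    show ?thesis
      by (rule zero_entropy_multiorder)
  qed
qed

end
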